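(* Let $F$ and $P$ be Euclidean Coxeter polytopes in $\mathbb{E}^n$. A Euclidean Coxeter polytope $T$ satisfying $\Sigma(T)=\Sigma(P)$ and $G_T\subset G_F$ exists if and only if there exists an embedding of $G'_P$ into $G'_F$.
   Context: A Euclidean Coxeter polytope is a finite volume convex polytope in $\mathbb{E}^n$ all of whose dihedral angles are integer submultiples of $\pi$; it is a direct product of Euclidean simplices (indecomposable factors). $G_P$ denotes the discrete group generated by the reflections in the facets of $P$. The Coxeter diagram $\Sigma(P)$ has one node for each facet; two nodes are joined by an $(m-2)$-fold edge if the facets form the angle $\pi/m$ (no edge if orthogonal), and by a bold edge if the facets are parallel. A vertex $V$ of $P$ is special if the stabilizer of $V$ in $G_P$ contains the linear parts of all elements of $G_P$; such a vertex always exists. $G'_P$ is the finite group generated by the reflections in the facets of $P$ containing a special vertex $V$ of $P$, i.e. the stabilizer of $V$ in $G_P$; up to isomorphism of reflection groups it does not depend on the choice of $V$. Embeddings of $G'_P$ into $G'_F$ are understood as embeddings of reflection groups, i.e. injective homomorphisms taking reflections to reflections. *)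

theory Defs
  imports "HOL-Analysis.Analysis" "HOL-Algebra.Elementary_Groups" "HOL-Algebra.Bij"
begin

definition facets :: "'a::euclidean_space set \<Rightarrow> 'a set set" where
  "facets P = {f. f facet_of P}"

text \<open>
  The condition that \<open>f \<inter> g\<close> is nonempty matters in dimension 1, where
  \<open>aff_dim {} = - 1 = aff_dim P - 2\<close>.
\<close>

definition adjacent_facets :: "'a::euclidean_space set \<Rightarrow> 'a set \<Rightarrow> 'a set \<Rightarrow> bool" where
  "adjacent_facets P f g \<longleftrightarrow>
     f \<in> facets P \<and> g \<in> facets P \<and> f \<noteq> g \<and> f \<inter> g \<noteq> {} \<and> aff_dim (f \<inter> g) = aff_dim P - 2"

definition outer_normal :: "'a::euclidean_space set \<Rightarrow> 'a set \<Rightarrow> 'a" where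
  "outer_normal P f =
     (THE u. norm u = 1 \<and> (\<exists>b. P \<subseteq> {x. u \<bullet> x \<le> b} \<and> f = P \<inter> {x. u \<bullet> x = b}))"

text \<open>The dihedral angle is the interior one, hence supplementary to the angle between
  the outer normals.\<close>

definition dihedral_angle :: "'a::euclidean_space set \<Rightarrow> 'a set \<Rightarrow> 'a set \<Rightarrow> real" where
  "dihedral_angle P f g = pi - arccos (outer_normal P f \<bullet> outer_normal P g)"

definition euclidean_coxeter_polytope :: "'a::euclidean_space set \<Rightarrow> bool" where
  "euclidean_coxeter_polytope P \<longleftrightarrow>
     polyhedron P \<and> interior P \<noteq> {} \<and> emeasure lborel P < \<infinity> \<and>
     (\<forall>f g. adjacent_facets P f g \<longrightarrow> (\<exists>m::nat. m \<ge> 2 \<and> dihedral_angle P f g = pi / real m))"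

text \<open>
  The label is the multiplicity of the edge joining two distinct nodes: \<open>\<infinity>\<close> stands for
  a bold edge, \<open>0\<close> for no edge, and two facets forming the angle \<open>pi / m\<close> get the
  label \<open>m - 2\<close>. In a Euclidean Coxeter polytope two distinct facets are either adjacent or
  parallel, so that the second branch is only used for adjacent facets.
\<close>

definition coxeter_edge :: "'a::euclidean_space set \<Rightarrow> 'a set \<Rightarrow> 'a set \<Rightarrow> enat" where
  "coxeter_edge P f g =
     (if affine_parallel (affine hull f) (affine hull g) then \<infinity>
      else enat ((THE m. m \<ge> 2 \<and> dihedral_angle P f g = pi / real m) - 2))"

text \<open>Coxeter diagrams are compared up to isomorphism of labelled graphs.\<close>

definition same_coxeter_diagram :: "'a::euclidean_space set \<Rightarrow> 'a set \<Rightarrow> bool" where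
  "same_coxeter_diagram P Q \<longleftrightarrow>
     (\<exists>\<pi>. bij_betw \<pi> (facets P) (facets Q) \<and>
       (\<forall>f \<in> facets P. \<forall>g \<in> facets P. f \<noteq> g \<longrightarrow>
          coxeter_edge Q (\<pi> f) (\<pi> g) = coxeter_edge P f g))"

definition reflection_in :: "'a::euclidean_space set \<Rightarrow> 'a \<Rightarrow> 'a" where
  "reflection_in H x = 2 *\<^sub>R closest_point H x - x"

definition is_reflection :: "('a::euclidean_space \<Rightarrow> 'a) \<Rightarrow> bool" where
  "is_reflection r \<longleftrightarrow> (\<exists>u b. u \<noteq> 0 \<and> r = reflection_in {x. u \<bullet> x = b})"

definition reflection_group_of :: "'a::euclidean_space set set \<Rightarrow> ('a \<Rightarrow> 'a) monoid" where
  "reflection_group_of \<F> =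
     subgroup_generated (BijGroup UNIV) ((\<lambda>f. reflection_in (affine hull f)) ` \<F>)"

definition coxeter_group :: "'a::euclidean_space set \<Rightarrow> ('a \<Rightarrow> 'a) monoid" where
  "coxeter_group P = reflection_group_of (facets P)"

definition vertex_group :: "'a::euclidean_space set \<Rightarrow> 'a \<Rightarrow> ('a \<Rightarrow> 'a) monoid" where
  "vertex_group P V = reflection_group_of {f \<in> facets P. V \<in> f}"

definition linear_part :: "('a::euclidean_space \<Rightarrow> 'a) \<Rightarrow> 'a \<Rightarrow> 'a" where
  "linear_part g = (\<lambda>x. g x - g 0)"

text \<open>
  The stabilizer of \<open>V\<close> is identified with a group of linear maps by taking \<open>V\<close> as the origin;
  it contains the linear part of \<open>g\<close> iff some element fixing \<open>V\<close> has the same linear part.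
\<close>

definition special_vertex :: "'a::euclidean_space set \<Rightarrow> 'a \<Rightarrow> bool" where
  "special_vertex P V \<longleftrightarrow>
     V extreme_point_of P \<and>
     linear_part ` carrier (coxeter_group P)
       \<subseteq> linear_part ` {h \<in> carrier (coxeter_group P). h V = V}"

definition reflection_group_embedding ::
    "('a::euclidean_space \<Rightarrow> 'a) monoid \<Rightarrow> ('a \<Rightarrow> 'a) monoid \<Rightarrow>
     (('a \<Rightarrow> 'a) \<Rightarrow> ('a \<Rightarrow> 'a)) \<Rightarrow> bool" where
  "reflection_group_embedding G H \<phi> \<longleftrightarrow>
     \<phi> \<in> mon G H \<and> (\<forall>r \<in> carrier G. is_reflection r \<longrightarrow> is_reflection (\<phi> r))"

end

theory Submission
  imports Defs
begin

text \<open>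
  The normals of a Coxeter polytope have pairwise nonpositive products and two facets that are not
  parallel are adjacent, so the Coxeter diagram determines the Gram matrix of the normals. If
  \<open>\<Sigma>(T) = \<Sigma>(P)\<close> and \<open>G\<^sub>T \<subseteq> G\<^sub>F\<close>, there is hence an isometry that carries the mirrors of \<open>P\<close> at \<open>V\<close> to mirrors
  of \<open>T\<close> up to translation; as \<open>W\<close> is special, the parallel reflections at \<open>W\<close> belong to \<open>G\<^sub>F\<close>, and Tits'
  theorem on stabilizers puts them into \<open>G'\<^sub>F\<close>.

  Conversely, a special vertex makes the translations in \<open>G\<^sub>F\<close> a lattice of full rank, and the
  crystallographic restriction implies that an embedding \<open>\<phi>\<close> of \<open>G'\<^sub>P\<close> into \<open>G'\<^sub>F\<close> preserves the products of
  the unit normals at \<open>V\<close> up to sign. The signs can be corrected because the Coxeter graph of \<open>G'\<^sub>P\<close> is a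
  forest, so \<open>\<phi>\<close> may be replaced by conjugation with an isometry. The facets of \<open>P\<close> missing \<open>V\<close> belong to
  different orthogonal factors of \<open>P\<close>; after rescaling the factors independently, the mirrors of these
  facets become mirrors of \<open>G\<^sub>F\<close>, since \<open>G\<^sub>F\<close> contains translations along every root.
\<close>

section \<open>Tits' theorem for chambers of affine reflections\<close>

text \<open>An embedding that respects reflections preserves only the orders of products of two
  reflections, and order m allows every angle k \<pi> / m with k coprime to m. For m = 5 this is a
  real obstacle: the dihedral group of order 10 has automorphisms that keep reflections but exchange
  the angles \<pi> / 5 and 2 \<pi> / 5. Integrality of
  \<open>4 * (\<theta> \<bullet> \<eta>)\<^sup>2\<close>, obtained from translations along the
  roots, leaves the orders 2, 3, 4 and 6, where the order fixes the cosine up to sign. The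
  decomposition of a polytope into simplices is not carried out. A self-adjoint map with all facet
  normals as eigenvectors takes its place: composed with an isometry it changes the distances of the
  facets from V but not the angles between them. The group theory rests on a purely angular notion
  of chamber, without assuming discreteness. Tits' length argument yields both the generators of
  point stabilizers and the discreteness of the translations.\<close>

definition hrefl :: "'a::euclidean_space \<Rightarrow> real \<Rightarrow> 'a \<Rightarrow> 'a" where
  "hrefl u b x = x - (2 * (u \<bullet> x - b)) *\<^sub>R u"

lemma pi_over_bounds:
  assumes "m \<ge> 2" shows "0 < pi / real m" "pi / real m \<le> pi / 2" "pi / real m \<le> pi"
proof -
  show "0 < pi / real m" using assms by simp
  show 1: "pi / real m \<le> pi / 2" using assms by (intro divide_left_mono) auto
  have "pi / 2 \<le> pi" by simp
  with 1 show "pi / real m \<le> pi" by (rule order_trans)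
qed

lemma cos_pi_over_nonneg:
  assumes "m \<ge> 2" shows "0 \<le> cos (pi / real m)"
proof -
  have "- (pi / 2) \<le> pi / real m" by (rule order_trans[of _ 0]) simp_all
  then show ?thesis using pi_over_bounds(2)[OF assms] by (rule cos_ge_zero)
qed

section \<open>Alternating words and Chebyshev polynomials\<close>

fun alternating :: "'i \<Rightarrow> 'i \<Rightarrow> nat \<Rightarrow> 'i list" where
  "alternating s t 0 = []"
| "alternating s t (Suc k) = s # alternating t s k"

lemma length_alternating [simp]: "length (alternating s t k) = k"
  by (induction k arbitrary: s t) auto

lemma alternating_in_lists: "s \<in> I \<Longrightarrow> t \<in> I \<Longrightarrow> alternating s t k \<in> lists I"
  by (induction k arbitrary: s t) auto

lemma alternating_add:
  "alternating s t (m + k) =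
     alternating s t m @ (if even m then alternating s t k else alternating t s k)"
  by (induction m arbitrary: s t) auto

text \<open>Chebyshev polynomials of the second kind, with the index shifted by one.\<close>

fun cheb :: "real \<Rightarrow> nat \<Rightarrow> real" where
  "cheb c 0 = 0"
| "cheb c (Suc 0) = 1"
| "cheb c (Suc (Suc k)) = 2 * c * cheb c (Suc k) - cheb c k"

lemma cheb_1: "cheb 1 k = real k"
  by (induction k rule: induct_nat_012) auto

lemma cheb_cos: "cheb (cos \<theta>) k * sin \<theta> = sin (real k * \<theta>)"
proof (induction k rule: induct_nat_012)
  case (ge2 k)
  have eqs: "real (Suc (Suc k)) * \<theta> = real (Suc k) * \<theta> + \<theta>"
    "real k * \<theta> = real (Suc k) * \<theta> - \<theta>"
    by (simp_all add: algebra_simps)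
  have "cheb (cos \<theta>) (Suc (Suc k)) * sin \<theta>
      = 2 * cos \<theta> * (cheb (cos \<theta>) (Suc k) * sin \<theta>) - cheb (cos \<theta>) k * sin \<theta>"
    by (simp add: left_diff_distrib)
  also have "\<dots> = 2 * cos \<theta> * sin (real (Suc k) * \<theta>) - sin (real (Suc k) * \<theta> - \<theta>)"
    unfolding ge2 eqs(2)[symmetric] ..
  also have "\<dots> = sin (real (Suc k) * \<theta> + \<theta>)"
    unfolding sin_add sin_diff by simp
  finally show ?case unfolding eqs(1) .
qed auto

text \<open>By \<open>cheb_cos\<close> the value at k is sin (k \<pi> / m) / sin (\<pi> / m),
  nonnegative up to k = m, where it vanishes. These values are the coefficients with which a
  two-letter word acts on depths, and the zero at m produces the braid relation.\<close>

lemma cheb_cos_pi: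
  assumes "m \<ge> 2"
  shows "cheb (cos (pi / real m)) m = 0" "cheb (cos (pi / real m)) (m - 1) = 1"
    "cheb (cos (pi / real m)) (Suc m) = - 1"
    "k \<le> m \<Longrightarrow> cheb (cos (pi / real m)) k \<ge> 0"
proof -
  let ?t = "pi / real m"
  have t: "0 < ?t" "?t < pi" using assms by (auto simp: divide_less_eq)
  have sp: "sin ?t > 0" using t by (intro sin_gt_zero)
  note c = cheb_cos[of ?t]
  show 0: "cheb (cos ?t) m = 0" using c[of m] sp assms by auto
  have "sin (real (m - 1) * ?t) = sin (pi - ?t)" using assms
    by (simp add: of_nat_diff field_simps)
  then have "cheb (cos ?t) (m - 1) * sin ?t = 1 * sin ?t" using c[of "m-1"] by simp
  then show 1: "cheb (cos ?t) (m - 1) = 1" using sp by simp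
  obtain k' where "m = Suc k'" using assms by (cases m) auto
  then show "cheb (cos ?t) (Suc m) = - 1" using 0 1 by simp
  assume "k \<le> m"
  then have "real k * ?t \<le> real m * ?t" using t by (intro mult_right_mono) auto
  also have "... = pi" using assms by simp
  finally have "sin (real k * ?t) \<ge> 0" using t by (intro sin_ge_zero) auto
  then show "cheb (cos ?t) k \<ge> 0" using c[of k] sp by (metis zero_le_mult_iff not_less order_less_imp_le)
qed

text \<open>Product -1 means that two walls face each other in parallel, the case m = \<infinity>.
  Only finitely many normals, their angles and an interior point enter, so a polytope is an instance
  as soon as the products of its normals are known.\<close>

locale chamber =
  fixes I :: "'i set" and u :: "'i \<Rightarrow> 'a::euclidean_space" and b :: "'i \<Rightarrow> real"
  assumes finite_I: "finite I"
    and norm_u [simp]: "\<And>i. i \<in> I \<Longrightarrow> norm (u i) = 1"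
    and angle: "\<And>i j. i \<in> I \<Longrightarrow> j \<in> I \<Longrightarrow> i \<noteq> j \<Longrightarrow>
      u i \<bullet> u j = - 1 \<or> (\<exists>m::nat. m \<ge> 2 \<and> u i \<bullet> u j = - cos (pi / real m))"
    and interior_point: "\<exists>z. \<forall>i\<in>I. u i \<bullet> z < b i"
begin

definition s :: "'i \<Rightarrow> 'a \<Rightarrow> 'a" where "s i = hrefl (u i) (b i)"

definition depth :: "'i \<Rightarrow> 'a \<Rightarrow> real" where "depth i x = b i - u i \<bullet> x"

definition C :: "'a set" where "C = {x. \<forall>i\<in>I. u i \<bullet> x \<le> b i}"

definition word :: "'i list \<Rightarrow> 'a \<Rightarrow> 'a" where "word ws = foldr (\<lambda>i g. s i \<circ> g) ws id"

definition G :: "('a \<Rightarrow> 'a) set" where "G = word ` lists I"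

definition len :: "('a \<Rightarrow> 'a) \<Rightarrow> nat" where
  "len g = (LEAST n. \<exists>ws\<in>lists I. length ws = n \<and> word ws = g)"

lemma u_self [simp]: "i \<in> I \<Longrightarrow> u i \<bullet> u i = 1"
  by (simp add: dot_square_norm)

lemma u_nonpos: "i \<in> I \<Longrightarrow> j \<in> I \<Longrightarrow> i \<noteq> j \<Longrightarrow> u i \<bullet> u j \<le> 0"
proof -
  assume a: "i \<in> I" "j \<in> I" "i \<noteq> j"
  show ?thesis using angle[OF a] cos_pi_over_nonneg by fastforce
qed

lemma word_simps [simp]: "word [] = id" "word (i # ws) = s i \<circ> word ws"
  by (simp_all add: word_def)

lemma word_append: "word (vs @ ws) = word vs \<circ> word ws"
  by (induction vs) auto

lemma s_eq: "s i x = x + (2 * depth i x) *\<^sub>R u i"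
  by (simp add: s_def hrefl_def depth_def algebra_simps)

lemma depth_s: "depth i (s j x) = depth i x - 2 * (u i \<bullet> u j) * depth j x"
  by (simp add: s_eq depth_def inner_add_right algebra_simps)

lemma depth_s_same: "i \<in> I \<Longrightarrow> depth i (s i x) = - depth i x"
  by (simp add: depth_s)

lemma s_s [simp]: "i \<in> I \<Longrightarrow> s i (s i x) = x"
  by (subst s_eq) (simp add: depth_s_same, simp add: s_eq)

lemma s_comp_s [simp]: "i \<in> I \<Longrightarrow> s i \<circ> s i = id"
  by (simp add: fun_eq_iff)

lemma s_comp_s_comp [simp]: "i \<in> I \<Longrightarrow> s i \<circ> (s i \<circ> g) = g"
  by (simp add: fun_eq_iff)

lemma word_in_G: "ws \<in> lists I \<Longrightarrow> word ws \<in> G"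
  by (auto simp: G_def)

lemma id_in_G: "id \<in> G"
  using word_in_G[of "[]"] by simp

lemma s_in_G: "i \<in> I \<Longrightarrow> s i \<in> G"
  using word_in_G[of "[i]"] by simp

lemma comp_in_G: "g \<in> G \<Longrightarrow> h \<in> G \<Longrightarrow> g \<circ> h \<in> G"
  unfolding G_def
proof (elim imageE, goal_cases)
  case (1 vs ws)
  then show ?case by (intro image_eqI[of _ _ "vs @ ws"]) (auto simp: word_append)
qed

lemma word_rev: "ws \<in> lists I \<Longrightarrow> word (rev ws) \<circ> word ws = id"
  by (induction ws) (auto simp: word_append fun_eq_iff)

lemma inverse_in_G: "g \<in> G \<Longrightarrow> \<exists>h\<in>G. h \<circ> g = id \<and> g \<circ> h = id"
proof -
  assume "g \<in> G"
  then obtain ws where ws: "ws \<in> lists I" "g = word ws" by (auto simp: G_def)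
  have "rev ws \<in> lists I" using ws by auto
  then show ?thesis
    using word_rev[OF ws(1)] word_rev[of "rev ws"] ws word_in_G by (metis rev_rev_ident)
qed

lemma G_induct [consumes 1, case_names id s]:
  assumes "g \<in> G" "P id" "\<And>i g. i \<in> I \<Longrightarrow> g \<in> G \<Longrightarrow> P g \<Longrightarrow> P (s i \<circ> g)"
  shows "P g"
proof -
  have "P (word ws)" if "ws \<in> lists I" for ws
    using that
  proof induction
    case (Cons i ws)
    then show ?case using assms(3)[of i "word ws"] word_in_G by (metis word_simps(2))
  qed (use assms(2) in \<open>auto simp: id_def\<close>)
  then show ?thesis using assms(1) by (auto simp: G_def)
qed

lemma len_word_le: "ws \<in> lists I \<Longrightarrow> len (word ws) \<le> length ws"
  unfolding len_def by (rule Least_le) auto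

lemma reduced_word:
  assumes "g \<in> G"
  obtains ws where "ws \<in> lists I" "word ws = g" "length ws = len g"
proof -
  have "\<exists>n. \<exists>ws\<in>lists I. length ws = n \<and> word ws = g" using assms by (auto simp: G_def)
  from LeastI_ex[OF this] show ?thesis using that unfolding len_def by blast
qed

lemma len_word_comp_le:
  assumes "g \<in> G" "ws \<in> lists I"
  shows "len (word ws \<circ> g) \<le> length ws + len g"
proof -
  obtain vs where "vs \<in> lists I" "word vs = g" "length vs = len g" using reduced_word assms(1) by blast
  then show ?thesis using len_word_le[of "ws @ vs"] assms(2) by (auto simp: word_append)
qed

text \<open>Peeling off the outer letter turns the coefficients with indices j + 1, j into those
  with indices j + 2, j + 1 and exchanges the two walls, by the Chebyshev recursion; hence the
  generalization over j. For j = 0 the left side is the single depth at s'.\<close>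

lemma depth_alternating:
  assumes st: "s' \<in> I" "t' \<in> I"
  shows "cheb (- (u s' \<bullet> u t')) (Suc j) * depth s' (word (alternating t' s' k) y)
         + cheb (- (u s' \<bullet> u t')) j * depth t' (word (alternating t' s' k) y)
       = cheb (- (u s' \<bullet> u t')) (Suc (j + k)) * depth (if even k then s' else t') y
         + cheb (- (u s' \<bullet> u t')) (j + k) * depth (if even k then t' else s') y"
  using st
proof (induction k arbitrary: s' t' j)
  case (Suc k)
  let ?z = "word (alternating s' t' k) y" and ?c = "- (u s' \<bullet> u t')"
  have d: "depth s' (s t' ?z) = depth s' ?z + 2 * ?c * depth t' ?z" "depth t' (s t' ?z) = - depth t' ?z"
    using Suc.prems by (simp_all add: depth_s)
  have "cheb ?c (Suc j) * depth s' (s t' ?z) + cheb ?c j * depth t' (s t' ?z)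
      = cheb ?c (Suc (Suc j)) * depth t' ?z + cheb ?c (Suc j) * depth s' ?z"
    unfolding d cheb.simps(3) by algebra
  also have "\<dots> = cheb ?c (Suc (Suc j + k)) * depth (if even k then t' else s') y
         + cheb ?c (Suc j + k) * depth (if even k then s' else t') y"
    using Suc.IH[of t' s' "Suc j"] Suc.prems by (simp only: inner_commute[of "u t'" "u s'"])
  finally show ?case by (simp del: cheb.simps)
qed simp

text \<open>Both words move y by a vector in the span of u i and u j, and both images have the same
  depths at the walls i and j. The difference of the images thus lies in that span and is orthogonal
  to it.\<close>

lemma braid:
  assumes st: "i \<in> I" "j \<in> I" and m: "m \<ge> 2" "u i \<bullet> u j = - cos (pi / real m)"
  shows "word (alternating i j m) = word (alternating j i m)"
proof
  fix y
  have *: "depth s' (word (alternating t' s' m) y) = - depth (if even m then s' else t') y"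
    "depth s' (word (alternating s' t' m) y) = - depth (if even m then s' else t') y"
    if "s' \<in> I" "t' \<in> I" "u s' \<bullet> u t' = - cos (pi / real m)" for s' t'
  proof -
    show "depth s' (word (alternating t' s' m) y) = - depth (if even m then s' else t') y"
      using depth_alternating[OF that(1,2), of 0 m y] cheb_cos_pi(1,3)[OF m(1)] that(3) by simp
    \<comment> \<open>The outer letter s' only changes the sign of its own depth, so the inner word
      of length m - 1, with Chebyshev coefficients 0 and 1, decides.\<close>
    obtain k where k: "m = Suc k" using m(1) by (cases m) auto
    have "depth s' (word (alternating t' s' k) y) = depth (if even k then t' else s') y"
      using depth_alternating[OF that(1,2), of 0 k y] cheb_cos_pi(1,2)[OF m(1)] that(3) k by simp
    then show "depth s' (word (alternating s' t' m) y) = - depth (if even m then s' else t') y"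
      using k that by (simp add: depth_s_same)
  qed
  have sp: "word (alternating s' t' k) y - y \<in> span {u i, u j}" if "{s',t'} = {i,j}" for s' t' k
    using that
  proof (induction k arbitrary: s' t')
    case (Suc k)
    let ?z = "word (alternating t' s' k) y"
    have "?z - y \<in> span {u i, u j}" using Suc by (metis insert_commute)
    moreover have "(2 * depth s' ?z) *\<^sub>R u s' \<in> span {u i, u j}"
      using Suc.prems by (intro span_scale span_base) (auto simp: doubleton_eq_iff)
    ultimately have "(?z - y) + (2 * depth s' ?z) *\<^sub>R u s' \<in> span {u i, u j}" by (rule span_add)
    then show ?case by (simp add: s_eq algebra_simps)
  qed (simp add: span_zero)
  let ?d = "word (alternating i j m) y - word (alternating j i m) y"
  have "depth i (word (alternating i j m) y) = depth i (word (alternating j i m) y)"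
    "depth j (word (alternating i j m) y) = depth j (word (alternating j i m) y)"
    using *[of i j] *[of j i] st m by (simp_all add: inner_commute)
  then have "orthogonal v ?d" if "v \<in> {u i, u j}" for v
    using that by (auto simp: depth_def orthogonal_def inner_diff_right)
  moreover have "?d \<in> span {u i, u j}"
    using span_diff[OF sp[of i j m] sp[of j i m]] by auto
  ultimately have "orthogonal ?d ?d" by (meson orthogonal_commute orthogonal_to_span)
  then show "word (alternating i j m) y = word (alternating j i m) y"
    by (simp add: orthogonal_def)
qed

definition reduced :: "'i list \<Rightarrow> bool" where
  "reduced ws \<longleftrightarrow> ws \<in> lists I \<and> len (word ws) = length ws"

lemma reduced_tail:
  assumes "reduced (i # ws)" shows "reduced ws"
proof -
  have ws: "i \<in> I" "ws \<in> lists I" "len (word (i # ws)) = Suc (length ws)"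
    using assms by (auto simp: reduced_def)
  have "len (word [i] \<circ> word ws) \<le> length [i] + len (word ws)"
    using ws by (intro len_word_comp_le word_in_G) auto
  then show ?thesis using ws len_word_le[of ws] by (auto simp: reduced_def)
qed

lemma not_reduced_repeat: "\<not> reduced (i # i # ws)"
proof
  assume "reduced (i # i # ws)"
  then have "i \<in> I" "ws \<in> lists I" "len (word ws) = Suc (Suc (length ws))"
    by (auto simp: reduced_def)
  then show False using len_word_le[of ws] by simp
qed

lemma reduced_alternating:
  assumes "reduced d" "d \<in> lists {i, j}" "\<And>d'. d \<noteq> i # d'"
  shows "d = alternating j i (length d)"
  using assms
proof (induction d arbitrary: i j)
  case (Cons a d)
  then have a: "a = j" by auto
  have "d \<noteq> j # d'" for d' using Cons.prems(1) a not_reduced_repeat by blast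
  then have "d = alternating i j (length d)"
    using Cons.prems a by (intro Cons.IH) (auto dest: reduced_tail)
  then show ?case using a by simp
qed simp

text \<open>
  Tits' argument: split \<open>g\<close> as a word in two letters times a factor that no letter of these two
  shortens; the induction hypothesis applies to the factor, and the two-letter word acts on the two
  depth functions by Chebyshev coefficients, which stay nonnegative below the braid length.
\<close>

theorem depth_nonneg:
  assumes "g \<in> G" "i \<in> I" "len g \<le> len (s i \<circ> g)" "x \<in> C"
  shows "0 \<le> depth i (g x)"
  using assms
proof (induction "len g" arbitrary: g i rule: less_induct)
  case less
  note g = \<open>g \<in> G\<close> and i = \<open>i \<in> I\<close>
  obtain ws where ws: "ws \<in> lists I" "word ws = g" "length ws = len g" using g by (rule reduced_word)
  show ?case
  proof (cases ws)
    case Nil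
    then have "g x = x" using ws by auto
    then show ?thesis using \<open>x \<in> C\<close> i by (auto simp: C_def depth_def)
  next
    case (Cons j ws')
    have j: "j \<in> I" and ws': "ws' \<in> lists I" using ws Cons by auto
    have red: "len (word ws') = length ws'"
      using reduced_tail[of j ws'] ws Cons by (auto simp: reduced_def)
    \<comment> \<open>Among the factorizations of g into a word d in i and j and a remainder v, with
      lengths adding up, one with the shortest v is taken: a letter that shortened v could be moved
      into d. Splitting off the first letter j of a reduced word shows that v is strictly shorter
      than g.\<close>
    define Q where "Q = (\<lambda>(v, d). v \<in> G \<and> d \<in> lists {i, j} \<and> word d \<circ> v = g
                                   \<and> length d + len v = len g)"
    have Q0: "Q (word ws', [j])" using ws Cons red ws' word_in_G unfolding Q_def by auto
    obtain v d where vd: "Q (v, d)" and min: "\<And>v' d'. Q (v', d') \<Longrightarrow> len v \<le> len v'"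
      using ex_has_least_nat[of Q "(word ws', [j])" "len \<circ> fst"] Q0 by auto
    have v: "v \<in> G" and d: "d \<in> lists {i, j}" "word d \<circ> v = g" "length d + len v = len g"
      using vd by (auto simp: Q_def)
    have dI: "d \<in> lists I" using d i j by (auto simp: subset_iff)
    have less_v: "len v < len g" using min[OF Q0] red ws(3) Cons by simp
    have noshort: "len v \<le> len (s k \<circ> v)" if k: "k \<in> {i, j}" for k
    proof (rule ccontr)
      assume short: "\<not> len v \<le> len (s k \<circ> v)"
      have kI: "k \<in> I" using k i j by auto
      have G': "s k \<circ> v \<in> G" using kI v by (intro comp_in_G s_in_G)
      have eq: "word (d @ [k]) \<circ> (s k \<circ> v) = g"
        using d(2) kI by (simp add: word_append fun_eq_iff)
      have "len g \<le> length (d @ [k]) + len (s k \<circ> v)"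
        using len_word_comp_le[OF G', of "d @ [k]"] eq dI kI by simp
      then have "Q (s k \<circ> v, d @ [k])" using short d k G' eq by (auto simp: Q_def)
      then show False using min short by blast
    qed
    have pos: "0 \<le> depth k (v x)" if "k \<in> {i, j}" for k
      using less.hyps[OF less_v v _ noshort[OF that] \<open>x \<in> C\<close>] that i j by auto
    have dred: "reduced d"
    proof -
      have "len (word d) = length d"
      proof (rule ccontr)
        assume "len (word d) \<noteq> length d"
        then have lt: "len (word d) < length d" using len_word_le[OF dI] by simp
        obtain d' where d': "d' \<in> lists I" "word d' = word d" "length d' = len (word d)"
          using reduced_word[OF word_in_G[OF dI]] .
        show False using len_word_comp_le[OF v d'(1)] d' d lt by simp
      qed
      then show ?thesis using dI by (simp add: reduced_def)
    qed
    \<comment> \<open>A first letter i of d would be cancelled by \<open>s i\<close>, giving a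
      shorter element against the assumption on i.\<close>
    have start: "d \<noteq> i # d'" for d'
    proof
      assume eq: "d = i # d'"
      then have "s i \<circ> g = word d' \<circ> v" using d(2) i s_comp_s_comp[of i "word d' \<circ> v"] by (simp add: comp_assoc)
      then show False using len_word_comp_le[OF v, of d'] dI eq d(3) less.prems(3) by auto
    qed
    define k where "k = length d"
    have dk: "d = alternating j i k"
      unfolding k_def using dred d(1) start by (rule reduced_alternating)
    have ij: "i \<noteq> j"
    proof
      assume "i = j"
      then have "s i \<circ> g = word ws'" using ws(2) Cons i by auto
      then show False using less.prems(3) red ws(3) Cons by simp
    qed
    have "0 \<le> cheb (- (u i \<bullet> u j)) (Suc k) \<and> 0 \<le> cheb (- (u i \<bullet> u j)) k"
      using angle[OF i j ij]
    proof
      assume "u i \<bullet> u j = - 1"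
      then show ?thesis by (simp add: cheb_1)
    next
      assume "\<exists>m::nat. m \<ge> 2 \<and> u i \<bullet> u j = - cos (pi / real m)"
      then obtain m :: nat where m: "m \<ge> 2" "u i \<bullet> u j = - cos (pi / real m)" by blast
      \<comment> \<open>A word of length at least m could be rewritten by the braid relation so as
        to begin with i, and \<open>s i\<close> would again shorten g.\<close>
      have "k < m"
      proof (rule ccontr)
        assume "\<not> k < m"
        define r where "r = (if even m then alternating j i (k - m) else alternating i j (k - m))"
        obtain m' where m': "m = Suc m'" using m(1) by (cases m) auto
        have "d = alternating j i m @ r"
          using alternating_add[of j i m "k - m"] \<open>\<not> k < m\<close> unfolding dk r_def by simp
        then have "word d = word (alternating i j m) \<circ> word r"
          using braid[OF i j m] by (simp add: word_append)
        then have "s i \<circ> g = word (alternating j i m' @ r) \<circ> v"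
          using m' s_comp_s_comp[OF i, of "word (alternating j i m' @ r) \<circ> v"] d(2)
          by (simp add: word_append comp_assoc)
        moreover have "alternating j i m' @ r \<in> lists I"
          using i j alternating_in_lists[of _ I] unfolding r_def by (auto simp del: in_lists_conv_set)
        ultimately have "len (s i \<circ> g) \<le> m' + length r + len v"
          using len_word_comp_le[OF v, of "alternating j i m' @ r"] by simp
        moreover have "length r = k - m" by (simp add: r_def)
        ultimately show False
          using \<open>\<not> k < m\<close> m' d(3) less.prems(3) by (simp add: k_def)
      qed
      then show ?thesis using cheb_cos_pi(4)[OF m(1)] m(2) by simp
    qed
    moreover have "depth i (g x) = cheb (- (u i \<bullet> u j)) (Suc k) * depth (if even k then i else j) (v x)
         + cheb (- (u i \<bullet> u j)) k * depth (if even k then j else i) (v x)"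
      using depth_alternating[OF i j, of 0 k "v x"] d(2) dk by auto
    ultimately show ?thesis using pos by auto
  qed
qed

text \<open>The first letter i of a reduced word shortens g, so \<open>depth_nonneg\<close> applies
  to \<open>s i \<circ> g\<close>, and the reflection turns the sign. Geometrically, wall i
  separates \<open>C\<close> from its image under g.\<close>

lemma depth_nonpos:
  assumes "g \<in> G" "g \<noteq> id"
  obtains i where "i \<in> I" "len (s i \<circ> g) < len g" "\<And>x. x \<in> C \<Longrightarrow> depth i (g x) \<le> 0"
proof -
  obtain ws where ws: "ws \<in> lists I" "word ws = g" "length ws = len g" using assms(1) by (rule reduced_word)
  then obtain i ws' where Cons: "ws = i # ws'" using assms(2) by (cases ws) auto
  have i: "i \<in> I" "ws' \<in> lists I" using ws Cons by auto
  then have eq: "s i \<circ> g = word ws'" using ws(2) Cons by auto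
  have lt: "len (s i \<circ> g) < len g" using len_word_le[OF i(2)] eq ws(3) Cons by simp
  have "depth i (g x) \<le> 0" if "x \<in> C" for x
  proof -
    have "0 \<le> depth i ((s i \<circ> g) x)"
    proof (rule depth_nonneg[of "s i \<circ> g"])
      show "s i \<circ> g \<in> G" using i assms(1) by (intro comp_in_G s_in_G)
      show "len (s i \<circ> g) \<le> len (s i \<circ> (s i \<circ> g))"
        unfolding s_comp_s_comp[OF i(1)] using lt by simp
    qed (use i that in auto)
    then show ?thesis using i by (simp add: depth_s_same)
  qed
  then show ?thesis using that i lt by blast
qed

text \<open>At the wall i given by \<open>depth_nonpos\<close> the point V = g V has depth at most
  0, and as a point of \<open>C\<close> also at least 0. So \<open>s i\<close> fixes V and can be
  stripped off, which shortens g.\<close>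

lemma stabilizer:
  assumes "g \<in> G" "g V = V" "V \<in> C"
  shows "g \<in> word ` lists {i \<in> I. u i \<bullet> V = b i}"
  using assms(1,2)
proof (induction "len g" arbitrary: g rule: less_induct)
  case less
  show ?case
  proof (cases "g = id")
    case True
    then show ?thesis by (intro image_eqI[of _ _ "[]"]) auto
  next
    case False
    with less.prems(1) obtain i where i: "i \<in> I" "len (s i \<circ> g) < len g" "depth i (g V) \<le> 0"
      using depth_nonpos assms(3) by metis
    have "u i \<bullet> V \<le> b i" using assms(3) i(1) by (simp add: C_def)
    with i(3) have V: "u i \<bullet> V = b i" using less.prems(2) by (simp add: depth_def)
    then have "s i V = V" by (simp add: s_eq depth_def)
    then have "s i \<circ> g \<in> word ` lists {i \<in> I. u i \<bullet> V = b i}"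
      using less.prems i by (intro less.hyps comp_in_G s_in_G) auto
    then obtain ws where "ws \<in> lists {i \<in> I. u i \<bullet> V = b i}" "s i \<circ> g = word ws" by auto
    then have "g = s i \<circ> word ws" using i by (metis s_comp_s_comp)
    then show ?thesis using i V \<open>ws \<in> _\<close> by (intro image_eqI[of _ _ "i # ws"]) auto
  qed
qed

end

section \<open>Translations and the crystallographic restriction\<close>

lemma linear_part_hrefl [simp]: "linear_part (hrefl u b) = hrefl u 0"
  by (simp add: linear_part_def hrefl_def fun_eq_iff algebra_simps)

lemma linear_hrefl: "linear (hrefl u 0)"
  by (rule linearI) (simp_all add: hrefl_def inner_add_right algebra_simps)

lemma linear_part_comp:
  assumes "linear (linear_part g)"
  shows "linear_part (g \<circ> h) = linear_part g \<circ> linear_part h"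
proof
  fix x
  have "linear_part g (h x - h 0) = linear_part g (h x) - linear_part g (h 0)"
    using assms by (rule linear_diff)
  then show "linear_part (g \<circ> h) x = (linear_part g \<circ> linear_part h) x"
    by (simp add: linear_part_def)
qed

section \<open>Linear parts and translations\<close>

context chamber
begin

lemma linear_part_s: "linear_part (s i) = hrefl (u i) 0"
  by (simp add: s_def)

lemma linear_linear_part: "g \<in> G \<Longrightarrow> linear (linear_part g)"
proof (induction rule: G_induct)
  case id
  then show ?case by (simp add: linear_part_def linear_iff)
next
  case (s i g)
  have "linear_part (s i \<circ> g) = hrefl (u i) 0 \<circ> linear_part g"
    using linear_part_comp[of "s i" g] by (simp add: linear_part_s linear_hrefl)
  then have "linear (linear_part (s i \<circ> g))" using s linear_hrefl linear_compose by metis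
  then show ?case by (simp add: o_def)
qed

lemma G_diff: "g \<in> G \<Longrightarrow> g x - g y = linear_part g (x - y)"
  using linear_diff[OF linear_linear_part] by (simp add: linear_part_def)

definition translation_lattice :: "'a set" where "translation_lattice = {v. (\<lambda>x. x + v) \<in> G}"

lemma translations_zero: "0 \<in> translation_lattice"
  using id_in_G by (simp add: translation_lattice_def id_def)

lemma translations_add: "v \<in> translation_lattice \<Longrightarrow> w \<in> translation_lattice \<Longrightarrow> v + w \<in> translation_lattice"
  unfolding translation_lattice_def using comp_in_G[of "\<lambda>x. x + w" "\<lambda>x. x + v"]
  by (simp add: o_def add.assoc)

lemma translations_minus:
  assumes "v \<in> translation_lattice" shows "- v \<in> translation_lattice"
proof -
  obtain h where h: "h \<in> G" "(\<lambda>x. x + v) \<circ> h = id"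
    using inverse_in_G assms unfolding translation_lattice_def by blast
  have "h x = x + - v" for x
    using fun_cong[OF h(2), of x] by (simp add: eq_diff_eq)
  then have "h = (\<lambda>x. x + - v)" by blast
  then show ?thesis using h by (simp add: translation_lattice_def)
qed

lemma translations_diff: "v \<in> translation_lattice \<Longrightarrow> w \<in> translation_lattice \<Longrightarrow> v - w \<in> translation_lattice"
  using translations_add[of v "- w"] translations_minus[of w] by simp

lemma translations_of_int:
  assumes "v \<in> translation_lattice" shows "of_int k *\<^sub>R v \<in> translation_lattice"
proof (induction k rule: int_induct[of _ 0])
  case (step1 i)
  then show ?case using translations_add[OF step1(2) assms] by (simp add: scaleR_add_left)
next
  case (step2 i)
  then show ?case using translations_diff[OF step2(2) assms] by (simp add: scaleR_diff_left)
qed (simp add: translations_zero)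

lemma translations_linear_part:
  assumes "g \<in> G" "v \<in> translation_lattice" shows "linear_part g v \<in> translation_lattice"
proof -
  obtain h where h: "h \<in> G" "g \<circ> h = id" using inverse_in_G[OF assms(1)] by blast
  have "g (h x + v) = x + linear_part g v" for x
  proof -
    have "g (h x) = x" using h(2) by (metis comp_apply id_apply)
    then show ?thesis using G_diff[OF assms(1), of "h x + v" "h x"] by (simp add: algebra_simps)
  qed
  then have "g \<circ> ((\<lambda>x. x + v) \<circ> h) = (\<lambda>x. x + linear_part g v)" by (simp add: fun_eq_iff)
  moreover have "g \<circ> ((\<lambda>x. x + v) \<circ> h) \<in> G"
    using assms h by (intro comp_in_G) (auto simp: translation_lattice_def)
  ultimately show ?thesis by (simp add: translation_lattice_def)
qed

text \<open>Translations are stable under linear parts, and v minus its mirror image is this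
  multiple of \<theta>. Every translation that is not orthogonal to a root thus yields one along the
  root.\<close>

lemma translations_root:
  assumes "hrefl \<theta> 0 \<in> linear_part ` G" "v \<in> translation_lattice"
  shows "(2 * (\<theta> \<bullet> v)) *\<^sub>R \<theta> \<in> translation_lattice"
proof -
  have "hrefl \<theta> 0 v \<in> translation_lattice" using assms translations_linear_part by auto
  then have "v - hrefl \<theta> 0 v \<in> translation_lattice" using assms(2) by (intro translations_diff)
  then show ?thesis by (simp add: hrefl_def)
qed

lemma translations_discrete:
  obtains e where "e > 0" "\<And>v. v \<in> translation_lattice \<Longrightarrow> v \<noteq> 0 \<Longrightarrow> e \<le> norm v"
proof -
  obtain z where z: "\<And>i. i \<in> I \<Longrightarrow> u i \<bullet> z < b i" using interior_point by blast
  \<comment> \<open>The inserted 1 keeps the minimum defined when there are no walls. A nontrivial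
    translation carries the interior point z onto or across some wall, hence by at least its
    distance from that wall.\<close>
  define e where "e = Min (insert 1 ((\<lambda>i. depth i z) ` I))"
  have "e > 0" using finite_I z by (auto simp: e_def depth_def)
  moreover have "e \<le> norm v" if v: "v \<in> translation_lattice" "v \<noteq> 0" for v
  proof -
    have "(\<lambda>x. x + v) \<noteq> id" using v(2) by (metis add_0 id_apply)
    then obtain i where i: "i \<in> I" "\<And>x. x \<in> C \<Longrightarrow> depth i (x + v) \<le> 0"
      using depth_nonpos v(1) unfolding translation_lattice_def by blast
    have "z \<in> C" using z by (force simp: C_def)
    then have "depth i z \<le> u i \<bullet> v" using i(2)[of z] by (simp add: depth_def inner_add_right)
    also have "\<dots> \<le> norm (u i) * norm v" by (rule norm_cauchy_schwarz)
    also have "\<dots> = norm v" using i by simp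
    finally show ?thesis using finite_I i by (auto simp: e_def intro: Min.coboundedI order_trans[rotated])
  qed
  ultimately show ?thesis using that by blast
qed

text \<open>The multiples of \<theta> that are translations form a discrete subgroup of a line,
  hence a cyclic one, with r as its positive generator.\<close>

lemma cyclic_translations:
  assumes "norm \<theta> = 1" "q *\<^sub>R \<theta> \<in> translation_lattice" "q \<noteq> 0"
  obtains r where "r > 0" "r *\<^sub>R \<theta> \<in> translation_lattice"
    "\<And>p. p *\<^sub>R \<theta> \<in> translation_lattice \<Longrightarrow> \<exists>k::int. p = of_int k * r"
proof -
  obtain e where e: "e > 0" "\<And>v. v \<in> translation_lattice \<Longrightarrow> v \<noteq> 0 \<Longrightarrow> e \<le> norm v"
    using translations_discrete by blast
  define R where "R = {r. r > 0 \<and> r *\<^sub>R \<theta> \<in> translation_lattice}"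
  have R_ge: "e \<le> r" if "r \<in> R" for r
    using e(2)[of "r *\<^sub>R \<theta>"] that assms(1) by (force simp: R_def)
  have "\<bar>q\<bar> \<in> R"
    using assms(2,3) translations_minus[OF assms(2)] by (auto simp: R_def abs_if)
  then have ne: "R \<noteq> {}" by blast
  \<comment> \<open>The infimum is attained: two elements of \<open>R\<close> within less than e
    above it differ by less than e, and so are equal.\<close>
  have "Inf R < Inf R + e" using e by simp
  then obtain r where r: "r \<in> R" "r < Inf R + e"
    using cInf_lessD[OF ne] by blast
  have min: "r \<le> r'" if "r' \<in> R" for r'
  proof (rule ccontr)
    assume "\<not> r \<le> r'"
    then have "r - r' \<in> R"
      using that r(1) translations_diff[of "r *\<^sub>R \<theta>" "r' *\<^sub>R \<theta>"] by (simp add: R_def algebra_simps)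
    then have "e \<le> r - r'" by (rule R_ge)
    moreover have "Inf R \<le> r'" using that R_ge by (intro cInf_lower) (auto simp: bdd_below_def)
    ultimately show False using r(2) by simp
  qed
  have "\<exists>k::int. p = of_int k * r" if p: "p *\<^sub>R \<theta> \<in> translation_lattice" for p
  proof -
    have r0: "r > 0" "r *\<^sub>R \<theta> \<in> translation_lattice" using r(1) by (auto simp: R_def)
    define p' where "p' = p - of_int \<lfloor>p / r\<rfloor> * r"
    have "p' *\<^sub>R \<theta> \<in> translation_lattice"
      using translations_diff[OF p translations_of_int[OF r0(2), of "\<lfloor>p / r\<rfloor>"]]
      by (simp add: p'_def algebra_simps)
    moreover have "of_int \<lfloor>p / r\<rfloor> * r \<le> p" "p < (of_int \<lfloor>p / r\<rfloor> + 1) * r"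
      using r0(1) by (simp_all add: floor_divide_lower floor_divide_upper)
    then have "0 \<le> p'" "p' < r" by (simp_all add: p'_def algebra_simps)
    ultimately have "p' = 0" using min[of p'] by (force simp: R_def)
    then show ?thesis by (auto simp: p'_def)
  qed
  then show ?thesis using that[of r] r(1) by (auto simp: R_def)
qed

end

text \<open>\<open>vertex\<close> expresses that the normals of the walls through V span the space;
  \<open>no_ray\<close> is boundedness in the form in which it serves to make the translations
  span.\<close>

locale special_chamber = chamber I u b
  for I :: "'i set" and u :: "'i \<Rightarrow> 'a::euclidean_space" and b +
  fixes V :: 'a
  assumes V_in_C: "V \<in> C"
    and vertex: "\<And>y. (\<And>i. i \<in> I \<Longrightarrow> u i \<bullet> V = b i \<Longrightarrow> u i \<bullet> y = 0) \<Longrightarrow> y = 0"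
    and special: "\<And>g. g \<in> G \<Longrightarrow> \<exists>h\<in>G. h V = V \<and> linear_part h = linear_part g"
    and no_ray: "\<And>x y. x \<in> C \<Longrightarrow> y \<noteq> 0 \<Longrightarrow> \<exists>t\<ge>0. x + t *\<^sub>R y \<notin> C"
begin

text \<open>Undoing the linear part of \<open>s i\<close> by an element that fixes V leaves a
  translation, which takes V to its mirror image. In particular a wall whose normal is orthogonal to
  all translations contains V.\<close>

lemma translation_wall:
  assumes "i \<in> I" shows "(2 * depth i V) *\<^sub>R u i \<in> translation_lattice"
proof -
  obtain h where h: "h \<in> G" "h V = V" "linear_part h = linear_part (s i)"
    using special s_in_G assms by blast
  obtain h' where h': "h' \<in> G" "h \<circ> h' = id" using inverse_in_G[OF h(1)] by blast
  have "s i (h' x) = x + (2 * depth i V) *\<^sub>R u i" for x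
  proof -
    have "h (h' x) = x" using h'(2) by (metis comp_apply id_apply)
    moreover have "h (h' x) - h V = s i (h' x) - s i V"
      using G_diff h s_in_G assms by metis
    ultimately have "s i (h' x) = x + (s i V - V)" using h(2) by (simp add: algebra_simps)
    then show ?thesis by (simp add: s_eq)
  qed
  then have "s i \<circ> h' = (\<lambda>x. x + (2 * depth i V) *\<^sub>R u i)" by (simp add: fun_eq_iff)
  then show ?thesis using comp_in_G[OF s_in_G[OF assms] h'(1)] by (simp add: translation_lattice_def)
qed

lemma reflection_in_linear_part:
  assumes "i \<in> I" shows "hrefl (u i) 0 \<in> linear_part ` G"
  using s_in_G[OF assms] linear_part_s by (metis image_eqI)

text \<open>
  If a direction were orthogonal to all translation_lattice, the component of \<open>z - V\<close> orthogonal to the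
  translation_lattice (with \<open>z\<close> an interior point) would span a ray of the chamber.
\<close>

lemma translations_span:
  assumes "y \<noteq> 0" shows "\<exists>v\<in>translation_lattice. v \<bullet> y \<noteq> 0"
proof (rule ccontr)
  assume "\<not> ?thesis"
  then have orth: "v \<bullet> y = 0" if "v \<in> translation_lattice" for v using that by blast
  obtain z where z: "\<And>i. i \<in> I \<Longrightarrow> u i \<bullet> z < b i" using interior_point by blast
  obtain p q where pq: "p \<in> span translation_lattice" "\<And>w. w \<in> span translation_lattice \<Longrightarrow> orthogonal q w" "z - V = p + q"
    using orthogonal_subspace_decomp_exists by blast
  have dich: "u i \<in> span translation_lattice \<or> (\<forall>w\<in>span translation_lattice. u i \<bullet> w = 0)" if i: "i \<in> I" for i
  proof (cases "\<forall>w\<in>translation_lattice. u i \<bullet> w = 0")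
    case True
    then have "orthogonal (u i) w" if "w \<in> span translation_lattice" for w
      using orthogonal_to_span[OF that, of "u i"] by (simp add: orthogonal_def)
    then show ?thesis by (simp add: orthogonal_def)
  next
    case False
    then obtain v where v: "v \<in> translation_lattice" "u i \<bullet> v \<noteq> 0" by blast
    have "(1 / (2 * (u i \<bullet> v))) *\<^sub>R ((2 * (u i \<bullet> v)) *\<^sub>R u i) \<in> span translation_lattice"
      using translations_root[OF reflection_in_linear_part[OF i] v(1)]
      by (intro span_scale span_base)
    then show ?thesis using v(2) by simp
  qed
  have tight: "u i \<bullet> V = b i" if i: "i \<in> I" "\<forall>w\<in>span translation_lattice. u i \<bullet> w = 0" for i
  proof -
    have "u i \<bullet> ((2 * depth i V) *\<^sub>R u i) = 0"
      using i translation_wall[OF i(1)] span_base by blast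
    then show ?thesis using i(1) by (simp add: depth_def)
  qed
  \<comment> \<open>Walls perpendicular to the translations contain V, and q points strictly to
    their inner side. If q = 0 there are no such walls, and y, orthogonal to all the other normals,
    serves as direction.\<close>
  define d where "d = (if q = 0 then y else q)"
  have "d \<noteq> 0" using assms by (simp add: d_def)
  have y0: "u i \<bullet> y = 0" if "u i \<in> span translation_lattice" for i
  proof -
    have "orthogonal y (u i)"
      using orth by (intro orthogonal_to_span[OF that]) (simp add: orthogonal_def inner_commute)
    then show ?thesis by (simp add: orthogonal_def inner_commute)
  qed
  have "u i \<bullet> d \<le> 0" if i: "i \<in> I" for i
  proof (cases "u i \<in> span translation_lattice")
    case True
    then have "u i \<bullet> q = 0" using pq(2) by (metis orthogonal_def inner_commute)
    then show ?thesis using y0[OF True] by (simp add: d_def)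
  next
    case False
    then have perp: "\<forall>w\<in>span translation_lattice. u i \<bullet> w = 0" using dich[OF i] by blast
    then have "u i \<bullet> q = u i \<bullet> z - b i"
      using tight[OF i perp] pq by (metis add.left_neutral inner_add_right inner_diff_right)
    then have "u i \<bullet> q < 0" using z[OF i] by simp
    then show ?thesis by (auto simp: d_def)
  qed
  then have "u i \<bullet> (V + t *\<^sub>R d) \<le> b i" if "t \<ge> 0" "i \<in> I" for t i
    using V_in_C mult_nonneg_nonpos[OF that(1), of "u i \<bullet> d"] that(2)
    by (force simp: C_def inner_add_right)
  then have "V + t *\<^sub>R d \<in> C" if "t \<ge> 0" for t
    using that by (simp add: C_def)
  then show False using no_ray[OF V_in_C \<open>d \<noteq> 0\<close>] by blast
qed

text \<open>The factor 2 anticipates the use: a reflection followed by the translation by 2 q along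
  its unit normal is the reflection in the mirror shifted by q.\<close>

lemma root_translation:
  assumes "norm \<theta> = 1" "hrefl \<theta> 0 \<in> linear_part ` G"
  obtains q where "q > 0" "(2 * q) *\<^sub>R \<theta> \<in> translation_lattice"
proof -
  obtain v where v: "v \<in> translation_lattice" "v \<bullet> \<theta> \<noteq> 0" using translations_span[of \<theta>] assms(1) by fastforce
  have "(2 * (\<theta> \<bullet> v)) *\<^sub>R \<theta> \<in> translation_lattice" by (rule translations_root[OF assms(2) v(1)])
  moreover from translations_minus[OF this] have "(2 * - (\<theta> \<bullet> v)) *\<^sub>R \<theta> \<in> translation_lattice" by simp
  ultimately show ?thesis
    using that[of "\<theta> \<bullet> v"] that[of "- (\<theta> \<bullet> v)"] v(2) by (cases "\<theta> \<bullet> v > 0") (auto simp: inner_commute)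
qed

text \<open>With shortest translations r \<theta> and r' \<eta> along the roots, the Cartan numbers
  2 r' (\<theta> \<bullet> \<eta>) / r and 2 r (\<theta> \<bullet> \<eta>) / r' are integers; the
  lengths cancel in their product.\<close>

lemma crystallographic:
  assumes "norm \<theta> = 1" "hrefl \<theta> 0 \<in> linear_part ` G" "norm \<eta> = 1" "hrefl \<eta> 0 \<in> linear_part ` G"
  obtains n :: int where "4 * (\<theta> \<bullet> \<eta>)\<^sup>2 = of_int n"
proof -
  obtain r where r: "r > 0" "r *\<^sub>R \<theta> \<in> translation_lattice"
    "\<And>p. p *\<^sub>R \<theta> \<in> translation_lattice \<Longrightarrow> \<exists>k::int. p = of_int k * r"
    using root_translation[OF assms(1,2)] cyclic_translations[OF assms(1)] by (metis less_irrefl mult_pos_pos zero_less_numeral)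
  obtain r' where r': "r' > 0" "r' *\<^sub>R \<eta> \<in> translation_lattice"
    "\<And>p. p *\<^sub>R \<eta> \<in> translation_lattice \<Longrightarrow> \<exists>k::int. p = of_int k * r'"
    using root_translation[OF assms(3,4)] cyclic_translations[OF assms(3)] by (metis less_irrefl mult_pos_pos zero_less_numeral)
  obtain k :: int where k: "2 * (\<theta> \<bullet> (r' *\<^sub>R \<eta>)) = of_int k * r"
    using r(3)[OF translations_root[OF assms(2) r'(2)]] by blast
  obtain l :: int where l: "2 * (\<eta> \<bullet> (r *\<^sub>R \<theta>)) = of_int l * r'"
    using r'(3)[OF translations_root[OF assms(4) r(2)]] by blast
  have "(2 * (\<theta> \<bullet> (r' *\<^sub>R \<eta>))) * (2 * (\<eta> \<bullet> (r *\<^sub>R \<theta>))) = (4 * (\<theta> \<bullet> \<eta>)\<^sup>2) * (r * r')"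
    by (simp add: power2_eq_square inner_commute)
  then have "(4 * (\<theta> \<bullet> \<eta>)\<^sup>2) * (r * r') = of_int (k * l) * (r * r')"
    unfolding k l of_int_mult by (simp only: mult_ac)
  then have "4 * (\<theta> \<bullet> \<eta>)\<^sup>2 = of_int (k * l)"
    using r(1) r'(1) by (metis less_irrefl mult_eq_0_iff mult_right_cancel)
  then show ?thesis by (rule that)
qed

end

section \<open>Facets of Coxeter polytopes\<close>

lemma unit_normal_parallel:
  fixes u v :: "'a::real_inner"
  assumes "norm u = 1" "norm v = 1" "\<And>y. u \<bullet> y = 0 \<Longrightarrow> v \<bullet> y = 0"
  shows "v = u \<or> v = - u"
proof -
  define w where "w = v - (u \<bullet> v) *\<^sub>R u"
  have uu: "u \<bullet> u = 1" using assms(1) by (simp add: dot_square_norm)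
  have uw: "u \<bullet> w = 0" by (simp add: w_def inner_diff_right uu)
  then have "w \<bullet> w = 0"
    using assms(3)[of w] by (simp add: w_def inner_diff_left)
  then have v: "v = (u \<bullet> v) *\<^sub>R u" by (simp add: w_def)
  then have "norm v = \<bar>u \<bullet> v\<bar> * norm u" by (metis norm_scaleR)
  then have "\<bar>u \<bullet> v\<bar> = 1" using assms by simp
  then show ?thesis using v by (metis abs_eq_iff' scaleR_minus1_left scaleR_one)
qed

lemma affine_parallel_hyperplanes:
  fixes u v :: "'a::real_inner"
  assumes "norm u = 1" "norm v = 1"
  shows "affine_parallel {x. u \<bullet> x = b} {x. v \<bullet> x = c} \<longleftrightarrow> v = u \<or> v = - u"
proof
  have uu: "u \<bullet> u = 1" using assms(1) by (simp add: dot_square_norm)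
  {
    assume "affine_parallel {x. u \<bullet> x = b} {x. v \<bullet> x = c}"
    then obtain a where a: "{x. v \<bullet> x = c} = (\<lambda>x. a + x) ` {x. u \<bullet> x = b}"
      unfolding affine_parallel_def by blast
    have "v \<bullet> y = 0" if "u \<bullet> y = 0" for y
    proof -
      have "a + b *\<^sub>R u \<in> {x. v \<bullet> x = c}" "a + (b *\<^sub>R u + y) \<in> {x. v \<bullet> x = c}"
        unfolding a by (auto simp: inner_add_right uu that)
      then show ?thesis by (simp add: inner_add_right)
    qed
    then show "v = u \<or> v = - u" using assms by (intro unit_normal_parallel)
  next
    assume v: "v = u \<or> v = - u"
    have "u \<noteq> - u"
    proof
      assume "u = - u"
      then have "u \<bullet> u = - (u \<bullet> u)" by (metis inner_minus_right)
      then show False using uu by simp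
    qed
    have "{x. v \<bullet> x = c} = (\<lambda>x. ((if v = u then c else - c) - b) *\<^sub>R u + x) ` {x. u \<bullet> x = b}"
      (is "?L = (\<lambda>x. ?a + x) ` ?R")
    proof (intro equalityI subsetI)
      fix x assume "x \<in> ?L"
      then have "x - ?a \<in> ?R" using v by (auto simp: inner_diff_right uu)
      then show "x \<in> (\<lambda>x. ?a + x) ` ?R" by (intro image_eqI[of _ _ "x - ?a"]) simp_all
    next
      fix x assume "x \<in> (\<lambda>x. ?a + x) ` ?R"
      then show "x \<in> ?L" using v \<open>u \<noteq> - u\<close> by (auto simp: inner_add_right uu)
    qed
    then show "affine_parallel {x. u \<bullet> x = b} {x. v \<bullet> x = c}"
      unfolding affine_parallel_def by blast
  }
qed

lemma facet_affine_hull: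
  fixes P :: "'a::euclidean_space set"
  assumes "interior P \<noteq> {}" "f facet_of P" "a \<noteq> 0" "f \<subseteq> {x. a \<bullet> x = b}"
  shows "affine hull f = {x. a \<bullet> x = b}"
proof (rule affine_dim_equal)
  show "affine hull f \<subseteq> {x. a \<bullet> x = b}"
    using assms(4) by (intro hull_minimal) (auto simp: affine_hyperplane)
  have "aff_dim P = DIM('a)" using assms(1) by (simp add: aff_dim_eq_full affine_hull_nonempty_interior)
  then show "aff_dim (affine hull f) = aff_dim {x. a \<bullet> x = b}"
    using assms(2,3) by (simp add: facet_of_def)
  show "affine hull f \<noteq> {}" using assms(2) by (simp add: facet_of_def)
qed (auto simp: affine_hyperplane)

lemma interior_below_support:
  fixes P :: "'a::euclidean_space set"
  assumes "z \<in> interior P" "P \<subseteq> {x. a \<bullet> x \<le> b}" "a \<noteq> 0"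
  shows "a \<bullet> z < b"
  using interior_mono[OF assms(2)] assms(1,3) by auto

text \<open>The hyperplane is the affine hull of the facet, which fixes the normal up to sign, and
  an interior point decides the sign. This justifies the definite description in
  \<open>outer_normal\<close>.\<close>

lemma supporting_halfspace_unique:
  fixes P :: "'a::euclidean_space set"
  assumes P: "interior P \<noteq> {}" "f facet_of P"
    and u: "norm u = 1" "P \<subseteq> {x. u \<bullet> x \<le> b}" "f = P \<inter> {x. u \<bullet> x = b}"
    and v: "norm v = 1" "P \<subseteq> {x. v \<bullet> x \<le> c}" "f = P \<inter> {x. v \<bullet> x = c}"
  shows "u = v"
proof -
  obtain z where z: "z \<in> interior P" using P(1) by blast
  obtain x where x: "x \<in> f" using P(2) by (auto simp: facet_of_def)
  have "u \<noteq> 0" "v \<noteq> 0" using u v by auto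
  then have uz: "u \<bullet> z < b" "v \<bullet> z < c" using interior_below_support z u v by blast+
  have "f \<subseteq> {x. u \<bullet> x = b}" using u(3) by (metis Int_lower2)
  moreover have "f \<subseteq> {x. v \<bullet> x = c}" using v(3) by (metis Int_lower2)
  ultimately have "affine hull f = {x. u \<bullet> x = b}" "affine hull f = {x. v \<bullet> x = c}"
    using facet_affine_hull[OF P] \<open>u \<noteq> 0\<close> \<open>v \<noteq> 0\<close> by blast+
  then have "affine_parallel {x. u \<bullet> x = b} {x. v \<bullet> x = c}"
    using affine_parallel_reflex by metis
  then have "v = u \<or> v = - u" using affine_parallel_hyperplanes u v by blast
  moreover have "v \<noteq> - u"
  proof
    assume "v = - u"
    moreover have "u \<bullet> x = b" "v \<bullet> x = c" using x u v by auto
    ultimately have "v \<bullet> z = - (u \<bullet> z)" "c = - b" by auto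
    then show False using uz by linarith
  qed
  ultimately show ?thesis by simp
qed

text \<open>All points of a facet give the same value, so the choice is harmless;
  \<open>outer_normal_eqI\<close> identifies it with the offset of the supporting
  hyperplane.\<close>

definition facet_offset :: "'a::euclidean_space set \<Rightarrow> 'a set \<Rightarrow> real" where
  "facet_offset P f = outer_normal P f \<bullet> (SOME x. x \<in> f)"

lemma outer_normal_eqI:
  fixes P :: "'a::euclidean_space set"
  assumes "interior P \<noteq> {}" "f facet_of P"
    "norm u = 1" "P \<subseteq> {x. u \<bullet> x \<le> b}" "f = P \<inter> {x. u \<bullet> x = b}"
  shows "outer_normal P f = u" "facet_offset P f = b"
proof -
  show u: "outer_normal P f = u"
    unfolding outer_normal_def
  proof (rule the_equality)
    show "norm u = 1 \<and> (\<exists>b. P \<subseteq> {x. u \<bullet> x \<le> b} \<and> f = P \<inter> {x. u \<bullet> x = b})"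
      using assms by blast
  next
    fix v assume "norm v = 1 \<and> (\<exists>b. P \<subseteq> {x. v \<bullet> x \<le> b} \<and> f = P \<inter> {x. v \<bullet> x = b})"
    then show "v = u" using supporting_halfspace_unique[OF assms(1,2)] assms(3-5) by blast
  qed
  have "(SOME x. x \<in> f) \<in> f" using assms(2) by (auto simp: facet_of_def some_in_eq)
  then show "facet_offset P f = b" unfolding facet_offset_def u using assms(5) by blast
qed

lemma outer_normal_eq_scaled:
  fixes P :: "'a::euclidean_space set"
  assumes "interior P \<noteq> {}" "f facet_of P" "a \<noteq> 0" "P \<subseteq> {x. a \<bullet> x \<le> b}" "f = P \<inter> {x. a \<bullet> x = b}"
  shows "outer_normal P f = a /\<^sub>R norm a" "facet_offset P f = b / norm a"
proof -
  have "{x. (a /\<^sub>R norm a) \<bullet> x \<le> b / norm a} = {x. a \<bullet> x \<le> b}"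
    "{x. (a /\<^sub>R norm a) \<bullet> x = b / norm a} = {x. a \<bullet> x = b}"
    using assms(3) by (auto simp: field_simps)
  then show "outer_normal P f = a /\<^sub>R norm a" "facet_offset P f = b / norm a"
    using outer_normal_eqI[OF assms(1,2), of "a /\<^sub>R norm a" "b / norm a"] assms(3-5) by auto
qed

lemma facet_outer_normal:
  fixes P :: "'a::euclidean_space set"
  assumes "polyhedron P" "interior P \<noteq> {}" "f facet_of P"
  shows "norm (outer_normal P f) = 1"
    "P \<subseteq> {x. outer_normal P f \<bullet> x \<le> facet_offset P f}"
    "f = P \<inter> {x. outer_normal P f \<bullet> x = facet_offset P f}"
proof -
  obtain a b where ab: "a \<noteq> 0" "P \<subseteq> {x. a \<bullet> x \<le> b}" "f = P \<inter> {x. a \<bullet> x = b}"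
    using facet_of_polyhedron[OF assms(1,3)] by metis
  note eq = outer_normal_eq_scaled[OF assms(2,3) ab]
  show "norm (outer_normal P f) = 1" using ab(1) eq by simp
  have "{x. outer_normal P f \<bullet> x \<le> facet_offset P f} = {x. a \<bullet> x \<le> b}"
    "{x. outer_normal P f \<bullet> x = facet_offset P f} = {x. a \<bullet> x = b}"
    unfolding eq using ab(1) by (auto simp: field_simps)
  then show "P \<subseteq> {x. outer_normal P f \<bullet> x \<le> facet_offset P f}"
    "f = P \<inter> {x. outer_normal P f \<bullet> x = facet_offset P f}"
    using ab(2,3) by simp_all
qed

lemma polyhedron_eq_facet_halfspaces:
  fixes P :: "'a::euclidean_space set"
  assumes "polyhedron P" "interior P \<noteq> {}"
  shows "P = {x. \<forall>f\<in>facets P. outer_normal P f \<bullet> x \<le> facet_offset P f}"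
proof (intro equalityI subsetI)
  fix x assume "x \<in> P"
  then show "x \<in> {x. \<forall>f\<in>facets P. outer_normal P f \<bullet> x \<le> facet_offset P f}"
    using facet_outer_normal(2)[OF assms] by (auto simp: facets_def)
next
  fix x assume x: "x \<in> {x. \<forall>f\<in>facets P. outer_normal P f \<bullet> x \<le> facet_offset P f}"
  obtain F where F: "finite F" "P = (affine hull P) \<inter> \<Inter>F"
    "\<forall>h \<in> F. \<exists>a b. a \<noteq> 0 \<and> h = {x. a \<bullet> x \<le> b}" "\<And>F'. F' \<subset> F \<Longrightarrow> P \<subset> (affine hull P) \<inter> \<Inter>F'"
    using assms(1) unfolding polyhedron_Int_affine_minimal by meson
  from F(3) obtain a b where ab: "\<And>h. h \<in> F \<Longrightarrow> a h \<noteq> 0 \<and> h = {x. a h \<bullet> x \<le> b h}" by metis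
  have U: "affine hull P = UNIV" using assms(2) by (rule affine_hull_nonempty_interior)
  have "x \<in> h" if h: "h \<in> F" for h
  proof -
    let ?f = "P \<inter> {x. a h \<bullet> x = b h}"
    have f: "?f facet_of P"
      using facet_of_polyhedron_explicit[OF F(1,2) ab F(4)] h by blast
    have "P \<subseteq> h" using F(2) h by blast
    then have le: "P \<subseteq> {x. a h \<bullet> x \<le> b h}" using ab[OF h] by blast
    have "a h \<noteq> 0" using ab[OF h] by blast
    moreover have "outer_normal P ?f \<bullet> x \<le> facet_offset P ?f" using x f by (simp add: facets_def)
    ultimately have "a h \<bullet> x \<le> b h"
      unfolding outer_normal_eq_scaled[OF assms(2) f \<open>a h \<noteq> 0\<close> le refl] by (simp add: field_simps)
    then show ?thesis using ab[OF h] by blast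
  qed
  then show "x \<in> P" by (subst F(2)) (simp add: U)
qed

text \<open>Connectedness of the segment: otherwise its part in f would be closed and relatively
  open while containing w but not y.\<close>

lemma segment_leaves_through_boundary:
  fixes f :: "'a::euclidean_space set"
  assumes "closed f" "w \<in> rel_interior f" "y \<in> affine hull f" "y \<notin> f"
  obtains q where "q \<in> closed_segment w y" "q \<in> f" "q \<notin> rel_interior f"
proof (rule ccontr)
  assume "\<not> thesis"
  let ?S = "closed_segment w y"
  have *: "?S \<inter> f = ?S \<inter> rel_interior f"
    using that \<open>\<not> thesis\<close> rel_interior_subset[of f] by blast
  have wf: "w \<in> f" using assms(2) rel_interior_subset by blast
  have sub: "?S \<subseteq> affine hull f"
  proof -
    have "convex (affine hull f)" by (simp add: affine_imp_convex)
    then show ?thesis using assms(3) hull_inc[OF wf, of affine] by (intro closed_segment_subset)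
  qed
  obtain T where T: "open T" "rel_interior f = affine hull f \<inter> T"
    using openin_rel_interior[of f] unfolding openin_open by blast
  have "?S \<inter> f = ?S \<inter> T" using * T(2) sub by blast
  then have "openin (top_of_set ?S) (?S \<inter> f)" using T(1) openin_open_Int by metis
  moreover have "closedin (top_of_set ?S) (?S \<inter> f)" using assms(1) by (rule closedin_closed_Int)
  ultimately have "?S \<inter> f = {} \<or> ?S \<inter> f = ?S"
    using connected_clopen[THEN iffD1, OF connected_segment(1)[of w y]] by blast
  then show False using wf assms(4) by auto
qed

text \<open>The convex hull of a ball around z and a far point x contains N disjoint balls of half
  the radius along the nearer half of the segment. The distance 2 r N leaves room for centers at
  spacing r, and N is chosen so that the total volume N c exceeds that of P.\<close>

lemma finite_volume_convex_bounded:
  fixes P :: "'a::euclidean_space set"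
  assumes "convex P" "P \<in> sets lborel" "interior P \<noteq> {}" "emeasure lborel P < \<infinity>"
  shows "bounded P"
proof -
  obtain z r where zr: "r > 0" "ball z r \<subseteq> P" using assms(3) by (metis all_not_in_conv mem_interior)
  define c where "c = unit_ball_vol (DIM('a)) * (r / 2) ^ DIM('a)"
  have c: "c > 0" using zr by (simp add: c_def)
  obtain M where M: "emeasure lborel P = ennreal M" "M \<ge> 0"
    using assms(4) by (metis ennreal_cases infinity_ennreal_def less_irrefl)
  define N where "N = nat (\<lfloor>M / c\<rfloor> + 1)"
  have "M / c \<ge> 0" using M c by simp
  then have N: "M / c < real N" unfolding N_def by linarith
  then have "M < real N * c" using c by (simp add: field_simps)
  have "norm (x - z) \<le> 2 * r * real N" if x: "x \<in> P" for x
  proof (rule ccontr)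
    assume far: "\<not> ?thesis"
    let ?l = "norm (x - z)"
    have "0 \<le> 2 * r * real N" using zr by simp
    then have l: "?l > 0" using far by linarith
    define p where "p k = z + (real k * r / ?l) *\<^sub>R (x - z)" for k
    have in_P: "ball (p k) (r / 2) \<subseteq> P" if "k < N" for k
    proof
      fix y assume y: "y \<in> ball (p k) (r / 2)"
      define \<mu> where "\<mu> = real k * r / ?l"
      have "real k * r < (1 / 2) * ?l"
      proof -
        have "real k * r < real N * r" using that zr by simp
        also have "\<dots> < (1 / 2) * ?l" using far by (simp add: mult_ac not_le)
        finally show ?thesis .
      qed
      then have mu: "0 \<le> \<mu>" "\<mu> < 1 / 2" using l zr by (simp_all add: \<mu>_def divide_less_eq)
      have pk: "p k = z + \<mu> *\<^sub>R (x - z)" by (simp add: p_def \<mu>_def)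
      \<comment> \<open>The homothety with center x and ratio 1 - \<mu> maps w to y. As the ratio
        exceeds 1/2, w lies in the ball of radius r about z.\<close>
      define w where "w = z + (1 / (1 - \<mu>)) *\<^sub>R (y - p k)"
      have "norm (w - z) = norm (y - p k) / (1 - \<mu>)" using mu by (simp add: w_def)
      also have "\<dots> \<le> norm (y - p k) / (1 / 2)" using mu by (intro divide_left_mono) auto
      also have "\<dots> < r" using y by (simp add: dist_norm norm_minus_commute)
      finally have "w \<in> P" using zr by (auto simp: dist_norm norm_minus_commute)
      moreover have "(1 - \<mu>) *\<^sub>R w = (1 - \<mu>) *\<^sub>R z + (y - p k)" using mu by (simp add: w_def scaleR_add_right)
      then have "y = (1 - \<mu>) *\<^sub>R w + \<mu> *\<^sub>R x" using pk by (simp add: algebra_simps)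
      ultimately show "y \<in> P" using convexD[OF assms(1) _ x, of w "1 - \<mu>" \<mu>] mu by simp
    qed
    have dist: "r * \<bar>real j - real k\<bar> = dist (p j) (p k)" for j k
    proof -
      have "p j - p k = ((real j - real k) * r / ?l) *\<^sub>R (x - z)"
        by (simp add: p_def algebra_simps diff_divide_distrib)
      then show ?thesis using l zr by (simp add: dist_norm abs_mult)
    qed
    have disj: "disjoint_family_on (\<lambda>k. ball (p k) (r / 2)) {..<N}"
      unfolding disjoint_family_on_def
    proof (intro ballI impI)
      fix j k :: nat assume "j \<noteq> k"
      then have "1 \<le> \<bar>real j - real k\<bar>" by linarith
      then have "r \<le> dist (p j) (p k)" using zr(1) dist[of j k] by (metis mult.right_neutral mult_le_cancel_left_pos)
      then show "ball (p j) (r / 2) \<inter> ball (p k) (r / 2) = {}" by (intro disjoint_ballI) simp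
    qed
    have "(\<Sum>k<N. emeasure lborel (ball (p k) (r / 2))) = emeasure lborel (\<Union>k<N. ball (p k) (r / 2))"
      using disj by (intro sum_emeasure) auto
    also have "\<dots> \<le> emeasure lborel P" using in_P assms(2) by (intro emeasure_mono) auto
    finally have "ennreal (real N * c) \<le> ennreal M"
      using zr(1) c M(1) by (simp add: emeasure_ball c_def[symmetric] ennreal_mult'' ennreal_of_nat_eq_real_of_nat)
    then show False using \<open>M < real N * c\<close> M(2) by simp
  qed
  then have "P \<subseteq> cball z (2 * r * real N)" by (auto simp: dist_norm norm_minus_commute)
  then show ?thesis using bounded_cball bounded_subset by blast
qed

lemma cos_pi_over_inj:
  assumes "m \<ge> 2" "k \<ge> 2" "cos (pi / real m) = cos (pi / real k)"
  shows "m = k"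
proof -
  have "pi / real m = pi / real k"
  proof (rule cos_inj_pi)
    show "0 \<le> pi / real m" "pi / real m \<le> pi" "0 \<le> pi / real k" "pi / real k \<le> pi"
      using pi_over_bounds[OF assms(1)] pi_over_bounds[OF assms(2)] by (simp_all only: less_imp_le)
  qed (rule assms(3))
  then have "real m = real k" using assms(1,2) by (simp only: divide_cancel_left pi_neq_zero) simp
  then show ?thesis by simp
qed

lemma dihedral_angle_eq_iff:
  fixes P :: "'a::euclidean_space set"
  assumes "norm (outer_normal P f) = 1" "norm (outer_normal P g) = 1" "m \<ge> 2"
  shows "dihedral_angle P f g = pi / real m \<longleftrightarrow> outer_normal P f \<bullet> outer_normal P g = - cos (pi / real m)"
proof -
  let ?c = "outer_normal P f \<bullet> outer_normal P g"
  have c: "- 1 \<le> ?c" "?c \<le> 1"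
    using Cauchy_Schwarz_ineq2[of "outer_normal P f" "outer_normal P g"] assms by auto
  have m: "0 \<le> pi - pi / real m" "pi - pi / real m \<le> pi" using pi_over_bounds[OF assms(3)] by linarith+
  have "dihedral_angle P f g = pi / real m \<longleftrightarrow> arccos ?c = pi - pi / real m"
    by (auto simp: dihedral_angle_def)
  also have "\<dots> \<longleftrightarrow> ?c = cos (pi - pi / real m)"
    using cos_arccos[OF c] arccos_cos[OF m] by auto
  finally show ?thesis by simp
qed

section \<open>Normals and angles of Coxeter polytopes\<close>

locale coxeter_polytope =
  fixes P :: "'a::euclidean_space set"
  assumes coxeter: "euclidean_coxeter_polytope P"
begin

abbreviation "n \<equiv> outer_normal P"
abbreviation "d \<equiv> facet_offset P"

lemma polyhedron: "polyhedron P" and interior: "interior P \<noteq> {}"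
  using coxeter by (simp_all add: euclidean_coxeter_polytope_def)

lemma convex: "convex P" using polyhedron by (rule polyhedron_imp_convex)

lemma closed: "closed P" using polyhedron by (rule polyhedron_imp_closed)

lemma bounded: "bounded P"
  using finite_volume_convex_bounded[OF convex] closed interior coxeter
  by (simp add: euclidean_coxeter_polytope_def borel_closed)

lemma finite_facets: "finite (facets P)"
  unfolding facets_def using polyhedron by (rule finite_polyhedron_facets)

lemma norm_n [simp]: "f \<in> facets P \<Longrightarrow> norm (n f) = 1"
  and n_le: "f \<in> facets P \<Longrightarrow> x \<in> P \<Longrightarrow> n f \<bullet> x \<le> d f"
  and facet_eq: "f \<in> facets P \<Longrightarrow> f = {x \<in> P. n f \<bullet> x = d f}"
  using facet_outer_normal[OF polyhedron interior, of f] by (auto simp: facets_def)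

lemma n_self [simp]: "f \<in> facets P \<Longrightarrow> n f \<bullet> n f = 1"
  by (simp add: dot_square_norm)

lemma n_nonzero: "f \<in> facets P \<Longrightarrow> n f \<noteq> 0"
  using norm_n by fastforce

lemma P_eq: "P = {x. \<forall>f\<in>facets P. n f \<bullet> x \<le> d f}"
  by (rule polyhedron_eq_facet_halfspaces[OF polyhedron interior])

lemma facet_nonempty: "f \<in> facets P \<Longrightarrow> f \<noteq> {}"
  by (auto simp: facets_def facet_of_def)

lemma affine_hull_facet: "f \<in> facets P \<Longrightarrow> affine hull f = {x. n f \<bullet> x = d f}"
  using facet_affine_hull[OF interior, of f "n f" "d f"] n_nonzero facet_eq[of f]
  by (auto simp: facets_def)

lemma aff_dim_P: "aff_dim P = DIM('a)"
  using interior by (simp add: aff_dim_eq_full affine_hull_nonempty_interior)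

lemma aff_dim_facet: "f \<in> facets P \<Longrightarrow> aff_dim f = int DIM('a) - 1"
  using aff_dim_P by (simp add: facets_def facet_of_def)

lemma interior_below: "f \<in> facets P \<Longrightarrow> z \<in> interior P \<Longrightarrow> n f \<bullet> z < d f"
  using interior_below_support[of z P "n f" "d f"] n_le n_nonzero by blast

lemma adjacent_nonpos:
  assumes "adjacent_facets P f g" shows "n f \<bullet> n g \<le> 0"
proof -
  obtain m :: nat where m: "m \<ge> 2" "dihedral_angle P f g = pi / real m"
    using coxeter assms by (auto simp: euclidean_coxeter_polytope_def)
  have "f \<in> facets P" "g \<in> facets P" using assms by (auto simp: adjacent_facets_def)
  then show ?thesis using m dihedral_angle_eq_iff[of P f g m] cos_pi_over_nonneg[OF m(1)] by simp
qed

text \<open>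
  The facets of a facet \<open>f\<close> are cut out by the facets adjacent to \<open>f\<close>, whose inequalities are
  preserved by the orthogonal projection onto the hyperplane of \<open>f\<close> because the angles there are
  not obtuse.
\<close>

lemma projection_onto_facet:
  assumes f: "f \<in> facets P" and x: "x \<in> P"
  shows "x + (d f - n f \<bullet> x) *\<^sub>R n f \<in> f"
proof (rule ccontr)
  define y where "y = x + (d f - n f \<bullet> x) *\<^sub>R n f"
  assume "\<not> ?thesis"
  then have yf: "y \<notin> f" by (simp add: y_def)
  have ff: "f face_of P" "f facet_of P" using f by (simp_all add: facets_def facet_of_def)
  have polyf: "polyhedron f" using face_of_polyhedron_polyhedron[OF polyhedron ff(1)] .
  have closedf: "closed f" using polyf by (rule polyhedron_imp_closed)
  have convf: "convex f" using polyf by (rule polyhedron_imp_convex)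
  then obtain w where w: "w \<in> rel_interior f"
    using facet_nonempty[OF f] rel_interior_eq_empty by blast
  have "n f \<bullet> y = d f" using f by (simp add: y_def inner_add_right)
  then have "y \<in> affine hull f" using affine_hull_facet[OF f] by simp
  then obtain q where q: "q \<in> closed_segment w y" "q \<in> f" "q \<notin> rel_interior f"
    using segment_leaves_through_boundary[OF closedf w _ yf] by blast
  then obtain r where r: "r facet_of f" "q \<in> r"
    using rel_boundary_of_polyhedron[OF polyf] by blast
  have rf: "r face_of f" "r \<noteq> f" "r \<noteq> {}" "r \<subseteq> f" "aff_dim r = aff_dim f - 1"
    using r by (auto simp: facet_of_def face_of_imp_subset)
  have rP: "r face_of P" using face_of_trans rf(1) ff(1) by blast
  have "r \<noteq> P" using rf(5) aff_dim_facet[OF f] aff_dim_P by auto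
  then have req: "r = \<Inter>{F. F facet_of P \<and> r \<subseteq> F}"
    using face_of_polyhedron[OF polyhedron rP] rf(3) by blast
  \<comment> \<open>A nonempty proper face is the intersection of the facets that contain it; as r
    differs from f, a second facet contains it.\<close>
  have "\<exists>k. k facet_of P \<and> r \<subseteq> k \<and> k \<noteq> f"
  proof (rule ccontr)
    assume "\<not> ?thesis"
    then have "{F. F facet_of P \<and> r \<subseteq> F} = {f}" using ff rf(4) by blast
    then show False using req rf(2) by simp
  qed
  then obtain k where k: "k facet_of P" "r \<subseteq> k" "k \<noteq> f" by blast
  have kf: "k \<in> facets P" using k by (simp add: facets_def)
  have kface: "k face_of P" using k by (simp add: facet_of_def)
  have "\<not> f \<subseteq> k"
  proof
    assume "f \<subseteq> k"
    then have "f face_of k" using ff kface face_of_face by blast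
    then have "aff_dim f < aff_dim k"
      using k(3) face_of_aff_dim_lt[of k f] face_of_imp_convex[OF kface] convex by blast
    then show False using aff_dim_facet[OF f] aff_dim_facet[OF kf] by simp
  qed
  then have fk: "f \<inter> k face_of f" "f \<inter> k \<noteq> f"
    using face_of_Int[OF ff(1) kface] face_of_face[OF ff(1)] by auto
  \<comment> \<open>The proper face \<open>f \<inter> k\<close> of f contains r, which has
    codimension 1 in f, so its dimension is squeezed and f and k are adjacent.\<close>
  then have "aff_dim (f \<inter> k) < aff_dim f" using face_of_aff_dim_lt convf by blast
  moreover have "aff_dim r \<le> aff_dim (f \<inter> k)" using rf(4) k(2) by (intro aff_dim_subset) auto
  ultimately have "aff_dim (f \<inter> k) = aff_dim P - 2" using rf(5) aff_dim_facet[OF f] aff_dim_P by simp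
  then have "adjacent_facets P f k" using f kf k rf by (auto simp: adjacent_facets_def)
  then have "n f \<bullet> n k \<le> 0" by (rule adjacent_nonpos)
  then have "(d f - n f \<bullet> x) * (n f \<bullet> n k) \<le> 0"
    using n_le[OF f x] by (intro mult_nonneg_nonpos) auto
  then have ky: "n k \<bullet> y \<le> d k"
    using n_le[OF kf x] by (simp add: y_def inner_add_right inner_commute[of "n k" "n f"])
  have "f \<inter> k \<inter> rel_interior f = {}" using face_of_disjoint_rel_interior fk by blast
  then have "w \<notin> k" using w rel_interior_subset by blast
  moreover have "w \<in> P" using w rel_interior_subset ff(1) face_of_imp_subset by blast
  ultimately have kw: "n k \<bullet> w < d k" using facet_eq[OF kf] n_le[OF kf, of w] by force
  have kq: "n k \<bullet> q = d k" using r(2) k(2) facet_eq[OF kf] by blast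
  \<comment> \<open>The point q is a convex combination of w, strictly inside the half-space of k,
    and of y, still inside it. As w has positive weight, q cannot lie on k, although r does.\<close>
  obtain t where t: "0 \<le> t" "t \<le> 1" "q = (1 - t) *\<^sub>R w + t *\<^sub>R y"
    using q(1) by (auto simp: in_segment)
  have "t \<noteq> 1" using t(3) q(2) yf by auto
  then have "(1 - t) * (n k \<bullet> w) < (1 - t) * d k" using kw t by simp
  moreover have "t * (n k \<bullet> y) \<le> t * d k" using ky t by (intro mult_left_mono)
  ultimately have "n k \<bullet> q < (1 - t) * d k + t * d k" by (simp add: t(3) inner_add_right)
  then show False using kq by (simp add: algebra_simps)
qed

lemma facet_not_subset:
  assumes "f \<in> facets P" "g \<in> facets P" "f \<noteq> g"
  obtains y where "y \<in> g" "y \<notin> f"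
proof -
  have "f face_of P" "g face_of P" using assms by (simp_all add: facets_def facet_of_def)
  have "\<not> g \<subseteq> f"
  proof
    assume "g \<subseteq> f"
    then have "g face_of f" using \<open>f face_of P\<close> \<open>g face_of P\<close> face_of_face by blast
    then have "aff_dim g < aff_dim f"
      using assms(3) face_of_aff_dim_lt[of f g] face_of_imp_convex[OF \<open>f face_of P\<close>] convex by blast
    then show False using aff_dim_facet assms by simp
  qed
  then show ?thesis using that by blast
qed

text \<open>A point of g outside f, projected onto f, moves by a positive multiple of n f and stays
  in P. Since it started on g, it cannot have moved outward across g.\<close>

lemma normals_nonpos:
  assumes f: "f \<in> facets P" and g: "g \<in> facets P" and ne: "f \<noteq> g"
  shows "n f \<bullet> n g \<le> 0"
proof -
  obtain y where y: "y \<in> g" "y \<notin> f" using facet_not_subset[OF f g ne] .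
  have yP: "y \<in> P" "n g \<bullet> y = d g" using y facet_eq[OF g] by auto
  then have "n f \<bullet> y < d f" using y(2) facet_eq[OF f] n_le[OF f] by force
  moreover have "y + (d f - n f \<bullet> y) *\<^sub>R n f \<in> P"
    using projection_onto_facet[OF f yP(1)] facet_eq[OF f] by blast
  then have "(d f - n f \<bullet> y) * (n f \<bullet> n g) \<le> 0"
    using n_le[OF g] yP(2) by (force simp: inner_add_right inner_commute[of "n g" "n f"])
  ultimately show ?thesis by (simp add: mult_le_0_iff)
qed

text \<open>
  Moving an interior point in the plane spanned by two normals onto both hyperplanes only decreases
  the other normals' values.
\<close>

lemma nonparallel_adjacent:
  assumes f: "f \<in> facets P" and g: "g \<in> facets P" and ne: "f \<noteq> g" and c: "n f \<bullet> n g \<noteq> - 1"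
  shows "adjacent_facets P f g"
proof -
  obtain x where x: "x \<in> interior P" using interior by blast
  define c where "c = n f \<bullet> n g"
  have c0: "c \<le> 0" using normals_nonpos[OF f g ne] by (simp add: c_def)
  have "\<bar>c\<bar> \<le> 1" using Cauchy_Schwarz_ineq2[of "n f" "n g"] f g by (simp add: c_def)
  then have "\<bar>c\<bar> < 1" using c c0 by (simp add: c_def)
  then have c1: "c\<^sup>2 < 1" using abs_square_less_1 by blast
  define p q where "p = d f - n f \<bullet> x" and "q = d g - n g \<bullet> x"
  have pq: "p > 0" "q > 0" using interior_below x f g by (auto simp: p_def q_def)
  \<comment> \<open>Solution of the linear system in \<open>eqs\<close>, whose determinant is
    \<open>1 - c\<^sup>2\<close>; both values are nonnegative because c \<le> 0.\<close>
  define s t where "s = (p - c * q) / (1 - c\<^sup>2)" and "t = (q - c * p) / (1 - c\<^sup>2)"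
  have "c * q \<le> 0" "c * p \<le> 0" using c0 pq by (auto intro: mult_nonpos_nonneg)
  then have st: "s \<ge> 0" "t \<ge> 0" using pq c1 by (auto simp: s_def t_def)
  have eqs: "s + c * t = p" "c * s + t = q"
  proof -
    have e: "s * (1 - c\<^sup>2) = p - c * q" "t * (1 - c\<^sup>2) = q - c * p"
      using c1 by (simp_all add: s_def t_def)
    have "(s + c * t) * (1 - c\<^sup>2) = s * (1 - c\<^sup>2) + c * (t * (1 - c\<^sup>2))"
      "(c * s + t) * (1 - c\<^sup>2) = c * (s * (1 - c\<^sup>2)) + t * (1 - c\<^sup>2)"
      by (simp_all add: algebra_simps)
    then have "(s + c * t) * (1 - c\<^sup>2) = p * (1 - c\<^sup>2)" "(c * s + t) * (1 - c\<^sup>2) = q * (1 - c\<^sup>2)"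
      unfolding e by (simp_all add: algebra_simps power2_eq_square)
    then show "s + c * t = p" "c * s + t = q" using c1 by simp_all
  qed
  define z where "z = x + s *\<^sub>R n f + t *\<^sub>R n g"
  have zf: "n f \<bullet> z = d f"
    using eqs f by (simp add: z_def inner_add_right c_def[symmetric] p_def mult.commute)
  have zg: "n g \<bullet> z = d g"
    using eqs g by (simp add: z_def inner_add_right inner_commute[of "n g" "n f"] c_def[symmetric] q_def mult.commute)
  have zk: "n k \<bullet> z < d k" if "k \<in> facets P" "k \<noteq> f" "k \<noteq> g" for k
  proof -
    have "s * (n k \<bullet> n f) \<le> 0" "t * (n k \<bullet> n g) \<le> 0"
      using st normals_nonpos that f g by (auto intro: mult_nonneg_nonpos)
    then show ?thesis using interior_below[OF that(1) x] by (simp add: z_def inner_add_right)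
  qed
  define S where "S = {x. n f \<bullet> x = d f} \<inter> {x. n g \<bullet> x = d g}"
  \<comment> \<open>The inequalities of the other facets are strict at z, so
    \<open>f \<inter> g\<close> contains a relatively open part of \<open>S\<close> and has its full
    dimension.\<close>
  define U where "U = (\<Inter>k\<in>facets P - {f, g}. {x. n k \<bullet> x < d k})"
  have "open U" unfolding U_def using finite_facets by (intro open_INT) (auto simp: open_halfspace_lt)
  have zSU: "z \<in> S \<inter> U" using zf zg zk by (auto simp: S_def U_def)
  have "convex S" unfolding S_def by (intro convex_Int convex_hyperplane)
  then have dim: "aff_dim (S \<inter> U) = aff_dim S"
    using aff_dim_convex_Int_open[OF _ \<open>open U\<close>] zSU by blast
  have "S \<inter> U \<subseteq> f \<inter> g"
  proof
    fix y assume y: "y \<in> S \<inter> U"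
    have "n k \<bullet> y \<le> d k" if "k \<in> facets P" for k
      using y that by (cases "k = f \<or> k = g") (auto simp: S_def U_def less_imp_le)
    then have "y \<in> P" using P_eq by blast
    then show "y \<in> f \<inter> g" using y facet_eq[OF f] facet_eq[OF g] by (auto simp: S_def)
  qed
  then have 1: "aff_dim S \<le> aff_dim (f \<inter> g)" using dim by (metis aff_dim_subset)
  have "f \<inter> g \<subseteq> S" using facet_eq[OF f] facet_eq[OF g] by (auto simp: S_def)
  then have 2: "aff_dim (f \<inter> g) \<le> aff_dim S" by (rule aff_dim_subset)
  have "\<not> {x. n f \<bullet> x = d f} \<subseteq> {x. n g \<bullet> x = d g}"
  proof
    assume "{x. n f \<bullet> x = d f} \<subseteq> {x. n g \<bullet> x = d g}"
    then have "f \<subseteq> g" using facet_eq[OF f] facet_eq[OF g] by blast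
    then show False using facet_not_subset[OF g f] ne by blast
  qed
  then have "aff_dim S = int DIM('a) - 2"
    using zSU aff_dim_affine_Int_hyperplane[of "{x. n f \<bullet> x = d f}" "n g" "d g"] n_nonzero[OF f]
    unfolding S_def by (auto simp: affine_hyperplane)
  moreover have "f \<inter> g \<noteq> {}" using zSU \<open>S \<inter> U \<subseteq> f \<inter> g\<close> by blast
  ultimately show ?thesis using 1 2 f g ne aff_dim_P by (simp add: adjacent_facets_def)
qed

lemma normals_product:
  assumes "f \<in> facets P" "g \<in> facets P" "f \<noteq> g"
  shows "n f \<bullet> n g = - 1 \<or> (\<exists>m::nat. m \<ge> 2 \<and> n f \<bullet> n g = - cos (pi / real m))"
proof (cases "n f \<bullet> n g = - 1")
  case False
  then obtain m :: nat where m: "m \<ge> 2" "dihedral_angle P f g = pi / real m"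
    using nonparallel_adjacent[OF assms] coxeter by (auto simp: euclidean_coxeter_polytope_def)
  then show ?thesis using dihedral_angle_eq_iff[of P f g m] assms by auto
qed simp

lemma normals_neq_one:
  assumes "f \<in> facets P" "g \<in> facets P" "f \<noteq> g" shows "n f \<noteq> n g"
  using normals_nonpos[OF assms] assms(1) by (metis n_self not_one_le_zero)

lemma coxeter_edge_eq:
  assumes "f \<in> facets P" "g \<in> facets P" "f \<noteq> g"
  shows "coxeter_edge P f g = (if n f \<bullet> n g = - 1 then \<infinity>
           else enat ((THE m. m \<ge> 2 \<and> n f \<bullet> n g = - cos (pi / real m)) - 2))"
proof -
  have "n g = - n f \<longleftrightarrow> n f \<bullet> n g = - 1"
  proof
    assume "n f \<bullet> n g = - 1"
    then have "(n f + n g) \<bullet> (n f + n g) = 0"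
      using assms by (simp add: inner_add_left inner_add_right inner_commute[of "n g" "n f"])
    then show "n g = - n f" by (simp add: add_eq_0_iff)
  qed (use assms in simp)
  then have "affine_parallel (affine hull f) (affine hull g) \<longleftrightarrow> n f \<bullet> n g = - 1"
    using affine_parallel_hyperplanes[of "n f" "n g"] affine_hull_facet normals_neq_one[OF assms] assms
    by auto
  moreover have "(m \<ge> 2 \<and> dihedral_angle P f g = pi / real m) = (m \<ge> 2 \<and> n f \<bullet> n g = - cos (pi / real m))" for m :: nat
    using dihedral_angle_eq_iff[of P f g m] assms by auto
  ultimately show ?thesis unfolding coxeter_edge_def by presburger
qed

text \<open>For m \<ge> 2 truncated subtraction of 2 is injective, cos is injective on [0, \<pi>],
  and cos (\<pi> / m) < 1 keeps finite labels apart from \<infinity>. The diagram thus carries the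
  whole Gram matrix of the normals.\<close>

lemma coxeter_edge_iff:
  assumes "f \<in> facets P" "g \<in> facets P" "f \<noteq> g"
  shows "coxeter_edge P f g = \<infinity> \<longleftrightarrow> n f \<bullet> n g = - 1"
    "m \<ge> 2 \<Longrightarrow> coxeter_edge P f g = enat (m - 2) \<longleftrightarrow> n f \<bullet> n g = - cos (pi / real m)"
proof -
  show "coxeter_edge P f g = \<infinity> \<longleftrightarrow> n f \<bullet> n g = - 1"
    using coxeter_edge_eq[OF assms] by simp
  assume m: "m \<ge> 2"
  have the: "(THE m. m \<ge> 2 \<and> n f \<bullet> n g = - cos (pi / real m)) = k" if "k \<ge> 2" "n f \<bullet> n g = - cos (pi / real k)" for k
    using that by (intro the_equality) (auto intro: cos_pi_over_inj)
  have ne: "- cos (pi / real k) \<noteq> - 1" if "k \<ge> 2" for k :: nat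
  proof -
    have "cos (pi / real k) < cos 0" using pi_over_bounds[OF that] by (intro cos_monotone_0_pi) auto
    then show ?thesis by simp
  qed
  show "coxeter_edge P f g = enat (m - 2) \<longleftrightarrow> n f \<bullet> n g = - cos (pi / real m)"
  proof (cases "n f \<bullet> n g = - 1")
    case True
    then show ?thesis using coxeter_edge_eq[OF assms] ne[OF m] by auto
  next
    case False
    then obtain k where k: "k \<ge> 2" "n f \<bullet> n g = - cos (pi / real k)" using normals_product[OF assms] by blast
    then have "coxeter_edge P f g = enat (k - 2)" using the[OF k] False coxeter_edge_eq[OF assms] by simp
    moreover have "k - 2 = m - 2 \<longleftrightarrow> k = m" using k m by arith
    ultimately show ?thesis using k m cos_pi_over_inj[of k m] by auto
  qed
qed

lemma interior_chamber:
  obtains z where "z \<in> P" "\<And>f. f \<in> facets P \<Longrightarrow> n f \<bullet> z < d f"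
  using interior interior_below interior_subset by blast

lemma no_ray_P:
  assumes "y \<noteq> 0" shows "\<exists>t\<ge>0. x + t *\<^sub>R y \<notin> P"
proof (rule ccontr)
  assume "\<not> ?thesis"
  then have ray: "x + t *\<^sub>R y \<in> P" if "t \<ge> 0" for t using that by blast
  obtain B where B: "\<And>w. w \<in> P \<Longrightarrow> norm w \<le> B" using bounded unfolding bounded_iff by blast
  define t where "t = (\<bar>B\<bar> + norm x + 1) / norm y"
  have "t \<ge> 0" by (simp add: t_def)
  then have "norm (x + t *\<^sub>R y) \<le> B" using ray B by blast
  moreover have "norm (t *\<^sub>R y) = \<bar>B\<bar> + norm x + 1" using assms by (simp add: t_def)
  moreover have "norm (t *\<^sub>R y) \<le> norm (x + t *\<^sub>R y) + norm x"
    by (metis add.commute add_diff_cancel_left' norm_triangle_ineq4)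
  ultimately show False by linarith
qed

text \<open>A direction orthogonal to all tight normals could be followed both ways for a short time
  without violating any inequality, making V the midpoint of a segment in P.\<close>

lemma vertex_normals:
  assumes V: "V extreme_point_of P" and y: "\<And>f. f \<in> facets P \<Longrightarrow> n f \<bullet> V = d f \<Longrightarrow> n f \<bullet> y = 0"
  shows "y = 0"
proof (rule ccontr)
  assume "y \<noteq> 0"
  have VP: "V \<in> P" using V by (simp add: extreme_point_of_def)
  have "\<forall>\<^sub>F t in at_right 0. \<forall>f\<in>facets P. n f \<bullet> V \<noteq> d f \<longrightarrow> t * \<bar>n f \<bullet> y\<bar> < d f - n f \<bullet> V"
  proof (intro eventually_ball_finite finite_facets ballI)
    fix f assume f: "f \<in> facets P"
    show "\<forall>\<^sub>F t in at_right 0. n f \<bullet> V \<noteq> d f \<longrightarrow> t * \<bar>n f \<bullet> y\<bar> < d f - n f \<bullet> V"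
    proof (cases "n f \<bullet> V = d f")
      case False
      have "((\<lambda>t. t * \<bar>n f \<bullet> y\<bar>) \<longlongrightarrow> 0 * \<bar>n f \<bullet> y\<bar>) (at_right 0)" by (intro tendsto_intros)
      then have "\<forall>\<^sub>F t in at_right 0. t * \<bar>n f \<bullet> y\<bar> < d f - n f \<bullet> V"
        using False n_le[OF f VP] by (intro order_tendstoD(2)[of _ 0]) auto
      then show ?thesis by (rule eventually_mono) simp
    qed simp
  qed
  moreover have "\<forall>\<^sub>F t::real in at_right 0. t > 0" by (simp add: eventually_at_right_less)
  ultimately have "\<forall>\<^sub>F t in at_right 0. t > 0 \<and> (\<forall>f\<in>facets P. n f \<bullet> V \<noteq> d f \<longrightarrow> t * \<bar>n f \<bullet> y\<bar> < d f - n f \<bullet> V)"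
    by (rule eventually_conj[rotated])
  then obtain t where t: "t > 0"
    "\<And>f. f \<in> facets P \<Longrightarrow> n f \<bullet> V \<noteq> d f \<Longrightarrow> t * \<bar>n f \<bullet> y\<bar> < d f - n f \<bullet> V"
    using eventually_happens'[OF trivial_limit_at_right_real] by blast
  have "V + r *\<^sub>R y \<in> P" if "\<bar>r\<bar> = t" for r
  proof -
    have "n f \<bullet> (V + r *\<^sub>R y) \<le> d f" if f: "f \<in> facets P" for f
    proof (cases "n f \<bullet> V = d f")
      case True
      then show ?thesis using y[OF f] by (simp add: inner_add_right)
    next
      case False
      have "r * (n f \<bullet> y) \<le> \<bar>r\<bar> * \<bar>n f \<bullet> y\<bar>" by (metis abs_ge_self abs_mult)
      then show ?thesis using t(2)[OF f False] \<open>\<bar>r\<bar> = t\<close> by (simp add: inner_add_right)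
    qed
    then show ?thesis using P_eq by blast
  qed
  from this[of t] this[of "- t"] have "V + t *\<^sub>R y \<in> P" "V - t *\<^sub>R y \<in> P" using t(1) by auto
  moreover have "V \<in> open_segment (V + t *\<^sub>R y) (V - t *\<^sub>R y)"
  proof -
    have "V = midpoint (V + t *\<^sub>R y) (V - t *\<^sub>R y)" by (simp add: midpoint_def algebra_simps flip: scaleR_add_left)
    moreover have "V + t *\<^sub>R y \<noteq> V - t *\<^sub>R y"
    proof
      assume "V + t *\<^sub>R y = V - t *\<^sub>R y"
      then have "(2 * t) *\<^sub>R y = 0" by (simp add: algebra_simps flip: scaleR_add_left)
      then show False using t(1) \<open>y \<noteq> 0\<close> by simp
    qed
    ultimately show ?thesis by (metis midpoint_in_open_segment)
  qed
  ultimately show False using V by (auto simp: extreme_point_of_def)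
qed

end

section \<open>Reflection groups of Coxeter polytopes\<close>

lemma closest_point_hyperplane:
  fixes u :: "'a::euclidean_space"
  assumes "norm u = 1"
  shows "closest_point {x. u \<bullet> x = b} x = x - (u \<bullet> x - b) *\<^sub>R u"
proof (rule closest_point_unique[symmetric])
  have uu: "u \<bullet> u = 1" using assms by (simp add: dot_square_norm)
  show "x - (u \<bullet> x - b) *\<^sub>R u \<in> {x. u \<bullet> x = b}" by (simp add: inner_diff_right uu)
  show "\<forall>z\<in>{x. u \<bullet> x = b}. dist x (x - (u \<bullet> x - b) *\<^sub>R u) \<le> dist x z"
  proof
    fix z assume "z \<in> {x. u \<bullet> x = b}"
    then have "u \<bullet> x - b = u \<bullet> (x - z)" by (simp add: inner_diff_right)
    then show "dist x (x - (u \<bullet> x - b) *\<^sub>R u) \<le> dist x z"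
      using Cauchy_Schwarz_ineq2[of u "x - z"] assms by (simp add: dist_norm)
  qed
qed (simp_all add: convex_hyperplane closed_hyperplane)

lemma reflection_in_hyperplane:
  fixes u :: "'a::euclidean_space"
  assumes "norm u = 1"
  shows "reflection_in {x. u \<bullet> x = b} = hrefl u b"
proof
  fix x show "reflection_in {x. u \<bullet> x = b} x = hrefl u b x"
    unfolding reflection_in_def closest_point_hyperplane[OF assms] hrefl_def
    by (simp add: algebra_simps scaleR_2)
qed

lemma is_reflection_iff: "is_reflection r \<longleftrightarrow> (\<exists>u b. norm u = 1 \<and> r = hrefl u b)"
proof
  assume "is_reflection r"
  then obtain u b where u: "u \<noteq> 0" "r = reflection_in {x. u \<bullet> x = b}"
    by (auto simp: is_reflection_def)
  have "{x. u \<bullet> x = b} = {x. (u /\<^sub>R norm u) \<bullet> x = b / norm u}"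
    using u(1) by (auto simp: divide_inverse mult.commute)
  moreover have "norm (u /\<^sub>R norm u) = 1" using u(1) by simp
  ultimately have "r = hrefl (u /\<^sub>R norm u) (b / norm u)"
    using u(2) reflection_in_hyperplane[of "u /\<^sub>R norm u"] by simp
  then show "\<exists>u b. norm u = 1 \<and> r = hrefl u b" using \<open>norm (u /\<^sub>R norm u) = 1\<close> by blast
next
  assume "\<exists>u b. norm u = 1 \<and> r = hrefl u b"
  then obtain u b where u: "norm u = 1" "r = hrefl u b" by blast
  then have "u \<noteq> 0" "r = reflection_in {x. u \<bullet> x = b}" using reflection_in_hyperplane[OF u(1), of b] by auto
  then show "is_reflection r" unfolding is_reflection_def by blast
qed

section \<open>Groups generated by reflections as sets of words\<close>

lemma Bij_UNIV: "Bij UNIV = {f. bij f}"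
  by (auto simp: Bij_def extensional_def)

lemma mult_BijGroup_UNIV: "bij g \<Longrightarrow> bij h \<Longrightarrow> g \<otimes>\<^bsub>BijGroup UNIV\<^esub> h = g \<circ> h"
  by (simp add: BijGroup_def Bij_UNIV compose_def fun_eq_iff)

lemma one_BijGroup_UNIV: "\<one>\<^bsub>BijGroup UNIV\<^esub> = id"
  by (auto simp: BijGroup_def)

lemma bij_foldr_comp: "(\<And>g. g \<in> S \<Longrightarrow> bij g) \<Longrightarrow> ws \<in> lists S \<Longrightarrow> bij (foldr (\<circ>) ws id)"
  by (induction ws) (auto simp: bij_comp)

text \<open>An involution is bijective and its own inverse, so words in the generators already form
  a group.\<close>

lemma carrier_generated_by_involutions:
  assumes inv: "\<And>g. g \<in> S \<Longrightarrow> g \<circ> g = id"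
  shows "carrier (subgroup_generated (BijGroup UNIV) S) = (\<lambda>ws. foldr (\<circ>) ws id) ` lists S"
proof -
  have bij: "bij g" if "g \<in> S" for g using inv[OF that] o_bij by blast
  have carr: "carrier (BijGroup UNIV) = {f. bij f}" by (simp add: BijGroup_def Bij_UNIV)
  interpret B: group "BijGroup UNIV" by (rule group_BijGroup)
  let ?W = "(\<lambda>ws. foldr (\<circ>) ws id) ` lists S"
  have "carrier (BijGroup UNIV) \<inter> S = S" using bij carr by auto
  then have car: "carrier (subgroup_generated (BijGroup UNIV) S) = generate (BijGroup UNIV) S"
    by (simp add: carrier_subgroup_generated)
  have foldr_append: "foldr (\<circ>) (vs @ ws) id = foldr (\<circ>) vs id \<circ> foldr (\<circ>) ws id" for vs ws :: "('a \<Rightarrow> 'a) list"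
    by (induction vs) auto
  have bijW: "bij g" if "g \<in> ?W" for g using that bij_foldr_comp bij by blast
  have single: "g \<in> ?W" if "g \<in> S" for g using that by (intro image_eqI[of _ _ "[g]"]) auto
  show ?thesis
  proof (intro equalityI subsetI)
    fix g assume "g \<in> carrier (subgroup_generated (BijGroup UNIV) S)"
    then have "g \<in> generate (BijGroup UNIV) S" using car by simp
    then show "g \<in> ?W"
    proof induction
      case one
      then show ?case by (intro image_eqI[of _ _ "[]"]) (auto simp: one_BijGroup_UNIV)
    next
      case (incl h)
      then show ?case by (rule single)
    next
      case (inv h)
      have "inv\<^bsub>BijGroup UNIV\<^esub> h = h"
        using bij[OF inv] assms[OF inv] carr
        by (intro B.inv_equality) (auto simp: mult_BijGroup_UNIV one_BijGroup_UNIV)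
      then show ?case using single[OF inv] by (simp only:)
    next
      case (eng h1 h2)
      then obtain vs ws where "vs \<in> lists S" "ws \<in> lists S" "h1 = foldr (\<circ>) vs id" "h2 = foldr (\<circ>) ws id"
        by blast
      moreover have "h1 \<otimes>\<^bsub>BijGroup UNIV\<^esub> h2 = h1 \<circ> h2"
        using eng.IH bijW by (intro mult_BijGroup_UNIV)
      ultimately have "h1 \<otimes>\<^bsub>BijGroup UNIV\<^esub> h2 = foldr (\<circ>) (vs @ ws) id" "vs @ ws \<in> lists S"
        by (simp_all only: foldr_append append_in_lists_conv)
      then show ?case by blast
    qed
  next
    fix g assume "g \<in> ?W"
    then obtain ws where "ws \<in> lists S" "g = foldr (\<circ>) ws id" by blast
    moreover have "foldr (\<circ>) ws id \<in> generate (BijGroup UNIV) S" if "set ws \<subseteq> S" for ws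
      using that
    proof (induction ws)
      case Nil
      show ?case using generate.one[of "BijGroup UNIV" S] unfolding one_BijGroup_UNIV by (simp add: id_def)
    next
      case (Cons h ws)
      have "foldr (\<circ>) ws id \<in> ?W" using Cons.prems by (intro imageI) auto
      then have "h \<otimes>\<^bsub>BijGroup UNIV\<^esub> foldr (\<circ>) ws id = foldr (\<circ>) (h # ws) id"
        using Cons.prems bij bijW by (subst mult_BijGroup_UNIV) auto
      moreover have "h \<otimes>\<^bsub>BijGroup UNIV\<^esub> foldr (\<circ>) ws id \<in> generate (BijGroup UNIV) S"
        by (rule generate.eng[OF generate.incl Cons.IH]) (use Cons.prems in auto)
      ultimately show ?case by (simp only:)
    qed
    ultimately have "g \<in> generate (BijGroup UNIV) S" by (metis in_lists_conv_set subsetI)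
    then show "g \<in> carrier (subgroup_generated (BijGroup UNIV) S)" using car by simp
  qed
qed

lemma mult_reflection_group_of [simp]:
  "mult (reflection_group_of \<F>) = mult (BijGroup UNIV)"
  by (simp add: reflection_group_of_def subgroup_generated_def)

lemma (in chamber) word_eq_foldr: "word ws = foldr (\<circ>) (map s ws) id"
  by (induction ws) auto

lemma (in chamber) G_bij: "g \<in> G \<Longrightarrow> bij g"
  using inverse_in_G o_bij by metis

sublocale coxeter_polytope \<subseteq> chamber "facets P" n d
proof
  show "\<exists>z. \<forall>i\<in>facets P. n i \<bullet> z < d i" using interior_chamber by metis
qed (use finite_facets normals_product in auto)

context coxeter_polytope
begin

lemma C_eq: "C = P"
  using P_eq by (simp add: C_def)

lemma reflection_in_facet: "f \<in> facets P \<Longrightarrow> reflection_in (affine hull f) = s f"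
  by (simp add: affine_hull_facet reflection_in_hyperplane s_def)

lemma carrier_reflection_group_of:
  assumes "\<F> \<subseteq> facets P"
  shows "carrier (reflection_group_of \<F>) = word ` lists \<F>"
proof -
  have eq: "(\<lambda>f. reflection_in (affine hull f)) ` \<F> = s ` \<F>"
    using assms reflection_in_facet by (intro image_cong) auto
  have "carrier (reflection_group_of \<F>) = (\<lambda>ws. foldr (\<circ>) ws id) ` lists (s ` \<F>)"
    unfolding reflection_group_of_def eq
    by (rule carrier_generated_by_involutions) (use assms in auto)
  also have "\<dots> = word ` lists \<F>" by (simp add: lists_image image_image word_eq_foldr)
  finally show ?thesis .
qed

lemma carrier_coxeter_group: "carrier (coxeter_group P) = G"
  by (simp add: coxeter_group_def carrier_reflection_group_of G_def)

lemma s_fixes: "f \<in> facets P \<Longrightarrow> n f \<bullet> V = d f \<Longrightarrow> s f V = V"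
  by (simp add: s_eq depth_def)

lemma vertex_group_words:
  assumes "V \<in> P"
  shows "carrier (vertex_group P V) = word ` lists {f \<in> facets P. n f \<bullet> V = d f}"
proof -
  have eq: "{f \<in> facets P. V \<in> f} = {f \<in> facets P. n f \<bullet> V = d f}"
    using facet_eq assms by blast
  show ?thesis unfolding vertex_group_def eq by (intro carrier_reflection_group_of) auto
qed

text \<open>The generators fix V; the converse inclusion is Tits' theorem \<open>stabilizer\<close>.
  This reconciles the two descriptions of the vertex group, by generators and as a
  stabilizer.\<close>

lemma carrier_vertex_group:
  assumes "V \<in> P"
  shows "carrier (vertex_group P V) = {g \<in> G. g V = V}"
proof -
  let ?J = "{f \<in> facets P. n f \<bullet> V = d f}"
  have "word ws V = V" if "ws \<in> lists ?J" for ws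
    using that by induction (auto simp: s_fixes)
  moreover have "word ws \<in> G" if "ws \<in> lists ?J" for ws
    using that by (intro word_in_G) auto
  ultimately have "word ` lists ?J \<subseteq> {g \<in> G. g V = V}" by blast
  moreover have "{g \<in> G. g V = V} \<subseteq> word ` lists ?J"
    using stabilizer[of _ V] assms by (auto simp: C_eq)
  ultimately show ?thesis unfolding vertex_group_words[OF assms] by (rule equalityI)
qed

end

locale coxeter_polytope_vertex = coxeter_polytope P for P :: "'a::euclidean_space set" +
  fixes V :: 'a
  assumes special_vertex: "special_vertex P V"
begin

lemma V_in_P: "V \<in> P" and V_extreme: "V extreme_point_of P"
  using special_vertex by (auto simp: special_vertex_def extreme_point_of_def)

end

sublocale coxeter_polytope_vertex \<subseteq> special_chamber "facets P" n d V
proof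
  show "V \<in> C" using V_in_P C_eq by simp
  show "y = 0" if "\<And>i. i \<in> facets P \<Longrightarrow> n i \<bullet> V = d i \<Longrightarrow> n i \<bullet> y = 0" for y
    using vertex_normals[OF V_extreme that] .
  show "\<exists>h\<in>G. h V = V \<and> linear_part h = linear_part g" if "g \<in> G" for g
  proof -
    have "linear_part g \<in> linear_part ` {h \<in> G. h V = V}"
      using special_vertex that unfolding special_vertex_def carrier_coxeter_group by blast
    then show ?thesis by fastforce
  qed
  show "\<exists>t\<ge>0. x + t *\<^sub>R y \<notin> C" if "x \<in> C" "y \<noteq> 0" for x y
    using no_ray_P[OF that(2)] C_eq by simp
qed

text \<open>A is prescribed on a basis chosen among the x i, and equal Gram matrices make it an
  isometry. For the remaining indices y i and A (x i) have equal norms and the same products with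
  the image of A, so they coincide.\<close>

lemma exists_isometry_of_gram:
  fixes x y :: "'i \<Rightarrow> 'a::euclidean_space"
  assumes gram: "\<And>i j. i \<in> J \<Longrightarrow> j \<in> J \<Longrightarrow> x i \<bullet> x j = y i \<bullet> y j"
    and total: "\<And>v. (\<And>i. i \<in> J \<Longrightarrow> x i \<bullet> v = 0) \<Longrightarrow> v = 0"
  obtains A where "orthogonal_transformation A" "\<And>i. i \<in> J \<Longrightarrow> A (x i) = y i"
proof -
  obtain B where B: "B \<subseteq> x ` J" "independent B" "x ` J \<subseteq> span B"
    using maximal_independent_subset by blast
  have "v \<in> span B" for v
  proof -
    obtain p q where pq: "p \<in> span B" "\<And>w. w \<in> span B \<Longrightarrow> orthogonal q w" "v = p + q"
      using orthogonal_subspace_decomp_exists by blast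
    have "x i \<bullet> q = 0" if "i \<in> J" for i
      using pq(2)[of "x i"] B(3) that by (auto simp: orthogonal_def inner_commute)
    then have "q = 0" by (rule total)
    then show ?thesis using pq by simp
  qed
  then have spanB: "span B = UNIV" by blast
  define k where "k = inv_into J x"
  have k: "k v \<in> J" "x (k v) = v" if "v \<in> B" for v
    using B(1) that inv_into_into[of v x J] f_inv_into_f[of v x J] by (auto simp: k_def)
  obtain A where A: "linear A" "\<And>v. v \<in> B \<Longrightarrow> A v = y (k v)"
    using linear_independent_extend[OF B(2), of "y \<circ> k"] by auto
  have AB: "A v \<bullet> A w = v \<bullet> w" if "v \<in> B" "w \<in> B" for v w
    using gram[of "k v" "k w"] k that A(2) by simp
  have AB': "A v \<bullet> A w = v \<bullet> w" if "w \<in> B" for v w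
  proof -
    have "v \<in> span B" by (simp add: spanB)
    then show ?thesis
      by (induction rule: span_induct_alt)
        (simp_all add: linear_0[OF A(1)] linear_add[OF A(1)] linear_scale[OF A(1)] inner_add_left AB that)
  qed
  have iso: "A v \<bullet> A w = v \<bullet> w" for v w
  proof -
    have "w \<in> span B" by (simp add: spanB)
    then show ?thesis
      by (induction rule: span_induct_alt)
        (simp_all add: linear_0[OF A(1)] linear_add[OF A(1)] linear_scale[OF A(1)] inner_add_right AB')
  qed
  have "A (x i) = y i" if i: "i \<in> J" for i
  proof -
    have AB'': "y i \<bullet> A w = x i \<bullet> w" for w
    proof -
      have "w \<in> span B" by (simp add: spanB)
      then show ?thesis
      proof (induction rule: span_induct_alt)
        case (step c v w)
        have "y i \<bullet> A v = x i \<bullet> v" using gram[OF i, of "k v"] k A(2) step(1) by simp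
        then show ?case using step
          by (simp add: linear_add[OF A(1)] linear_scale[OF A(1)] inner_add_right)
      qed (simp add: linear_0[OF A(1)])
    qed
    have "(y i - A (x i)) \<bullet> (y i - A (x i)) = 0"
      using AB''[of "x i"] iso[of "x i" "x i"] gram[OF i i]
      by (simp add: inner_diff_left inner_diff_right inner_commute[of "A (x i)" "y i"])
    then show ?thesis by simp
  qed
  moreover have "orthogonal_transformation A" using A(1) iso by (simp add: orthogonal_transformation_def)
  ultimately show ?thesis using that by blast
qed

text \<open>For orthogonal A, the motion with linear part A that carries V to W. The inverse of A
  with the base points exchanged gives the inverse motion.\<close>

definition congruence :: "('a::euclidean_space \<Rightarrow> 'a) \<Rightarrow> 'a \<Rightarrow> 'a \<Rightarrow> 'a \<Rightarrow> 'a" where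
  "congruence A V W x = W + A (x - V)"

definition conjugate :: "('a::euclidean_space \<Rightarrow> 'a) \<Rightarrow> 'a \<Rightarrow> 'a \<Rightarrow> ('a \<Rightarrow> 'a) \<Rightarrow> 'a \<Rightarrow> 'a" where
  "conjugate A V W g = congruence A V W \<circ> g \<circ> congruence (inv_into UNIV A) W V"

lemma congruence_inverse:
  assumes "orthogonal_transformation A"
  shows "congruence (inv_into UNIV A) W V (congruence A V W x) = x" "congruence A V W (congruence (inv_into UNIV A) W V x) = x"
proof -
  have b: "bij A" using assms by (rule orthogonal_transformation_bij)
  show "congruence (inv_into UNIV A) W V (congruence A V W x) = x"
    using b by (simp add: congruence_def bij_is_inj)
  show "congruence A V W (congruence (inv_into UNIV A) W V x) = x"
    using b by (simp add: congruence_def bij_is_surj surj_f_inv_f)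
qed

lemma conjugate_comp:
  "orthogonal_transformation A \<Longrightarrow> conjugate A V W (g \<circ> h) = conjugate A V W g \<circ> conjugate A V W h"
  by (simp add: conjugate_def fun_eq_iff congruence_inverse)

lemma conjugate_inj:
  assumes "orthogonal_transformation A" "conjugate A V W g = conjugate A V W h"
  shows "g = h"
proof
  fix x
  have "conjugate A V W g (congruence A V W x) = conjugate A V W h (congruence A V W x)"
    using assms(2) by simp
  then have "congruence A V W (g x) = congruence A V W (h x)"
    by (simp add: conjugate_def congruence_inverse[OF assms(1)])
  then show "g x = h x" using congruence_inverse(1)[OF assms(1)] by metis
qed

lemma conjugate_hrefl:
  assumes "orthogonal_transformation A"
  shows "conjugate A V W (hrefl u b) = hrefl (A u) (A u \<bullet> W + b - u \<bullet> V)"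
proof
  fix y
  have A: "linear A" "\<And>v w. A v \<bullet> A w = v \<bullet> w" using assms by (auto simp: orthogonal_transformation_def)
  define x where "x = congruence (inv_into UNIV A) W V y"
  have y: "y = W + A (x - V)" using congruence_inverse(2)[OF assms] unfolding x_def congruence_def by metis
  have ux: "u \<bullet> x - b = A u \<bullet> y - (A u \<bullet> W + b - u \<bullet> V)"
    unfolding y by (simp add: inner_add_right A(2) inner_diff_right)
  have "conjugate A V W (hrefl u b) y = W + A (hrefl u b x - V)"
    by (simp add: conjugate_def x_def congruence_def)
  also have "hrefl u b x - V = (x - V) - (2 * (u \<bullet> x - b)) *\<^sub>R u" by (simp add: hrefl_def)
  also have "W + A \<dots> = y - (2 * (u \<bullet> x - b)) *\<^sub>R A u"
    unfolding linear_diff[OF A(1), of "x - V"] linear_scale[OF A(1)] by (simp add: y)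
  finally show "conjugate A V W (hrefl u b) y = hrefl (A u) (A u \<bullet> W + b - u \<bullet> V) y"
    unfolding ux hrefl_def .
qed

lemma is_reflection_conjugate:
  assumes "orthogonal_transformation A" "is_reflection r"
  shows "is_reflection (conjugate A V W r)"
proof -
  obtain u b where "norm u = 1" "r = hrefl u b" using assms(2) by (auto simp: is_reflection_iff)
  then show ?thesis
    using conjugate_hrefl[OF assms(1)] orthogonal_transformation_norm[OF assms(1)]
    unfolding is_reflection_iff by metis
qed

lemma conjugate_fixes:
  assumes "orthogonal_transformation A" "g V = V" shows "conjugate A V W g W = W"
proof -
  have "linear A" using assms(1) by (simp add: orthogonal_transformation_def)
  then have "congruence A V W V = W" by (simp add: congruence_def linear_0)
  then show ?thesis using congruence_inverse(1)[OF assms(1)] assms(2)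
    unfolding conjugate_def by (metis comp_apply)
qed

lemma hrefl_fixes_iff: "norm u = 1 \<Longrightarrow> hrefl u b x = x \<longleftrightarrow> b = u \<bullet> x"
  by (auto simp: hrefl_def)

text \<open>Specialness supplies an element that fixes V and has this linear part, and these two
  data determine it. So every mirror direction of the group also occurs at V.\<close>

lemma (in special_chamber) hrefl_at_V_in_G:
  assumes "hrefl u' 0 \<in> linear_part ` G"
  shows "hrefl u' (u' \<bullet> V) \<in> G"
proof -
  obtain g where "g \<in> G" "linear_part g = hrefl u' 0" using assms by auto
  then obtain h where h: "h \<in> G" "h V = V" "linear_part h = hrefl u' 0" using special by metis
  have "h x = hrefl u' (u' \<bullet> V) x" for x
    using G_diff[OF h(1), of x V] h(2,3) by (simp add: hrefl_def inner_diff_right algebra_simps)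
  then have "h = hrefl u' (u' \<bullet> V)" by blast
  then show ?thesis using h(1) by simp
qed

text \<open>Conjugation is multiplicative, so membership in the group of F is checked on the
  generators at V only; the conjugates fix W, and the stabilizer of W is its vertex group.\<close>

lemma conjugate_vertex_group:
  assumes P: "coxeter_polytope P" "V \<in> P" and F: "coxeter_polytope F" "W \<in> F"
    and A: "orthogonal_transformation A"
    and gen: "\<And>f. f \<in> facets P \<Longrightarrow> outer_normal P f \<bullet> V = facet_offset P f \<Longrightarrow>
               hrefl (A (outer_normal P f)) (A (outer_normal P f) \<bullet> W) \<in> carrier (coxeter_group F)"
    and g: "g \<in> carrier (vertex_group P V)"
  shows "conjugate A V W g \<in> carrier (vertex_group F W)"
proof -
  interpret P: coxeter_polytope P by fact
  interpret F: coxeter_polytope F by fact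
  obtain ws where ws: "ws \<in> lists {f \<in> facets P. P.n f \<bullet> V = P.d f}" "g = P.word ws"
    using g P.vertex_group_words[OF P(2)] by blast
  have "conjugate A V W (P.word ws) \<in> F.G"
    using ws(1)
  proof (induction ws)
    case Nil
    have "conjugate A V W id = id" using A by (simp add: conjugate_def fun_eq_iff congruence_inverse)
    then show ?case using F.id_in_G by (simp only: P.word_simps)
  next
    case (Cons f ws)
    have "conjugate A V W (P.s f) \<in> F.G"
      using gen[of f] Cons.hyps A by (simp add: P.s_def conjugate_hrefl F.carrier_coxeter_group)
    then show ?case using Cons.IH F.comp_in_G by (simp only: P.word_simps conjugate_comp[OF A])
  qed
  moreover have "g V = V" using g P.carrier_vertex_group[OF P(2)] by simp
  then have "conjugate A V W g W = W" by (rule conjugate_fixes[OF A])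
  ultimately show ?thesis using ws(2) F.carrier_vertex_group[OF F(2)] by simp
qed

lemma mult_vertex_group:
  assumes P: "coxeter_polytope P" "V \<in> P" and "g \<in> carrier (vertex_group P V)" "h \<in> carrier (vertex_group P V)"
  shows "g \<otimes>\<^bsub>vertex_group P V\<^esub> h = g \<circ> h"
proof -
  interpret P: coxeter_polytope P by fact
  have "bij g" "bij h" using assms P.carrier_vertex_group[OF P(2)] P.G_bij by auto
  then show ?thesis by (simp add: vertex_group_def mult_BijGroup_UNIV)
qed

lemma same_edges_imp_same_products:
  assumes T: "coxeter_polytope T" and P: "coxeter_polytope P"
    and "f \<in> facets T" "g \<in> facets T" "f \<noteq> g" "f' \<in> facets P" "g' \<in> facets P" "f' \<noteq> g'"
    and "coxeter_edge P f' g' = coxeter_edge T f g"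
  shows "outer_normal P f' \<bullet> outer_normal P g' = outer_normal T f \<bullet> outer_normal T g"
  using coxeter_polytope.normals_product[OF T assms(3-5)]
    coxeter_polytope.coxeter_edge_iff[OF T assms(3-5)] coxeter_polytope.coxeter_edge_iff[OF P assms(6-8)]
    assms(9) by metis

text \<open>The embedding is conjugation by a motion. It matches mirrors of P with those of T only
  in direction, since the facets of T need not pass through W; specialness of W supplies the
  parallel mirrors there.\<close>

theorem embedding_of_subpolytope:
  fixes F P T :: "'a::euclidean_space set"
  assumes "coxeter_polytope_vertex P V" "coxeter_polytope_vertex F W" "coxeter_polytope T"
    and "same_coxeter_diagram T P" "carrier (coxeter_group T) \<subseteq> carrier (coxeter_group F)"
  shows "\<exists>\<phi>. reflection_group_embedding (vertex_group P V) (vertex_group F W) \<phi>"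
proof -
  interpret P: coxeter_polytope_vertex P V by fact
  interpret F: coxeter_polytope_vertex F W by fact
  interpret T: coxeter_polytope T by fact
  obtain \<pi> where pi: "bij_betw \<pi> (facets T) (facets P)"
    "\<And>f g. f \<in> facets T \<Longrightarrow> g \<in> facets T \<Longrightarrow> f \<noteq> g \<Longrightarrow> coxeter_edge P (\<pi> f) (\<pi> g) = coxeter_edge T f g"
    using assms(4) unfolding same_coxeter_diagram_def by blast
  define \<sigma> where "\<sigma> = inv_into (facets T) \<pi>"
  have sigma: "\<sigma> f \<in> facets T" "\<pi> (\<sigma> f) = f" if "f \<in> facets P" for f
    using that pi(1) by (auto simp: \<sigma>_def bij_betw_def inv_into_into f_inv_into_f)
  have gram: "P.n f \<bullet> P.n g = T.n (\<sigma> f) \<bullet> T.n (\<sigma> g)" if "f \<in> facets P" "g \<in> facets P" for f g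
  proof (cases "f = g")
    case False
    then have "\<sigma> f \<noteq> \<sigma> g" using sigma that by metis
    then show ?thesis
      using same_edges_imp_same_products[OF T.coxeter_polytope_axioms P.coxeter_polytope_axioms, of "\<sigma> f" "\<sigma> g" f g]
        pi(2) sigma that False by metis
  qed (use that sigma in auto)
  \<comment> \<open>The facets at V suffice: their normals span, and their reflections generate the
    vertex group.\<close>
  obtain A where A: "orthogonal_transformation A"
    "\<And>f. f \<in> {f \<in> facets P. P.n f \<bullet> V = P.d f} \<Longrightarrow> A (P.n f) = T.n (\<sigma> f)"
  proof (rule exists_isometry_of_gram[of "{f \<in> facets P. P.n f \<bullet> V = P.d f}" P.n "\<lambda>f. T.n (\<sigma> f)"])
    show "v = 0" if "\<And>i. i \<in> {f \<in> facets P. P.n f \<bullet> V = P.d f} \<Longrightarrow> P.n i \<bullet> v = 0" for v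
      using that P.vertex by blast
  qed (use gram in auto)
  have gen: "hrefl (A (P.n f)) (A (P.n f) \<bullet> W) \<in> carrier (coxeter_group F)"
    if f: "f \<in> facets P" "P.n f \<bullet> V = P.d f" for f
  proof -
    have "T.s (\<sigma> f) \<in> F.G"
      using T.s_in_G sigma f assms(5) T.carrier_coxeter_group F.carrier_coxeter_group by blast
    then have "linear_part (T.s (\<sigma> f)) \<in> linear_part ` F.G" by (rule imageI)
    then have "hrefl (A (P.n f)) 0 \<in> linear_part ` F.G" using A(2) f by (simp add: T.linear_part_s)
    then show ?thesis using F.hrefl_at_V_in_G F.carrier_coxeter_group by simp
  qed
  have into: "conjugate A V W g \<in> carrier (vertex_group F W)" if "g \<in> carrier (vertex_group P V)" for g
    using P.coxeter_polytope_axioms P.V_in_P F.coxeter_polytope_axioms F.V_in_P A(1) gen that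
    by (rule conjugate_vertex_group)
  have "conjugate A V W \<in> hom (vertex_group P V) (vertex_group F W)"
  proof (rule homI)
    fix g h assume gh: "g \<in> carrier (vertex_group P V)" "h \<in> carrier (vertex_group P V)"
    then show "conjugate A V W (g \<otimes>\<^bsub>vertex_group P V\<^esub> h)
        = conjugate A V W g \<otimes>\<^bsub>vertex_group F W\<^esub> conjugate A V W h"
      using mult_vertex_group[OF P.coxeter_polytope_axioms P.V_in_P gh]
        mult_vertex_group[OF F.coxeter_polytope_axioms F.V_in_P into[OF gh(1)] into[OF gh(2)]]
        conjugate_comp[OF A(1)] by simp
  qed (use into in blast)
  moreover have "inj_on (conjugate A V W) (carrier (vertex_group P V))"
    using conjugate_inj[OF A(1)] by (intro inj_onI)
  ultimately have "reflection_group_embedding (vertex_group P V) (vertex_group F W) (conjugate A V W)"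
    using is_reflection_conjugate[OF A(1)] by (simp add: reflection_group_embedding_def mon_def)
  then show ?thesis by blast
qed

section \<open>Braid relations, signs and block scalings\<close>

lemma hrefl_at: "hrefl u (u \<bullet> V) (V + y) = V + y - (2 * (u \<bullet> y)) *\<^sub>R u"
  by (simp add: hrefl_def inner_add_right)

lemma combination_zero:
  fixes a c :: "'a::real_inner"
  assumes "norm a = 1" "norm c = 1" "(a \<bullet> c)\<^sup>2 < 1" "\<And>y. k *\<^sub>R ((c \<bullet> y) *\<^sub>R a - (a \<bullet> y) *\<^sub>R c) = 0"
  shows "k = 0"
proof (rule ccontr)
  assume "k \<noteq> 0"
  then have "(c \<bullet> a) *\<^sub>R a = c" using assms(4)[of a] assms(1) by (simp add: dot_square_norm)
  then have "((c \<bullet> a) *\<^sub>R a) \<bullet> c = c \<bullet> c" by simp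
  then show False using assms(2,3) by (simp add: dot_square_norm inner_commute[of c a] power2_eq_square)
qed

lemma combination_zero':
  fixes a c :: "'a::real_inner"
  assumes "norm a = 1" "norm c = 1" "(a \<bullet> c)\<^sup>2 < 1" "\<And>y. k *\<^sub>R ((a \<bullet> y) *\<^sub>R a - (c \<bullet> y) *\<^sub>R c) = 0"
  shows "k = 0"
proof (rule ccontr)
  assume "k \<noteq> 0"
  then have "(c \<bullet> a) *\<^sub>R c = a" using assms(4)[of a] assms(1) by (simp add: dot_square_norm)
  then have "((c \<bullet> a) *\<^sub>R c) \<bullet> a = a \<bullet> a" by simp
  then show False using assms(1,3) by (simp add: dot_square_norm inner_commute[of c a] power2_eq_square)
qed

section \<open>Two mirrors through a common point\<close>

context
  fixes a c V :: "'a::euclidean_space"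
  assumes ac: "norm a = 1" "norm c = 1" "(a \<bullet> c)\<^sup>2 < 1"
begin

private abbreviation "ra \<equiv> hrefl a (a \<bullet> V)"
private abbreviation "rc \<equiv> hrefl c (c \<bullet> V)"

private lemma products: "a \<bullet> a = 1" "c \<bullet> c = 1" "c \<bullet> a = a \<bullet> c"
  using ac by (simp_all add: dot_square_norm inner_commute)

private lemma fun_eq_at_V: "(f::'a \<Rightarrow> 'a) = g \<longleftrightarrow> (\<forall>y. f (V + y) - g (V + y) = 0)"
proof
  assume h: "\<forall>y. f (V + y) - g (V + y) = 0"
  show "f = g"
  proof
    fix x show "f x = g x" using h[rule_format, of "x - V"] by simp
  qed
qed simp

text \<open>Words in \<open>ra\<close> and \<open>rc\<close> displace V + y only within the span of
  a and c, so they are evaluated by rewriting the two coefficients p and q.\<close>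

private lemma apply_ra:
  "ra (V + (y + p *\<^sub>R a + q *\<^sub>R c)) = V + (y + (- p - 2 * (a \<bullet> y) - 2 * (a \<bullet> c) * q) *\<^sub>R a + q *\<^sub>R c)"
  unfolding hrefl_at by (simp add: inner_add_right products algebra_simps flip: scaleR_2)

private lemma apply_rc:
  "rc (V + (y + p *\<^sub>R a + q *\<^sub>R c)) = V + (y + p *\<^sub>R a + (- q - 2 * (c \<bullet> y) - 2 * (a \<bullet> c) * p) *\<^sub>R c)"
  unfolding hrefl_at by (simp add: inner_add_right products algebra_simps flip: scaleR_2)

private lemma start: "V + y = V + (y + 0 *\<^sub>R a + 0 *\<^sub>R c)"
  by simp

private lemma difference:
  assumes "p - p' = k * (c \<bullet> y)" "q - q' = - k * (a \<bullet> y)"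
  shows "(V + (y + p *\<^sub>R a + q *\<^sub>R c)) - (V + (y + p' *\<^sub>R a + q' *\<^sub>R c))
    = k *\<^sub>R ((c \<bullet> y) *\<^sub>R a - (a \<bullet> y) *\<^sub>R c)"
proof -
  have "(V + (y + p *\<^sub>R a + q *\<^sub>R c)) - (V + (y + p' *\<^sub>R a + q' *\<^sub>R c)) = (p - p') *\<^sub>R a + (q - q') *\<^sub>R c"
    by (simp add: algebra_simps)
  then show ?thesis unfolding assms by (simp add: algebra_simps)
qed

private lemma difference':
  assumes "p - p' = k * (a \<bullet> y)" "q - q' = - k * (c \<bullet> y)"
  shows "(V + (y + p *\<^sub>R a + q *\<^sub>R c)) - (V + (y + p' *\<^sub>R a + q' *\<^sub>R c))
    = k *\<^sub>R ((a \<bullet> y) *\<^sub>R a - (c \<bullet> y) *\<^sub>R c)"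
proof -
  have "(V + (y + p *\<^sub>R a + q *\<^sub>R c)) - (V + (y + p' *\<^sub>R a + q' *\<^sub>R c)) = (p - p') *\<^sub>R a + (q - q') *\<^sub>R c"
    by (simp add: algebra_simps)
  then show ?thesis unfolding assms by (simp add: algebra_simps)
qed

text \<open>The factor \<open>4 * (a \<bullet> c)\<close>, like those for lengths 3 and 4 below, is
  up to sign twice \<open>cheb (a \<bullet> c) m\<close> with m the length of the words. In contrast
  to \<open>braid\<close>, the product may have either sign and an equivalence is obtained.\<close>

lemma commute_iff: "ra \<circ> rc = rc \<circ> ra \<longleftrightarrow> (a \<bullet> c) = 0"
proof -
  have "(ra \<circ> rc) (V + y) - (rc \<circ> ra) (V + y) = (4 * (a \<bullet> c)) *\<^sub>R ((c \<bullet> y) *\<^sub>R a - (a \<bullet> y) *\<^sub>R c)" for y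
    unfolding comp_apply start[of y] apply_ra apply_rc
    by (rule difference) (simp_all add: algebra_simps)
  then show ?thesis unfolding fun_eq_at_V using combination_zero[OF ac, of "4 * (a \<bullet> c)"] by auto
qed

lemma braid3_iff: "ra \<circ> rc \<circ> ra = rc \<circ> ra \<circ> rc \<longleftrightarrow> 4 * (a \<bullet> c)\<^sup>2 = 1"
proof -
  have "(ra \<circ> rc \<circ> ra) (V + y) - (rc \<circ> ra \<circ> rc) (V + y)
      = (2 - 8 * (a \<bullet> c)\<^sup>2) *\<^sub>R ((a \<bullet> y) *\<^sub>R a - (c \<bullet> y) *\<^sub>R c)" for y
    unfolding comp_apply start[of y] apply_ra apply_rc
    by (rule difference') (simp_all add: algebra_simps power2_eq_square)
  then show ?thesis unfolding fun_eq_at_V using combination_zero'[OF ac, of "2 - 8 * (a \<bullet> c)\<^sup>2"] by auto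
qed

lemma braid4_iff: "ra \<circ> rc \<circ> ra \<circ> rc = rc \<circ> ra \<circ> rc \<circ> ra \<longleftrightarrow> a \<bullet> c = 0 \<or> 4 * (a \<bullet> c)\<^sup>2 = 2"
proof -
  have "(ra \<circ> rc \<circ> ra \<circ> rc) (V + y) - (rc \<circ> ra \<circ> rc \<circ> ra) (V + y)
      = (8 * (a \<bullet> c) * (2 * (a \<bullet> c)\<^sup>2 - 1)) *\<^sub>R ((c \<bullet> y) *\<^sub>R a - (a \<bullet> y) *\<^sub>R c)" for y
    unfolding comp_apply start[of y] apply_ra apply_rc
    by (rule difference) (simp_all add: algebra_simps power2_eq_square)
  then show ?thesis
    unfolding fun_eq_at_V using combination_zero[OF ac, of "8 * (a \<bullet> c) * (2 * (a \<bullet> c)\<^sup>2 - 1)"] by auto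
qed

end

text \<open>
  Under the crystallographic restriction the angle between two mirrors is determined by which of the
  braid relations of length 2, 3 and 4 hold.
\<close>

lemma product_square_determined:
  fixes a c V :: "'a::euclidean_space" and a' c' V' :: "'b::euclidean_space" and k k' :: int
  assumes "norm a = 1" "norm c = 1" "(a \<bullet> c)\<^sup>2 < 1" "4 * (a \<bullet> c)\<^sup>2 = of_int k"
    and "norm a' = 1" "norm c' = 1" "(a' \<bullet> c')\<^sup>2 < 1" "4 * (a' \<bullet> c')\<^sup>2 = of_int k'"
    and "ra = hrefl a (a \<bullet> V)" "rc = hrefl c (c \<bullet> V)" "ra' = hrefl a' (a' \<bullet> V')" "rc' = hrefl c' (c' \<bullet> V')"
    and "ra \<circ> rc = rc \<circ> ra \<longleftrightarrow> ra' \<circ> rc' = rc' \<circ> ra'"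
    and "ra \<circ> rc \<circ> ra = rc \<circ> ra \<circ> rc \<longleftrightarrow> ra' \<circ> rc' \<circ> ra' = rc' \<circ> ra' \<circ> rc'"
    and "ra \<circ> rc \<circ> ra \<circ> rc = rc \<circ> ra \<circ> rc \<circ> ra \<longleftrightarrow> ra' \<circ> rc' \<circ> ra' \<circ> rc' = rc' \<circ> ra' \<circ> rc' \<circ> ra'"
  shows "(a \<bullet> c)\<^sup>2 = (a' \<bullet> c')\<^sup>2"
proof -
  \<comment> \<open>Four values of k remain, so three yes/no tests decide: k = 3 is the case in
    which no braid relation holds.\<close>
  have range: "j = 0 \<or> j = 1 \<or> j = 2 \<or> j = 3" if "4 * x\<^sup>2 = of_int j" "x\<^sup>2 < 1" for j :: int and x :: real
  proof -
    have "(of_int j :: real) < 4" using that by linarith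
    moreover have "0 \<le> (of_int j :: real)" unfolding that(1)[symmetric] by simp
    ultimately show ?thesis by linarith
  qed
  have zero: "x = 0 \<longleftrightarrow> j = 0" if "4 * x\<^sup>2 = of_int j" for j :: int and x :: real
    using that by auto
  have "(k = 0) = (k' = 0)"
    using assms(13) unfolding assms(9-12) commute_iff[OF assms(1-3)] commute_iff[OF assms(5-7)]
    using zero assms(4,8) by blast
  moreover have "(k = 1) = (k' = 1)"
    using assms(14) unfolding assms(9-12) braid3_iff[OF assms(1-3)] braid3_iff[OF assms(5-7)]
    unfolding assms(4,8) by simp
  moreover have "(k = 0 \<or> k = 2) = (k' = 0 \<or> k' = 2)"
    using assms(15) unfolding assms(9-12) braid4_iff[OF assms(1-3)] braid4_iff[OF assms(5-7)]
    unfolding assms(4,8) zero[OF assms(4)] zero[OF assms(8)] by simp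
  ultimately have "k = k'" using range[OF assms(4,3)] range[OF assms(8,7)] by auto
  then show ?thesis using assms(4,8) by simp
qed

text \<open>
  The Coxeter graph of linearly independent simple roots has fewer edges than nodes, since the square
  norm of the sum of the roots is positive; hence it has a leaf, whose sign can be chosen last.
\<close>

lemma exists_signs:
  fixes x :: "'i \<Rightarrow> 'a::real_inner" and y :: "'i \<Rightarrow> 'b::real_inner"
  assumes "finite J" "\<And>i. i \<in> J \<Longrightarrow> norm (x i) = 1"
    and "\<And>i j. i \<in> J \<Longrightarrow> j \<in> J \<Longrightarrow> i \<noteq> j \<Longrightarrow> x i \<bullet> x j = 0 \<or> x i \<bullet> x j \<le> - 1 / 2"
    and "\<And>i j. i \<in> J \<Longrightarrow> j \<in> J \<Longrightarrow> (x i \<bullet> x j)\<^sup>2 = (y i \<bullet> y j)\<^sup>2"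
    and "\<And>K. K \<subseteq> J \<Longrightarrow> K \<noteq> {} \<Longrightarrow> (\<Sum>i\<in>K. x i) \<noteq> 0"
  shows "\<exists>\<epsilon>::'i \<Rightarrow> real. (\<forall>i. \<epsilon> i = 1 \<or> \<epsilon> i = - 1) \<and>
     (\<forall>i\<in>J. \<forall>j\<in>J. x i \<bullet> x j = (\<epsilon> i * \<epsilon> j) * (y i \<bullet> y j))"
  using assms
proof (induction "card J" arbitrary: J)
  case 0
  then show ?case by (intro exI[of _ "\<lambda>_. 1"]) auto
next
  case (Suc m)
  note fin = Suc.prems(1)
  \<comment> \<open>The squared norm of the sum of all x i is the sum of the row sums 1 + w i of the
    Gram matrix, so some row sum is positive.\<close>
  define w where "w i = (\<Sum>j\<in>J - {i}. x i \<bullet> x j)" for i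
  have "J \<noteq> {}" using Suc.hyps(2) by auto
  then have "0 < (\<Sum>i\<in>J. x i) \<bullet> (\<Sum>i\<in>J. x i)" using Suc.prems(5)[OF order_refl] unfolding inner_gt_zero_iff by blast
  also have "\<dots> = (\<Sum>i\<in>J. \<Sum>j\<in>J. x i \<bullet> x j)"
    unfolding inner_sum_left unfolding inner_sum_right ..
  also have "\<dots> = (\<Sum>i\<in>J. 1 + w i)"
  proof (intro sum.cong refl)
    fix i assume i: "i \<in> J"
    have "x i \<bullet> x i = 1" using Suc.prems(2)[OF i] by (simp add: dot_square_norm)
    then show "(\<Sum>j\<in>J. x i \<bullet> x j) = 1 + w i" using fin i by (simp add: w_def sum.remove)
  qed
  finally have "\<exists>i\<in>J. 0 < 1 + w i" using sum_nonpos[of J "\<lambda>i. 1 + w i"] by (meson not_le)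
  then obtain l where l: "l \<in> J" "0 < 1 + w l" by blast
  \<comment> \<open>Two neighbours of l would contribute at most -1 to w l, and all other terms are
    nonpositive; so l has at most one neighbour.\<close>
  have leaf: "j = k" if jk: "j \<in> J - {l}" "k \<in> J - {l}" "x l \<bullet> x j \<noteq> 0" "x l \<bullet> x k \<noteq> 0" for j k
  proof (rule ccontr)
    assume "j \<noteq> k"
    have "w l \<le> (\<Sum>i\<in>{j,k}. x l \<bullet> x i)"
      unfolding w_def
    proof -
      have "(\<Sum>i\<in>J - {l}. x l \<bullet> x i) = (\<Sum>i\<in>{j,k}. x l \<bullet> x i) + (\<Sum>i\<in>J - {l} - {j,k}. x l \<bullet> x i)"
        using fin jk by (subst sum.subset_diff[of "{j,k}"]) auto
      moreover have "(\<Sum>i\<in>J - {l} - {j,k}. x l \<bullet> x i) \<le> 0"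
        using Suc.prems(3)[OF l(1)] by (intro sum_nonpos) force
      ultimately show "(\<Sum>i\<in>J - {l}. x l \<bullet> x i) \<le> (\<Sum>i\<in>{j,k}. x l \<bullet> x i)" by simp
    qed
    also have "\<dots> = x l \<bullet> x j + x l \<bullet> x k" using \<open>j \<noteq> k\<close> by simp
    also have "\<dots> \<le> - 1 / 2 + - 1 / 2"
      using Suc.prems(3)[OF l(1), of j] Suc.prems(3)[OF l(1), of k] jk by (intro add_mono) auto
    finally show False using l(2) by simp
  qed
  have "\<exists>\<epsilon>::'i \<Rightarrow> real. (\<forall>i. \<epsilon> i = 1 \<or> \<epsilon> i = - 1) \<and>
     (\<forall>i\<in>J - {l}. \<forall>j\<in>J - {l}. x i \<bullet> x j = (\<epsilon> i * \<epsilon> j) * (y i \<bullet> y j))"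
    using Suc.hyps(2) fin l(1) by (intro Suc.hyps(1) Suc.prems) auto
  then obtain \<epsilon> :: "'i \<Rightarrow> real" where eps: "\<And>i. \<epsilon> i = 1 \<or> \<epsilon> i = - 1"
    "\<And>i j. i \<in> J - {l} \<Longrightarrow> j \<in> J - {l} \<Longrightarrow> x i \<bullet> x j = (\<epsilon> i * \<epsilon> j) * (y i \<bullet> y j)" by blast
  have sq: "x i \<bullet> x j = y i \<bullet> y j \<or> x i \<bullet> x j = - (y i \<bullet> y j)" if "i \<in> J" "j \<in> J" for i j
    using Suc.prems(4)[OF that] by (simp add: power2_eq_iff)
  have "\<exists>e::real. (e = 1 \<or> e = - 1) \<and> (\<forall>j\<in>J - {l}. x l \<bullet> x j = (e * \<epsilon> j) * (y l \<bullet> y j))"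
  proof (cases "\<exists>k\<in>J - {l}. x l \<bullet> x k \<noteq> 0")
    case True
    then obtain k where k: "k \<in> J - {l}" "x l \<bullet> x k \<noteq> 0" by blast
    define e where "e = (if x l \<bullet> x k = y l \<bullet> y k then \<epsilon> k else - \<epsilon> k)"
    have ek: "\<epsilon> k * \<epsilon> k = 1" using eps(1)[of k] by auto
    have "x l \<bullet> x j = (e * \<epsilon> j) * (y l \<bullet> y j)" if j: "j \<in> J - {l}" for j
    proof (cases "j = k")
      case True
      then show ?thesis using sq[of l k] l(1) k(1) ek by (auto simp: e_def)
    next
      case False
      then have "x l \<bullet> x j = 0" using leaf[OF j k(1) _ k(2)] by blast
      moreover from this have "y l \<bullet> y j = 0" using sq[of l j] l(1) j by auto
      ultimately show ?thesis by simp
    qed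
    moreover have "e = 1 \<or> e = - 1" using eps(1)[of k] by (auto simp: e_def)
    ultimately show ?thesis by blast
  next
    case False
    then have "x l \<bullet> x j = 0 \<and> y l \<bullet> y j = 0" if "j \<in> J - {l}" for j
      using sq[of l j] l(1) that by auto
    then show ?thesis by (intro exI[of _ 1]) auto
  qed
  then obtain e :: real where e: "e = 1 \<or> e = - 1" "\<And>j. j \<in> J - {l} \<Longrightarrow> x l \<bullet> x j = (e * \<epsilon> j) * (y l \<bullet> y j)"
    by blast
  have ll: "x l \<bullet> x l = y l \<bullet> y l"
  proof -
    have "0 \<le> x l \<bullet> x l" "0 \<le> y l \<bullet> y l" by simp_all
    then show ?thesis using Suc.prems(4)[OF l(1) l(1)] unfolding power2_eq_iff by linarith
  qed
  define \<epsilon>' where "\<epsilon>' = \<epsilon>(l := e)"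
  have "x i \<bullet> x j = (\<epsilon>' i * \<epsilon>' j) * (y i \<bullet> y j)" if "i \<in> J" "j \<in> J" for i j
  proof -
    consider "i = l" "j = l" | "i = l" "j \<noteq> l" | "i \<noteq> l" "j = l" | "i \<noteq> l" "j \<noteq> l" by blast
    then show ?thesis
    proof cases
      case 1
      then show ?thesis using ll e(1) by (auto simp: \<epsilon>'_def)
    next
      case 2
      then show ?thesis using e(2)[of j] that by (simp add: \<epsilon>'_def)
    next
      case 3
      then show ?thesis using e(2)[of i] that
        by (simp add: \<epsilon>'_def inner_commute[of "x i" "x l"] inner_commute[of "y i" "y l"] mult.commute)
    next
      case 4
      then show ?thesis using eps(2)[of i j] that by (simp add: \<epsilon>'_def)
    qed
  qed
  moreover have "\<forall>i. \<epsilon>' i = 1 \<or> \<epsilon>' i = - 1" using eps(1) e(1) by (simp add: \<epsilon>'_def)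
  ultimately show ?case by blast
qed

section \<open>Roots at the special vertex and the walls missing it\<close>

context special_chamber
begin

definition J :: "'i set" where "J = {i \<in> I. u i \<bullet> V = b i}"

lemma J_sub: "J \<subseteq> I" and finite_J: "finite J"
  using finite_I by (auto simp: J_def)

text \<open>The normals at V lie in an open half-space: each has positive product with V - z for an
  interior point z.\<close>

lemma nonneg_combination_zero:
  assumes "\<And>j. j \<in> J \<Longrightarrow> 0 \<le> c j" "(\<Sum>j\<in>J. c j *\<^sub>R u j) = 0" "j \<in> J"
  shows "c j = 0"
proof -
  obtain z where z: "\<And>i. i \<in> I \<Longrightarrow> u i \<bullet> z < b i" using interior_point by blast
  have pos: "u i \<bullet> (V - z) > 0" if "i \<in> J" for i
    using z[of i] that by (auto simp: J_def inner_diff_right)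
  have "(\<Sum>j\<in>J. c j * (u j \<bullet> (V - z))) = (\<Sum>j\<in>J. c j *\<^sub>R u j) \<bullet> (V - z)"
    by (simp add: inner_sum_left)
  then have "(\<Sum>j\<in>J. c j * (u j \<bullet> (V - z))) = 0" using assms(2) by simp
  moreover have "\<And>j. j \<in> J \<Longrightarrow> 0 \<le> c j * (u j \<bullet> (V - z))"
    using assms(1) pos by (simp add: less_imp_le)
  ultimately have "c j * (u j \<bullet> (V - z)) = 0"
    using sum_nonneg_eq_0_iff[OF finite_J] assms(3) by (metis (no_types, lifting))
  then show ?thesis using pos[OF assms(3)] by simp
qed

lemma sum_pos_neg:
  fixes c :: "'i \<Rightarrow> real"
  shows "(\<Sum>j\<in>J. c j *\<^sub>R u j) = (\<Sum>j\<in>J. max (c j) 0 *\<^sub>R u j) - (\<Sum>j\<in>J. max (- c j) 0 *\<^sub>R u j)"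
proof -
  have "c j = max (c j) 0 - max (- c j) 0" for j by (simp add: max_def)
  then have "c j *\<^sub>R u j = max (c j) 0 *\<^sub>R u j - max (- c j) 0 *\<^sub>R u j" for j
    by (metis scaleR_diff_left)
  then show ?thesis by (simp add: sum_subtractf)
qed

text \<open>The two sums have disjoint supports, so only products of distinct normals survive, and
  these are nonpositive.\<close>

lemma pos_neg_product:
  "(\<Sum>j\<in>J. max (c j) 0 *\<^sub>R u j) \<bullet> (\<Sum>j\<in>J. max (- c j) 0 *\<^sub>R u j) \<le> 0"
proof -
  have "max (- c j) 0 * (max (c i) 0 * (u i \<bullet> u j)) \<le> 0" if "i \<in> J" "j \<in> J" for i j
  proof (cases "i = j")
    case False
    then have "u i \<bullet> u j \<le> 0" using that J_sub by (intro u_nonpos) auto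
    then show ?thesis by (simp add: mult_nonneg_nonpos)
  qed (simp add: max_def)
  then show ?thesis
    unfolding inner_sum_left inner_sum_right by (intro sum_nonpos) (simp add: inner_scaleR_left)
qed

text \<open>Obtuse vectors in an open half-space: the positive and negative parts of a relation are
  equal, so their nonpositive product is a squared norm.\<close>

lemma independent_coefficients:
  assumes "(\<Sum>j\<in>J. c j *\<^sub>R u j) = 0" "j \<in> J"
  shows "c j = 0"
proof -
  let ?p = "\<Sum>j\<in>J. max (c j) 0 *\<^sub>R u j" and ?q = "\<Sum>j\<in>J. max (- c j) 0 *\<^sub>R u j"
  have eq: "?p = ?q" using assms(1) sum_pos_neg[of c] by simp
  then have "?p \<bullet> ?p \<le> 0" using pos_neg_product[of c] by simp
  then have "?p = 0" by (metis inner_gt_zero_iff not_le)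
  then have "max (c j) 0 = 0" "max (- c j) 0 = 0"
    using nonneg_combination_zero[of "\<lambda>j. max (c j) 0" j] nonneg_combination_zero[of "\<lambda>j. max (- c j) 0" j]
      eq assms(2) by auto
  then show ?thesis by (auto simp: max_def split: if_splits)
qed

lemma inj_on_u: "inj_on u J"
proof
  fix i j assume ij: "i \<in> J" "j \<in> J" "u i = u j"
  show "i = j"
  proof (rule ccontr)
    assume "i \<noteq> j"
    then have "u i \<bullet> u j \<le> 0" using ij J_sub by (intro u_nonpos) auto
    then show False using ij J_sub u_self[of j] by (auto simp del: u_self)
  qed
qed

lemma span_J: "span (u ` J) = UNIV"
proof -
  have "v \<in> span (u ` J)" for v
  proof -
    obtain p q where pq: "p \<in> span (u ` J)" "\<And>w. w \<in> span (u ` J) \<Longrightarrow> orthogonal q w" "v = p + q"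
      using orthogonal_subspace_decomp_exists by blast
    have "u i \<bullet> q = 0" if "i \<in> J" for i
      using pq(2)[OF span_base, of "u i"] that by (simp add: orthogonal_def inner_commute)
    then have "q = 0" by (intro vertex) (auto simp: J_def)
    then show ?thesis using pq by simp
  qed
  then show ?thesis by blast
qed

lemma independent_J: "independent (u ` J)"
  unfolding independent_explicit
proof (intro conjI allI impI ballI)
  fix c v assume c: "(\<Sum>v\<in>u ` J. c v *\<^sub>R v) = 0" and v: "v \<in> u ` J"
  have "(\<Sum>j\<in>J. c (u j) *\<^sub>R u j) = 0" using c by (simp add: sum.reindex[OF inj_on_u])
  then show "c v = 0" using independent_coefficients[of "c \<circ> u"] v by auto
qed (simp add: finite_J)

lemma coefficients:
  obtains c where "v = (\<Sum>j\<in>J. c j *\<^sub>R u j)"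
proof -
  have "v \<in> span (u ` J)" by (simp add: span_J)
  then obtain c where "v = (\<Sum>w\<in>u ` J. c w *\<^sub>R w)"
    using span_finite[of "u ` J"] finite_J by auto
  then have "v = (\<Sum>j\<in>J. c (u j) *\<^sub>R u j)" by (simp add: sum.reindex[OF inj_on_u])
  then show ?thesis by (rule that[of "\<lambda>j. c (u j)"])
qed

text \<open>The part ?q of u e with positive coefficients has nonpositive product with u e, which
  expands into the squared norm of ?q minus a nonpositive number; hence ?q = 0.\<close>

lemma far_wall_coefficients:
  assumes "e \<in> I - J" "u e = - (\<Sum>j\<in>J. c j *\<^sub>R u j)" "j \<in> J"
  shows "0 \<le> c j"
proof -
  let ?p = "\<Sum>j\<in>J. max (c j) 0 *\<^sub>R u j" and ?q = "\<Sum>j\<in>J. max (- c j) 0 *\<^sub>R u j"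
  have e: "u e = ?q - ?p" using assms(2) sum_pos_neg[of c] by simp
  have "max (- c i) 0 * (u i \<bullet> u e) \<le> 0" if "i \<in> J" for i
  proof -
    have "u i \<bullet> u e \<le> 0" using that assms(1) J_sub by (intro u_nonpos) auto
    then show ?thesis by (simp add: mult_nonneg_nonpos)
  qed
  then have "?q \<bullet> u e \<le> 0" unfolding inner_sum_left by (intro sum_nonpos) simp
  moreover have "?q \<bullet> u e = ?q \<bullet> ?q - ?p \<bullet> ?q" by (simp add: e inner_diff_right inner_commute)
  ultimately have "?q \<bullet> ?q \<le> 0" using pos_neg_product[of c] by linarith
  then have "?q = 0" by (metis inner_gt_zero_iff not_le)
  then have "max (- c j) 0 = 0" using nonneg_combination_zero[of "\<lambda>j. max (- c j) 0" j] assms(3) by simp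
  then show ?thesis by (auto simp: max_def split: if_splits)
qed

text \<open>
  The walls missing \<open>V\<close> have normals \<open>- (\<Sum>j. c j *\<^sub>R u j)\<close> with \<open>c j \<ge> 0\<close>, and the supports of the
  coefficients for different such walls are disjoint, mutually orthogonal blocks.
\<close>

lemma block_scaling:
  fixes l :: "'i \<Rightarrow> real"
  assumes l: "\<And>e. e \<in> I - J \<Longrightarrow> 0 < l e"
  obtains D \<mu> where "linear D" "\<And>x y. x \<bullet> D y = D x \<bullet> y" "\<And>i. i \<in> I \<Longrightarrow> 0 < \<mu> i"
    "\<And>i. i \<in> I \<Longrightarrow> D (u i) = \<mu> i *\<^sub>R u i" "\<And>e. e \<in> I - J \<Longrightarrow> \<mu> e = l e"
proof -
  have "\<exists>c. u e = - (\<Sum>j\<in>J. c j *\<^sub>R u j)" for e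
    using coefficients[of "- u e"] by (metis minus_minus)
  then obtain c where c: "\<And>e. u e = - (\<Sum>j\<in>J. c e j *\<^sub>R u j)" by metis
  have c0: "0 \<le> c e j" if "e \<in> I - J" "j \<in> J" for e j using far_wall_coefficients[OF that(1) c that(2)] .
  have inner_c: "v \<bullet> u e = - (\<Sum>j\<in>J. c e j * (v \<bullet> u j))" for v e
    by (subst c) (simp add: inner_sum_right)
  \<comment> \<open>The product of u k and u e is at most 0 but expands into minus a sum of
    nonpositive terms, so every term vanishes.\<close>
  have ortho: "u j \<bullet> u k = 0" if e: "e \<in> I - J" "j \<in> J" "0 < c e j" and k: "k \<in> I" "k \<noteq> e"
    and nonpos: "\<And>i. i \<in> J \<Longrightarrow> c e i * (u k \<bullet> u i) \<le> 0" for e j k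
  proof -
    have "u k \<bullet> u e \<le> 0" using e k by (intro u_nonpos) auto
    then have "0 \<le> (\<Sum>i\<in>J. c e i * (u k \<bullet> u i))" using inner_c[of "u k" e] by simp
    moreover have "(\<Sum>i\<in>J. c e i * (u k \<bullet> u i)) \<le> 0" using nonpos by (rule sum_nonpos)
    ultimately have "(\<Sum>i\<in>J. - (c e i * (u k \<bullet> u i))) = 0" by (simp add: sum_negf)
    moreover have "\<And>i. i \<in> J \<Longrightarrow> 0 \<le> - (c e i * (u k \<bullet> u i))" using nonpos by simp
    ultimately have "- (c e j * (u k \<bullet> u j)) = 0"
      using sum_nonneg_eq_0_iff[OF finite_J] e(2) by (metis (no_types, lifting))
    then show ?thesis using e(3) by (simp add: inner_commute)
  qed
  have block: "u j \<bullet> u k = 0" if "e \<in> I - J" "j \<in> J" "0 < c e j" "k \<in> J" "\<not> 0 < c e k" for e j k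
  proof (rule ortho[OF that(1-3)])
    show "k \<in> I" "k \<noteq> e" using that J_sub by auto
    fix i assume i: "i \<in> J"
    \<comment> \<open>This removes the diagonal term i = k, the only one with a positive
      product.\<close>
    have "c e k = 0" using c0[OF that(1,4)] that(5) by simp
    then show "c e i * (u k \<bullet> u i) \<le> 0"
    proof (cases "i = k")
      case False
      then have "u k \<bullet> u i \<le> 0" using i that(4) J_sub by (intro u_nonpos) auto
      then show ?thesis using c0[OF that(1) i] by (simp add: mult_nonneg_nonpos)
    qed simp
  qed
  have far: "u j \<bullet> u e' = 0" if "e \<in> I - J" "j \<in> J" "0 < c e j" "e' \<in> I - J" "e \<noteq> e'" for e e' j
  proof (rule ortho[OF that(1-3)])
    show "e' \<in> I" "e' \<noteq> e" using that by auto
    fix i assume i: "i \<in> J"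
    then have "u e' \<bullet> u i \<le> 0" using that J_sub by (intro u_nonpos) auto
    then show "c e i * (u e' \<bullet> u i) \<le> 0" using c0[OF that(1) i] by (simp add: mult_nonneg_nonpos)
  qed
  \<comment> \<open>The part ?p of - u e' in the block of e is orthogonal to u e' by
    \<open>far\<close> and to the rest by \<open>block\<close>, hence to itself.\<close>
  have disjoint: "e = e'" if ee: "e \<in> I - J" "e' \<in> I - J" "j \<in> J" "0 < c e j" "0 < c e' j" for e e' j
  proof (rule ccontr)
    assume ne: "e \<noteq> e'"
    let ?c = "\<lambda>i. if 0 < c e i then c e' i else 0"
    let ?p = "\<Sum>i\<in>J. ?c i *\<^sub>R u i" and ?r = "\<Sum>i\<in>J. (if 0 < c e i then 0 else c e' i) *\<^sub>R u i"
    have "?p + ?r = (\<Sum>i\<in>J. c e' i *\<^sub>R u i)"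
      unfolding sum.distrib[symmetric] by (intro sum.cong) auto
    then have ue': "u e' = - (?p + ?r)" using c[of e'] by simp
    have "?p \<bullet> u e' = 0"
      unfolding inner_sum_left using far[OF ee(1) _ _ ee(2) ne] by (intro sum.neutral) auto
    moreover have "?p \<bullet> ?r = 0"
      unfolding inner_sum_left inner_sum_right using block[OF ee(1)] by (intro sum.neutral ballI) auto
    ultimately have "?p \<bullet> ?p = 0" by (simp add: ue' inner_diff_right)
    then have p0: "?p = 0" unfolding inner_eq_zero_iff .
    have "0 \<le> ?c i" if "i \<in> J" for i using c0[OF ee(2) that] by simp
    then have "?c j = 0" using p0 ee(3) by (rule nonneg_combination_zero)
    then have "c e' j = 0" unfolding if_P[OF ee(4)] .
    then show False using ee(5) by (simp only: less_irrefl)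
  qed
  define block_of where "block_of j = (SOME e. e \<in> I - J \<and> 0 < c e j)" for j
  define meets where "meets j \<longleftrightarrow> (\<exists>e\<in>I - J. 0 < c e j)" for j
  define \<mu> where "\<mu> i = (if i \<in> I - J then l i else if meets i then l (block_of i) else 1)" for i
  have mu_block: "\<mu> j = l e" if e: "e \<in> I - J" "j \<in> J" "0 < c e j" for e j
  proof -
    have "meets j" using e unfolding meets_def by blast
    moreover have "block_of j = e"
      unfolding block_of_def
    proof (rule some_equality)
      show "e \<in> I - J \<and> 0 < c e j" using e by blast
      show "e' = e" if "e' \<in> I - J \<and> 0 < c e' j" for e'
        using disjoint[of e' e j] that e by blast
    qed
    ultimately show ?thesis using e(2) by (simp add: \<mu>_def)
  qed
  have mu_pos: "0 < \<mu> i" if "i \<in> I" for i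
  proof (cases "i \<in> J \<and> meets i")
    case True
    then obtain e where "e \<in> I - J" "\<mu> i = l e" using mu_block unfolding meets_def by blast
    then show ?thesis using l by simp
  next
    case False
    then show ?thesis using that l[of i] by (cases "i \<in> J") (simp_all add: \<mu>_def)
  qed
  \<comment> \<open>Different scales occur only for orthogonal roots; this makes D, diagonal in the
    basis of roots, self-adjoint.\<close>
  have mu_or: "\<mu> i = \<mu> j \<or> u i \<bullet> u j = 0" if ij: "i \<in> J" "j \<in> J" for i j
  proof (cases "\<exists>e\<in>I - J. 0 < c e i \<or> 0 < c e j")
    case True
    then obtain e where e: "e \<in> I - J" "0 < c e i \<or> 0 < c e j" by blast
    then consider "0 < c e i" "0 < c e j" | "0 < c e i" "\<not> 0 < c e j" | "0 < c e j" "\<not> 0 < c e i" by blast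
    then show ?thesis
    proof cases
      case 1
      then show ?thesis using mu_block[OF e(1)] ij by simp
    next
      case 2
      then show ?thesis using block[OF e(1) ij(1) _ ij(2)] by blast
    next
      case 3
      then show ?thesis using block[OF e(1) ij(2) _ ij(1)] by (simp add: inner_commute)
    qed
  next
    case False
    then have "\<not> meets i" "\<not> meets j" unfolding meets_def by blast+
    then have "\<mu> i = 1" "\<mu> j = 1" using ij by (simp_all add: \<mu>_def)
    then show ?thesis by simp
  qed
  obtain D where D: "linear D" "\<And>v. v \<in> u ` J \<Longrightarrow> D v = \<mu> (inv_into J u v) *\<^sub>R v"
    using linear_independent_extend[OF independent_J, of "\<lambda>v. \<mu> (inv_into J u v) *\<^sub>R v"] by auto
  have DJ: "D (u j) = \<mu> j *\<^sub>R u j" if "j \<in> J" for j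
    using D(2)[of "u j"] that inv_into_f_f[OF inj_on_u that] by simp
  have adj1: "x \<bullet> D (u j) = D x \<bullet> u j" if j: "j \<in> J" for x j
  proof -
    have "x \<in> span (u ` J)" by (simp add: span_J)
    then show ?thesis
    proof (induction rule: span_induct_alt)
      case (step r v w)
      then obtain i where i: "i \<in> J" "v = u i" by blast
      have "v \<bullet> D (u j) = D v \<bullet> u j"
        using mu_or[OF i(1) j] DJ[OF i(1)] DJ[OF j] i(2) by auto
      then show ?case using step
        by (simp add: linear_add[OF D(1)] linear_scale[OF D(1)] inner_add_left)
    qed (simp add: linear_0[OF D(1)])
  qed
  have adj: "x \<bullet> D y = D x \<bullet> y" for x y
  proof -
    have "y \<in> span (u ` J)" by (simp add: span_J)
    then show ?thesis
    proof (induction rule: span_induct_alt)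
      case (step r v w)
      then show ?case using adj1
        by (auto simp: linear_add[OF D(1)] linear_scale[OF D(1)] inner_add_right)
    qed (simp add: linear_0[OF D(1)])
  qed
  have eigen: "D (u i) = \<mu> i *\<^sub>R u i" if i: "i \<in> I" for i
  proof (cases "i \<in> J")
    case False
    then have e: "i \<in> I - J" using i by blast
    have "c i j *\<^sub>R D (u j) = \<mu> i *\<^sub>R (c i j *\<^sub>R u j)" if j: "j \<in> J" for j
    proof (cases "0 < c i j")
      case True
      then show ?thesis using DJ[OF j] mu_block[OF e j True] e by (simp add: \<mu>_def)
    next
      case False
      then have "c i j = 0" using c0[OF e j] by simp
      then show ?thesis by simp
    qed
    then have "(\<Sum>j\<in>J. c i j *\<^sub>R D (u j)) = \<mu> i *\<^sub>R (\<Sum>j\<in>J. c i j *\<^sub>R u j)"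
      by (simp add: scaleR_sum_right)
    moreover have "D (u i) = - (\<Sum>j\<in>J. c i j *\<^sub>R D (u j))"
      by (subst c) (simp add: linear_neg[OF D(1)] linear_sum[OF D(1)] linear_scale[OF D(1)])
    ultimately have "D (u i) = \<mu> i *\<^sub>R - (\<Sum>j\<in>J. c i j *\<^sub>R u j)" by (simp only: scaleR_minus_right)
    then show ?thesis unfolding c[of i, symmetric] .
  qed (rule DJ)
  have far_scale: "\<mu> e = l e" if "e \<in> I - J" for e using that by (simp add: \<mu>_def)
  show ?thesis using D(1) adj mu_pos eigen far_scale by (rule that)
qed

end

section \<open>Images of Coxeter polytopes and the main theorem\<close>

text \<open>By \<open>N_M\<close> the adjoint of M takes N f to \<mu> f times n f: the half-space of
  f goes to one with normal N f, at distance from the base point scaled by \<mu> f. M need not be a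
  similarity; equal Gram matrices keep the dihedral angles.\<close>

locale coxeter_polytope_image = coxeter_polytope P for P :: "'a::euclidean_space set" +
  fixes M :: "'a \<Rightarrow> 'a" and V W :: 'a and N :: "'a set \<Rightarrow> 'a" and \<mu> :: "'a set \<Rightarrow> real"
  assumes linear_M: "linear M" and inj_M: "inj M"
    and norm_N: "\<And>f. f \<in> facets P \<Longrightarrow> norm (N f) = 1"
    and mu_pos: "\<And>f. f \<in> facets P \<Longrightarrow> 0 < \<mu> f"
    and N_M: "\<And>f x. f \<in> facets P \<Longrightarrow> N f \<bullet> M x = \<mu> f * (n f \<bullet> x)"
    and N_product: "\<And>f g. f \<in> facets P \<Longrightarrow> g \<in> facets P \<Longrightarrow> N f \<bullet> N g = n f \<bullet> n g"
begin

definition q :: "'a \<Rightarrow> 'a" where "q x = W + M (x - V)"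

definition T :: "'a set" where "T = q ` P"

lemma q_image: "q ` S = (\<lambda>x. (W - M V) + x) ` (M ` S)"
  by (auto simp: q_def linear_diff[OF linear_M] image_image algebra_simps)

lemma inj_q: "inj q"
proof (rule injI)
  fix x y assume "q x = q y"
  then have "M (x - V) = M (y - V)" by (simp add: q_def)
  then have "x - V = y - V" using inj_M by (simp only: inj_eq)
  then show "x = y" by simp
qed

lemma aff_dim_q: "aff_dim (q ` S) = aff_dim S"
  unfolding q_image using aff_dim_injective_linear_image[OF linear_M inj_M]
  by (simp add: aff_dim_translation_eq)

lemma face_q: "q ` S face_of q ` P \<longleftrightarrow> S face_of P"
  unfolding q_image face_of_translation_eq using face_of_linear_image[OF linear_M inj_M] .

lemma facet_q: "q ` f facet_of T \<longleftrightarrow> f facet_of P"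
  unfolding facet_of_def T_def aff_dim_q face_q by simp

lemma facets_T: "facets T = (\<lambda>f. q ` f) ` facets P"
proof (intro equalityI subsetI)
  fix F assume F: "F \<in> facets T"
  then have "F \<subseteq> q ` P" unfolding T_def[symmetric] facets_def using facet_of_imp_subset by auto
  then obtain f where f: "F = q ` f" by (meson subset_imageE)
  then show "F \<in> (\<lambda>f. q ` f) ` facets P" using F facet_q by (auto simp: facets_def)
qed (use facet_q in \<open>auto simp: facets_def\<close>)

lemma polyhedron_T: "polyhedron T"
proof -
  have "bij M" using linear_M inj_M linear_injective_imp_surjective by (auto simp: bij_def)
  then have "polyhedron (M ` P)" using polyhedron linear_M polyhedron_linear_image_eq by blast
  then obtain H where H: "finite H" "M ` P = \<Inter>H" "\<forall>h\<in>H. \<exists>a b. a \<noteq> 0 \<and> h = {x. a \<bullet> x \<le> b}"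
    unfolding polyhedron_def by blast
  have translate: "(\<lambda>x. c + x) ` {x. a \<bullet> x \<le> b} = {x. a \<bullet> x \<le> b + a \<bullet> c}" for a c :: 'a and b
  proof (intro equalityI subsetI)
    fix x assume "x \<in> {x. a \<bullet> x \<le> b + a \<bullet> c}"
    then show "x \<in> (\<lambda>x. c + x) ` {x. a \<bullet> x \<le> b}"
      by (intro image_eqI[of _ _ "x - c"]) (simp_all add: inner_diff_right)
  qed (auto simp: inner_add_right)
  let ?H = "(\<lambda>h. (\<lambda>x. (W - M V) + x) ` h) ` H"
  have bij: "bij (\<lambda>x. (W - M V) + x)" by (simp add: bij_def)
  have "T = \<Inter>?H" unfolding T_def q_image H(2) using bij_image_INT[OF bij, of "\<lambda>h. h" H] by simp
  moreover have "\<forall>h\<in>?H. \<exists>a b. a \<noteq> 0 \<and> h = {x. a \<bullet> x \<le> b}"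
  proof
    fix h' assume "h' \<in> ?H"
    then obtain h where h: "h \<in> H" "h' = (\<lambda>x. (W - M V) + x) ` h" by blast
    obtain a b where ab: "a \<noteq> 0" "h = {x. a \<bullet> x \<le> b}" using H(3) h(1) by blast
    have "h' = {x. a \<bullet> x \<le> b + a \<bullet> (W - M V)}" unfolding h(2) ab(2) by (rule translate)
    then show "\<exists>a b. a \<noteq> 0 \<and> h' = {x. a \<bullet> x \<le> b}" using ab(1) by blast
  qed
  ultimately show ?thesis using H(1) unfolding polyhedron_def by blast
qed

lemma interior_T: "interior T \<noteq> {}"
  using interior unfolding T_def q_image interior_translation
  by (simp add: interior_injective_linear_image[OF linear_M inj_M])

lemma normals_T:
  assumes f: "f \<in> facets P"
  shows "outer_normal T (q ` f) = N f" "facet_offset T (q ` f) = N f \<bullet> W + \<mu> f * (d f - n f \<bullet> V)"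
proof -
  have Nq: "N f \<bullet> q x = N f \<bullet> W + \<mu> f * (n f \<bullet> x - n f \<bullet> V)" for x
    by (simp add: q_def inner_add_right N_M[OF f] inner_diff_right)
  have facet: "q ` f facet_of T" using f facet_q by (simp add: facets_def)
  have le: "T \<subseteq> {y. N f \<bullet> y \<le> N f \<bullet> W + \<mu> f * (d f - n f \<bullet> V)}"
    unfolding T_def using n_le[OF f] mu_pos[OF f] Nq by auto
  have "q ` f = T \<inter> {y. N f \<bullet> y = N f \<bullet> W + \<mu> f * (d f - n f \<bullet> V)}"
  proof -
    have "f = {x \<in> P. N f \<bullet> q x = N f \<bullet> W + \<mu> f * (d f - n f \<bullet> V)}"
      using mu_pos[OF f] by (subst facet_eq[OF f]) (simp add: Nq)
    then show ?thesis unfolding T_def by blast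
  qed
  then show "outer_normal T (q ` f) = N f" "facet_offset T (q ` f) = N f \<bullet> W + \<mu> f * (d f - n f \<bullet> V)"
    using outer_normal_eqI[OF interior_T facet norm_N[OF f] le] by simp_all
qed

lemma euclidean_coxeter_polytope_T: "euclidean_coxeter_polytope T"
  unfolding euclidean_coxeter_polytope_def
proof (intro conjI allI impI)
  have "bounded (M ` P)" using bounded linear_M by (simp add: bounded_linear_image linear_linear)
  then have "bounded T" unfolding T_def q_image by (rule bounded_translation)
  then show "emeasure lborel T < \<infinity>" using emeasure_bounded_finite by auto
  fix F G assume FG: "adjacent_facets T F G"
  then obtain f g where fg: "f \<in> facets P" "g \<in> facets P" "F = q ` f" "G = q ` g"
    unfolding adjacent_facets_def facets_T by blast
  have Int: "F \<inter> G = q ` (f \<inter> g)" unfolding fg using inj_q by (rule image_Int[symmetric])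
  have "aff_dim T = aff_dim P" by (simp add: T_def aff_dim_q)
  then have "adjacent_facets P f g"
    using FG unfolding adjacent_facets_def Int aff_dim_q using fg by auto
  then obtain m :: nat where "m \<ge> 2" "dihedral_angle P f g = pi / real m"
    using coxeter by (auto simp: euclidean_coxeter_polytope_def)
  moreover have "dihedral_angle T F G = dihedral_angle P f g"
    unfolding dihedral_angle_def fg normals_T(1)[OF fg(1)] normals_T(1)[OF fg(2)] N_product[OF fg(1,2)] ..
  ultimately show "\<exists>m::nat. m \<ge> 2 \<and> dihedral_angle T F G = pi / real m" by metis
qed (fact polyhedron_T interior_T)+

lemma same_coxeter_diagram_T: "same_coxeter_diagram T P"
proof -
  have "inj_on (\<lambda>f. q ` f) (facets P)" using inj_q by (simp add: inj_on_def inj_image_eq_iff)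
  then have bij: "bij_betw (\<lambda>f. q ` f) (facets P) (facets T)" by (simp add: bij_betw_def facets_T)
  define \<pi> where "\<pi> = inv_into (facets P) (\<lambda>f. q ` f)"
  have "coxeter_edge P (\<pi> F) (\<pi> G) = coxeter_edge T F G" if FG: "F \<in> facets T" "G \<in> facets T" "F \<noteq> G" for F G
  proof -
    obtain f g where fg: "f \<in> facets P" "g \<in> facets P" "F = q ` f" "G = q ` g"
      using FG unfolding facets_T by blast
    have pi: "\<pi> F = f" "\<pi> G = g" using bij fg by (simp_all add: \<pi>_def bij_betw_inv_into_left)
    have "f \<noteq> g" using FG(3) fg by blast
    have T: "coxeter_polytope T" using euclidean_coxeter_polytope_T by (rule coxeter_polytope.intro)
    show ?thesis
      unfolding coxeter_polytope.coxeter_edge_eq[OF T FG] pi coxeter_edge_eq[OF fg(1,2) \<open>f \<noteq> g\<close>]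
      unfolding fg(3,4) normals_T(1)[OF fg(1)] normals_T(1)[OF fg(2)] N_product[OF fg(1,2)] ..
  qed
  then show ?thesis unfolding same_coxeter_diagram_def using bij_betw_inv_into[OF bij] \<pi>_def by blast
qed

end

section \<open>From group embeddings to isometries and subpolytopes\<close>

lemma (in coxeter_polytope) hrefl_in_vertex_group_iff:
  assumes "V \<in> P" "norm v = 1"
  shows "hrefl v b \<in> carrier (vertex_group P V) \<longleftrightarrow> hrefl v b \<in> G \<and> b = v \<bullet> V"
  using carrier_vertex_group[OF assms(1)] hrefl_fixes_iff[OF assms(2)] by auto

lemma hrefl_scale:
  assumes "\<epsilon> = 1 \<or> \<epsilon> = - (1::real)" shows "hrefl (\<epsilon> *\<^sub>R v) (\<epsilon> *\<^sub>R v \<bullet> W) = hrefl v (v \<bullet> W)"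
  using assms by (auto simp: hrefl_def fun_eq_iff algebra_simps)

lemma unit_product_square_one:
  fixes v w :: "'a::real_inner"
  assumes "norm v = 1" "norm w = 1" "\<not> (v \<bullet> w)\<^sup>2 < 1"
  shows "w = v \<or> w = - v"
proof -
  have "\<bar>v \<bullet> w\<bar> \<le> 1" using Cauchy_Schwarz_ineq2[of v w] assms by simp
  then have sq: "(v \<bullet> w)\<^sup>2 = 1" using assms(3) by (metis abs_square_less_1 abs_square_eq_1 le_less)
  have vw: "v \<bullet> v = 1" "w \<bullet> w = 1" using assms(1,2) by (simp_all add: dot_square_norm)
  have "(w - (v \<bullet> w) *\<^sub>R v) \<bullet> (w - (v \<bullet> w) *\<^sub>R v) = 1 - (v \<bullet> w)\<^sup>2"
    by (simp add: inner_diff_left inner_diff_right vw inner_commute[of w v] power2_eq_square)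
  then have "w = (v \<bullet> w) *\<^sub>R v" using sq by simp
  then show ?thesis using sq by (metis power2_eq_1_iff scaleR_minus1_left scaleR_one)
qed

lemma hrefl_eq_imp:
  fixes v w :: "'a::euclidean_space"
  assumes "norm v = 1" "norm w = 1" "hrefl v (v \<bullet> V) = hrefl w (w \<bullet> V)"
  shows "\<not> (v \<bullet> w)\<^sup>2 < 1"
proof -
  have "hrefl v (v \<bullet> V) (V + v) = hrefl w (w \<bullet> V) (V + v)" using assms(3) by simp
  then have "2 *\<^sub>R v = 2 *\<^sub>R ((w \<bullet> v) *\<^sub>R w)" unfolding hrefl_at using assms(1) by (simp add: dot_square_norm)
  then have "v = (w \<bullet> v) *\<^sub>R w" unfolding scaleR_cancel_left by simp
  then have "v \<bullet> v = (w \<bullet> v) * (w \<bullet> v)" by (metis inner_scaleR_left)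
  then show ?thesis using assms(1) by (simp add: dot_square_norm power2_eq_square inner_commute)
qed

context special_chamber
begin

lemma J_product_square:
  assumes "i \<in> J" "j \<in> J" "i \<noteq> j" shows "(u i \<bullet> u j)\<^sup>2 < 1"
proof (rule ccontr)
  assume "\<not> (u i \<bullet> u j)\<^sup>2 < 1"
  then have "u j = u i \<or> u j = - u i"
    using assms J_sub by (intro unit_product_square_one) auto
  moreover have "u i \<noteq> u j" using inj_on_u assms by (auto simp: inj_on_def)
  moreover obtain z where z: "\<And>i. i \<in> I \<Longrightarrow> u i \<bullet> z < b i" using interior_point by blast
  moreover have "u i \<bullet> z < u i \<bullet> V" "u j \<bullet> z < u j \<bullet> V" using z assms by (auto simp: J_def)
  ultimately show False by auto
qed

text \<open>A nonzero \<open>4 * (u i \<bullet> u j)\<^sup>2\<close> is a positive integer. The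
  resulting gap is what bounds the number of edges in \<open>exists_signs\<close>.\<close>

lemma J_product_bound:
  assumes "i \<in> J" "j \<in> J" "i \<noteq> j" shows "u i \<bullet> u j = 0 \<or> u i \<bullet> u j \<le> - 1 / 2"
proof -
  have I: "i \<in> I" "j \<in> I" using assms J_sub by auto
  obtain k :: int where k: "4 * (u i \<bullet> u j)\<^sup>2 = of_int k"
    using crystallographic[of "u i" "u j"] I reflection_in_linear_part by auto
  have np: "u i \<bullet> u j \<le> 0" using I assms(3) by (rule u_nonpos)
  show ?thesis
  proof (cases "u i \<bullet> u j = 0")
    case False
    then have "0 < 4 * (u i \<bullet> u j)\<^sup>2" by simp
    then have "1 \<le> k" unfolding k by simp
    then have "(1 / 2)\<^sup>2 \<le> (- (u i \<bullet> u j))\<^sup>2" using k by (simp add: power2_eq_square)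
    then have "1 / 2 \<le> - (u i \<bullet> u j)" using np by (intro power2_le_imp_le[of "1 / 2"]) auto
    then show ?thesis by simp
  qed simp
qed

lemma J_sum_nonzero:
  assumes "K \<subseteq> J" "K \<noteq> {}" shows "(\<Sum>i\<in>K. u i) \<noteq> 0"
proof
  assume sum0: "(\<Sum>i\<in>K. u i) = 0"
  obtain k where k: "k \<in> K" using assms by blast
  let ?c = "\<lambda>i. if i \<in> K then 1 else 0 :: real"
  have "(\<Sum>j\<in>J. ?c j *\<^sub>R u j) = (\<Sum>j\<in>J. if j \<in> K then u j else 0)" by (intro sum.cong) auto
  also have "\<dots> = (\<Sum>j\<in>K. u j)" using assms(1) finite_J by (simp add: sum.inter_restrict[symmetric] Int_absorb1)
  finally have "(\<Sum>j\<in>J. ?c j *\<^sub>R u j) = 0" using sum0 by simp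
  then have "?c k = 0" using k assms(1) by (intro nonneg_combination_zero[of ?c]) auto
  then show False using k by simp
qed

end

lemma isometry_of_embedding:
  fixes F P :: "'a::euclidean_space set"
  assumes P: "coxeter_polytope_vertex P V" and F: "coxeter_polytope_vertex F W"
    and \<phi>: "reflection_group_embedding (vertex_group P V) (vertex_group F W) \<phi>"
  obtains A where "orthogonal_transformation A"
    "\<And>g. g \<in> carrier (vertex_group P V) \<Longrightarrow> conjugate A V W g \<in> carrier (vertex_group F W)"
proof -
  interpret P: coxeter_polytope_vertex P V by fact
  interpret F: coxeter_polytope_vertex F W by fact
  let ?GP = "vertex_group P V" and ?GF = "vertex_group F W"
  note car_P = P.carrier_vertex_group[OF P.V_in_P] and car_F = F.carrier_vertex_group[OF F.V_in_P]
  have J: "f \<in> facets P" "P.n f \<bullet> V = P.d f" if "f \<in> P.J" for f using that by (auto simp: P.J_def)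
  have s_eq: "P.s f = hrefl (P.n f) (P.n f \<bullet> V)" if "f \<in> P.J" for f
    using J[OF that] by (simp add: P.s_def)
  have s_in: "P.s f \<in> carrier ?GP" if "f \<in> P.J" for f
    using J[OF that] P.s_in_G P.s_fixes by (simp add: car_P)
  have closed: "g \<circ> h \<in> carrier ?GP" if "g \<in> carrier ?GP" "h \<in> carrier ?GP" for g h
    using that P.comp_in_G by (simp add: car_P)
  have hom: "\<phi> g \<in> carrier ?GF" if "g \<in> carrier ?GP" for g
    using \<phi> that by (auto simp: reflection_group_embedding_def mon_def hom_def)
  have mult: "\<phi> (g \<circ> h) = \<phi> g \<circ> \<phi> h" if g: "g \<in> carrier ?GP" and h: "h \<in> carrier ?GP" for g h
  proof -
    have "\<phi> (g \<otimes>\<^bsub>?GP\<^esub> h) = \<phi> g \<otimes>\<^bsub>?GF\<^esub> \<phi> h"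
      using \<phi> g h by (simp add: reflection_group_embedding_def mon_def hom_def)
    then show ?thesis
      using mult_vertex_group[OF P.coxeter_polytope_axioms P.V_in_P g h]
        mult_vertex_group[OF F.coxeter_polytope_axioms F.V_in_P hom[OF g] hom[OF h]] by simp
  qed
  have inj: "\<phi> g = \<phi> h \<longleftrightarrow> g = h" if "g \<in> carrier ?GP" "h \<in> carrier ?GP" for g h
    using \<phi> that by (auto simp: reflection_group_embedding_def mon_def inj_on_def)
  have "\<exists>v. norm v = 1 \<and> \<phi> (P.s f) = hrefl v (v \<bullet> W)" if f: "f \<in> P.J" for f
  proof -
    have "is_reflection (P.s f)" using J[OF f] P.norm_n unfolding is_reflection_iff P.s_def by blast
    then have "is_reflection (\<phi> (P.s f))" using \<phi> s_in[OF f] by (simp add: reflection_group_embedding_def)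
    then obtain v b where v: "norm v = 1" "\<phi> (P.s f) = hrefl v b" unfolding is_reflection_iff by blast
    then have "b = v \<bullet> W"
      using hom[OF s_in[OF f]] F.hrefl_in_vertex_group_iff[OF F.V_in_P v(1), of b] by simp
    then show ?thesis using v by blast
  qed
  then obtain \<beta> where beta: "\<And>f. f \<in> P.J \<Longrightarrow> norm (\<beta> f) = 1"
    "\<And>f. f \<in> P.J \<Longrightarrow> \<phi> (P.s f) = hrefl (\<beta> f) (\<beta> f \<bullet> W)" by metis
  have beta_lin: "hrefl (\<beta> f) 0 \<in> linear_part ` F.G" if f: "f \<in> P.J" for f
  proof -
    have "\<phi> (P.s f) \<in> F.G" using hom[OF s_in[OF f]] car_F by simp
    moreover have "linear_part (\<phi> (P.s f)) = hrefl (\<beta> f) 0" using beta(2)[OF f] by simp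
    ultimately show ?thesis by (metis imageI)
  qed
  \<comment> \<open>Parallel normals at W would make the images of two distinct reflections equal,
    against injectivity.\<close>
  have beta_lt: "(\<beta> f \<bullet> \<beta> g)\<^sup>2 < 1" if fg: "f \<in> P.J" "g \<in> P.J" "f \<noteq> g" for f g
  proof (rule ccontr)
    assume "\<not> (\<beta> f \<bullet> \<beta> g)\<^sup>2 < 1"
    then have "\<beta> g = \<beta> f \<or> \<beta> g = - \<beta> f" using beta(1) fg by (intro unit_product_square_one) auto
    then have "hrefl (\<beta> g) (\<beta> g \<bullet> W) = hrefl (\<beta> f) (\<beta> f \<bullet> W)"
      using hrefl_scale[of "- 1" "\<beta> f" W] by auto
    then have "P.s f = P.s g" using inj s_in beta(2) fg by metis
    then show False
      using hrefl_eq_imp[of "P.n f" "P.n g" V] P.J_product_square[OF fg] s_eq J(1) fg P.norm_n by metis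
  qed
  have square: "(P.n f \<bullet> P.n g)\<^sup>2 = (\<beta> f \<bullet> \<beta> g)\<^sup>2" if fg: "f \<in> P.J" "g \<in> P.J" for f g
  proof (cases "f = g")
    case True
    then show ?thesis using beta(1)[OF fg(1)] J(1)[OF fg(1)] by (simp add: dot_square_norm)
  next
    case False
    have nf: "norm (P.n f) = 1" "norm (P.n g) = 1" using J(1) fg by simp_all
    obtain k :: int where k: "4 * (P.n f \<bullet> P.n g)\<^sup>2 = of_int k"
      by (rule P.crystallographic[OF nf(1) P.reflection_in_linear_part[OF J(1)[OF fg(1)]]
            nf(2) P.reflection_in_linear_part[OF J(1)[OF fg(2)]]])
    obtain k' :: int where k': "4 * (\<beta> f \<bullet> \<beta> g)\<^sup>2 = of_int k'"
      by (rule F.crystallographic[OF beta(1)[OF fg(1)] beta_lin[OF fg(1)]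
            beta(1)[OF fg(2)] beta_lin[OF fg(2)]])
    note sf = s_in[OF fg(1)] and sg = s_in[OF fg(2)]
    show ?thesis
    proof (rule product_square_determined[OF nf P.J_product_square[OF fg False] k
          beta(1)[OF fg(1)] beta(1)[OF fg(2)] beta_lt[OF fg False] k'
          s_eq[OF fg(1)] s_eq[OF fg(2)] beta(2)[OF fg(1)] beta(2)[OF fg(2)]])
      show "(P.s f \<circ> P.s g = P.s g \<circ> P.s f) \<longleftrightarrow> (\<phi> (P.s f) \<circ> \<phi> (P.s g) = \<phi> (P.s g) \<circ> \<phi> (P.s f))"
        using inj[OF closed[OF sf sg] closed[OF sg sf]] by (simp only: mult closed sf sg)
      show "(P.s f \<circ> P.s g \<circ> P.s f = P.s g \<circ> P.s f \<circ> P.s g) \<longleftrightarrow>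
        (\<phi> (P.s f) \<circ> \<phi> (P.s g) \<circ> \<phi> (P.s f) = \<phi> (P.s g) \<circ> \<phi> (P.s f) \<circ> \<phi> (P.s g))"
        using inj[OF closed[OF closed[OF sf sg] sf] closed[OF closed[OF sg sf] sg]] by (simp only: mult closed sf sg)
      show "(P.s f \<circ> P.s g \<circ> P.s f \<circ> P.s g = P.s g \<circ> P.s f \<circ> P.s g \<circ> P.s f) \<longleftrightarrow>
        (\<phi> (P.s f) \<circ> \<phi> (P.s g) \<circ> \<phi> (P.s f) \<circ> \<phi> (P.s g) = \<phi> (P.s g) \<circ> \<phi> (P.s f) \<circ> \<phi> (P.s g) \<circ> \<phi> (P.s f))"
        using inj[OF closed[OF closed[OF closed[OF sf sg] sf] sg] closed[OF closed[OF closed[OF sg sf] sg] sf]] by (simp only: mult closed sf sg)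
    qed
  qed
  have "\<exists>\<epsilon>::'a set \<Rightarrow> real. (\<forall>i. \<epsilon> i = 1 \<or> \<epsilon> i = - 1) \<and>
     (\<forall>i\<in>P.J. \<forall>j\<in>P.J. P.n i \<bullet> P.n j = (\<epsilon> i * \<epsilon> j) * (\<beta> i \<bullet> \<beta> j))"
    using P.finite_J P.norm_n[OF J(1)] P.J_product_bound square P.J_sum_nonzero by (rule exists_signs)
  then obtain \<epsilon> :: "'a set \<Rightarrow> real" where eps: "\<And>i. \<epsilon> i = 1 \<or> \<epsilon> i = - 1"
    "\<And>i j. i \<in> P.J \<Longrightarrow> j \<in> P.J \<Longrightarrow> P.n i \<bullet> P.n j = (\<epsilon> i * \<epsilon> j) * (\<beta> i \<bullet> \<beta> j)" by blast
  \<comment> \<open>Signs do not change reflections, so conjugation by the motion agrees with \<phi>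
    on the generators.\<close>
  obtain A where A: "orthogonal_transformation A" "\<And>f. f \<in> P.J \<Longrightarrow> A (P.n f) = \<epsilon> f *\<^sub>R \<beta> f"
  proof (rule exists_isometry_of_gram[of P.J P.n "\<lambda>f. \<epsilon> f *\<^sub>R \<beta> f"])
    show "P.n i \<bullet> P.n j = \<epsilon> i *\<^sub>R \<beta> i \<bullet> \<epsilon> j *\<^sub>R \<beta> j" if "i \<in> P.J" "j \<in> P.J" for i j
      using eps(2)[OF that] by simp
    show "v = 0" if "\<And>i. i \<in> P.J \<Longrightarrow> P.n i \<bullet> v = 0" for v
      using that by (intro P.vertex) (auto simp: P.J_def)
  qed blast
  have "conjugate A V W g \<in> carrier ?GF" if g: "g \<in> carrier ?GP" for g
  proof (rule conjugate_vertex_group[OF P.coxeter_polytope_axioms P.V_in_P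
        F.coxeter_polytope_axioms F.V_in_P A(1) _ g])
    fix f assume f: "f \<in> facets P" "P.n f \<bullet> V = P.d f"
    then have fJ: "f \<in> P.J" by (simp add: P.J_def)
    have "hrefl (A (P.n f)) (A (P.n f) \<bullet> W) = \<phi> (P.s f)"
      unfolding A(2)[OF fJ] hrefl_scale[OF eps(1)] beta(2)[OF fJ] ..
    then show "hrefl (A (P.n f)) (A (P.n f) \<bullet> W) \<in> carrier (coxeter_group F)"
      using hom[OF s_in[OF fJ]] car_F F.carrier_coxeter_group by simp
  qed
  then show ?thesis using that A(1) by blast
qed

theorem subpolytope_of_embedding:
  fixes F P :: "'a::euclidean_space set"
  assumes P: "coxeter_polytope_vertex P V" and F: "coxeter_polytope_vertex F W"
    and \<phi>: "reflection_group_embedding (vertex_group P V) (vertex_group F W) \<phi>"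
  shows "\<exists>T :: 'a set. euclidean_coxeter_polytope T \<and> same_coxeter_diagram T P \<and>
            carrier (coxeter_group T) \<subseteq> carrier (coxeter_group F)"
proof -
  interpret P: coxeter_polytope_vertex P V by fact
  interpret F: coxeter_polytope_vertex F W by fact
  obtain A where A: "orthogonal_transformation A"
    "\<And>g. g \<in> carrier (vertex_group P V) \<Longrightarrow> conjugate A V W g \<in> carrier (vertex_group F W)"
    using isometry_of_embedding[OF assms] by blast
  have AI: "A v \<bullet> A w = v \<bullet> w" and lin_A: "linear A" for v w
    using A(1) by (auto simp: orthogonal_transformation_def)
  \<comment> \<open>This includes the facets missing V: as V is special, the parallel reflection at
    V belongs to the vertex group and is carried over by the conjugation.\<close>
  have wall: "hrefl (A (P.n f)) (A (P.n f) \<bullet> W) \<in> F.G" if f: "f \<in> facets P" for f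
  proof -
    have "hrefl (P.n f) (P.n f \<bullet> V) \<in> P.G"
      using P.hrefl_at_V_in_G P.reflection_in_linear_part[OF f] by blast
    then have "hrefl (P.n f) (P.n f \<bullet> V) \<in> carrier (vertex_group P V)"
      using P.hrefl_in_vertex_group_iff[OF P.V_in_P P.norm_n[OF f]] by blast
    then have "conjugate A V W (hrefl (P.n f) (P.n f \<bullet> V)) \<in> carrier (vertex_group F W)" by (rule A(2))
    then show ?thesis using F.carrier_vertex_group[OF F.V_in_P] by (simp add: conjugate_hrefl[OF A(1)])
  qed
  have nA: "norm (A (P.n f)) = 1" if "f \<in> facets P" for f
    using that orthogonal_transformation_norm[OF A(1)] by simp
  have "\<exists>r. r > 0 \<and> (2 * r) *\<^sub>R A (P.n f) \<in> F.translation_lattice" if f: "f \<in> facets P" for f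
  proof -
    have "linear_part (hrefl (A (P.n f)) (A (P.n f) \<bullet> W)) \<in> linear_part ` F.G" using wall[OF f] by (rule imageI)
    then show ?thesis using F.root_translation[OF nA[OF f]] by (metis linear_part_hrefl)
  qed
  then obtain r where r: "\<And>f. f \<in> facets P \<Longrightarrow> r f > 0"
    "\<And>f. f \<in> facets P \<Longrightarrow> (2 * r f) *\<^sub>R A (P.n f) \<in> F.translation_lattice" by metis
  \<comment> \<open>The scale that puts the image of a far facet at distance r f from W.\<close>
  define l where "l f = r f / (P.d f - P.n f \<bullet> V)" for f
  have depth_pos: "0 < P.d f - P.n f \<bullet> V" if "f \<in> facets P - P.J" for f
    using that P.n_le[OF _ P.V_in_P, of f] by (auto simp: P.J_def less_le)
  then have "0 < l f" if "f \<in> facets P - P.J" for f using that r(1) by (simp add: l_def)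
  then obtain D \<mu> where D: "linear D" "\<And>x y. x \<bullet> D y = D x \<bullet> y" "\<And>f. f \<in> facets P \<Longrightarrow> 0 < \<mu> f"
    "\<And>f. f \<in> facets P \<Longrightarrow> D (P.n f) = \<mu> f *\<^sub>R P.n f" "\<And>f. f \<in> facets P - P.J \<Longrightarrow> \<mu> f = l f"
    using P.block_scaling[of l] by blast
  have eigen: "A (P.n f) \<bullet> (A \<circ> D) x = \<mu> f * (P.n f \<bullet> x)" if f: "f \<in> facets P" for f x
    using D(2)[of "P.n f" x] D(4)[OF f] by (simp add: AI)
  interpret T: coxeter_polytope_image P "A \<circ> D" V W "\<lambda>f. A (P.n f)" \<mu>
  proof (intro coxeter_polytope_image.intro coxeter_polytope_image_axioms.intro)
    show lin: "linear (A \<circ> D)" using D(1) lin_A by (rule linear_compose)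
    have "x = 0" if x: "(A \<circ> D) x = 0" for x
    proof (rule P.vertex)
      fix f assume f: "f \<in> facets P"
      have "\<mu> f * (P.n f \<bullet> x) = 0" using eigen[OF f, of x] x by simp
      then show "P.n f \<bullet> x = 0" using D(3)[OF f] by simp
    qed
    then show "inj (A \<circ> D)" using linear_injective_0[OF lin] by blast
  qed (use nA D(3) eigen AI P.coxeter_polytope_axioms in \<open>auto simp del: comp_apply\<close>)
  interpret T': coxeter_polytope T.T using T.euclidean_coxeter_polytope_T by (rule coxeter_polytope.intro)
  have s_in: "T'.s h \<in> F.G" if "h \<in> facets T.T" for h
  proof -
    obtain f where f: "f \<in> facets P" "h = T.q ` f" using \<open>h \<in> facets T.T\<close> unfolding T.facets_T by blast
    have s: "T'.s h = hrefl (A (P.n f)) (A (P.n f) \<bullet> W + \<mu> f * (P.d f - P.n f \<bullet> V))"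
      unfolding T'.s_def f(2) T.normals_T[OF f(1)] ..
    show ?thesis
    proof (cases "f \<in> P.J")
      case True
      then show ?thesis using wall[OF f(1)] unfolding s by (simp add: P.J_def)
    next
      case False
      then have "\<mu> f * (P.d f - P.n f \<bullet> V) = r f"
        using D(5)[of f] depth_pos[of f] f(1) by (simp add: l_def)
      \<comment> \<open>The reflection in a mirror at distance r f from W is the parallel reflection
        at W followed by the translation by twice that distance.\<close>
      then have "T'.s h = (\<lambda>x. x + (2 * r f) *\<^sub>R A (P.n f)) \<circ> hrefl (A (P.n f)) (A (P.n f) \<bullet> W)"
        unfolding s by (simp add: hrefl_def fun_eq_iff algebra_simps)
      moreover have "(\<lambda>x. x + (2 * r f) *\<^sub>R A (P.n f)) \<in> F.G"
        using r(2)[OF f(1)] by (simp add: F.translation_lattice_def)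
      ultimately show ?thesis using F.comp_in_G[OF _ wall[OF f(1)]] by simp
    qed
  qed
  have "T'.G \<subseteq> F.G"
  proof
    fix g assume "g \<in> T'.G"
    then show "g \<in> F.G"
    proof (induction rule: T'.G_induct)
      case (s h g)
      show ?case using F.comp_in_G[OF s_in[OF s(1)] s(3)] .
    qed (rule F.id_in_G)
  qed
  then show ?thesis
    using T.euclidean_coxeter_polytope_T T.same_coxeter_diagram_T
      T'.carrier_coxeter_group F.carrier_coxeter_group by blast
qed

theorem theorem2:
  fixes F P :: "'a::euclidean_space set" and V W :: 'a
  assumes "euclidean_coxeter_polytope F" and "euclidean_coxeter_polytope P"
    and "special_vertex P V" and "special_vertex F W"
  shows "(\<exists>T :: 'a set. euclidean_coxeter_polytope T \<and> same_coxeter_diagram T P \<and>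
            carrier (coxeter_group T) \<subseteq> carrier (coxeter_group F))
     \<longleftrightarrow> (\<exists>\<phi>. reflection_group_embedding (vertex_group P V) (vertex_group F W) \<phi>)"
proof -
  have P: "coxeter_polytope_vertex P V" and F: "coxeter_polytope_vertex F W"
    using assms by (simp_all add: coxeter_polytope_vertex_def coxeter_polytope_def coxeter_polytope_vertex_axioms_def)
  show ?thesis
    using embedding_of_subpolytope[OF P F] subpolytope_of_embedding[OF P F]
    by (metis coxeter_polytope.intro)
qed

end
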